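(* Let $\Omega,\ell,Q,f,\omega,\bar\varsigma,\varphi$ satisfy the standing assumptions listed in the context, and assume $\bar\varsigma=\infty$. Let $\{(u_\varepsilon,v_\varepsilon)\}_{\varepsilon>0}\subset L^1(\Omega,\mathbb R^2)$ be such that $$\sup_{\varepsilon>0}\big(\mathcal F_\varepsilon(u_\varepsilon,v_\varepsilon)+\|u_\varepsilon\|_{L^1(\Omega)}\big)<\infty.$$ Then there are a sequence $\{\varepsilon_k\}_{k\in\mathbb N}$ with $\varepsilon_k\to0^+$ and $u\in L^1\cap GSBV(\Omega)$ with $u'\in L^2(\Omega)$ such that $(u_{\varepsilon_k},v_{\varepsilon_k})\to(u,1)$ $\mathcal L^1$-a.e. on $\Omega$. If, moreover, $(u_\varepsilon)_\varepsilon$ is equi-integrable, then $u_{\varepsilon_k}\to u$ in $L^1(\Omega)$.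
   Context: Standing assumptions. $\Omega\subset\mathbb R$ is a bounded open interval. $\ell,Q\in C^0([0,1],[0,\infty))$, $\ell(1)=1$, $\ell^{-1}(\{0\})=Q^{-1}(\{0\})=\{0\}$, $Q$ is non-decreasing in a right neighbourhood of $0$, and $f(t):=\big(\ell(t)/Q(1-t)\big)^{1/2}$, $t\in[0,1)$, is non-decreasing in a left neighbourhood of $t=1$. $\omega\in C^0([0,1],[0,\infty))$, $\omega^{-1}(\{0\})=\{0\}$, and the limit $\bar\varsigma:=\lim_{t\to0^+}(\omega(t)/Q(t))^{1/2}\in[0,\infty]$ exists. $\varphi\in C^0([0,\infty))$ is non-negative and non-decreasing, $\varphi(\infty):=\lim_{t\to\infty}\varphi(t)\in(0,\infty)$, $\varphi^{-1}(\{0\})=\{0\}$, and $\varphi$ is right-differentiable at $0$ with $\varphi'(0^+)\in(0,\infty)$. Phase-field functionals. For $\varepsilon>0$, $\mathcal F_\varepsilon:L^1(\Omega,\mathbb R^2)\to[0,\infty]$ is $$\mathcal F_\varepsilon(u,v):=\int_\Omega\Big(\varphi(\varepsilon f^2(v))|u'|^2+\frac{\omega(1-v)}{4\varepsilon}+\varepsilon|v'|^2\Big)dx$$ if $(u,v)\in H^1(\Omega,\mathbb R\times[0,1])$, and $\infty$ otherwise; $t\mapsto\varphi(\varepsilon f^2(t))$ is extended to $t=1$ with value $\varphi(\infty)$. $GSBV(\Omega)$ is the space of generalized special functions of bounded variation; for such $u$, $u'$ denotes the approximate gradient. *)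

theory Defs
  imports "HOL-Analysis.Analysis"
begin

text \<open>
  Functions on an open set \<open>U\<close> of reals are represented by total functions, whose values outside
  \<open>U\<close> (and on null subsets of \<open>U\<close>) are irrelevant; all spaces are taken with respect to
  \<open>lebesgue_on U\<close>.
\<close>

definition L1 :: "real set \<Rightarrow> (real \<Rightarrow> real) set" where
  "L1 U = {u. integrable (lebesgue_on U) u}"

definition L2 :: "real set \<Rightarrow> (real \<Rightarrow> real) set" where
  "L2 U = {u \<in> borel_measurable (lebesgue_on U). integrable (lebesgue_on U) (\<lambda>x. (u x)\<^sup>2)}"

definition L1_norm :: "real set \<Rightarrow> (real \<Rightarrow> real) \<Rightarrow> real" where
  "L1_norm U u = (LINT x|lebesgue_on U. \<bar>u x\<bar>)"

text \<open>Test functions \<open>C\<^sub>c\<^sup>1(U)\<close>, as customary for one-dimensional Sobolev and BV functions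
  (testing with \<open>C\<^sub>c\<^sup>\<infinity>(U)\<close> gives the same spaces and derivatives, by mollification).\<close>

definition C1c :: "real set \<Rightarrow> (real \<Rightarrow> real) set" where
  "C1c U = {\<psi>. \<psi> C1_differentiable_on UNIV \<and>
     compact (closure {x. \<psi> x \<noteq> 0}) \<and> closure {x. \<psi> x \<noteq> 0} \<subseteq> U}"

definition is_weak_deriv :: "real set \<Rightarrow> (real \<Rightarrow> real) \<Rightarrow> (real \<Rightarrow> real) \<Rightarrow> bool" where
  "is_weak_deriv U u g \<longleftrightarrow> (\<forall>\<psi>\<in>C1c U.
     (LINT x|lebesgue_on U. u x * deriv \<psi> x) = - (LINT x|lebesgue_on U. g x * \<psi> x))"

definition H1 :: "real set \<Rightarrow> (real \<Rightarrow> real) set" where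
  "H1 U = {u \<in> L2 U. \<exists>g\<in>L2 U. is_weak_deriv U u g}"

text \<open>For \<open>u \<in> H1 U\<close> the weak derivative is unique up to null sets; a representative is chosen.\<close>

definition weak_deriv :: "real set \<Rightarrow> (real \<Rightarrow> real) \<Rightarrow> real \<Rightarrow> real" where
  "weak_deriv U u = (SOME g. g \<in> L2 U \<and> is_weak_deriv U u g)"

text \<open>Approximate limits: every superlevel set of the error has density zero at \<open>x\<close>.\<close>

definition has_approx_lim :: "real set \<Rightarrow> (real \<Rightarrow> real) \<Rightarrow> real \<Rightarrow> real \<Rightarrow> bool" where
  "has_approx_lim U u x z \<longleftrightarrow> (\<forall>\<eta>>0.
     ((\<lambda>r. measure lebesgue {y \<in> U \<inter> ball x r. \<bar>u y - z\<bar> > \<eta>} / (2 * r)) \<longlongrightarrow> 0) (at_right 0))"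

definition approx_discont_set :: "real set \<Rightarrow> (real \<Rightarrow> real) \<Rightarrow> real set" where
  "approx_discont_set U u = {x \<in> U. \<nexists>z. has_approx_lim U u x z}"

definition has_approx_deriv :: "real set \<Rightarrow> (real \<Rightarrow> real) \<Rightarrow> real \<Rightarrow> real \<Rightarrow> bool" where
  "has_approx_deriv U u x d \<longleftrightarrow> (\<exists>z. has_approx_lim U u x z \<and>
     has_approx_lim U (\<lambda>y. (u y - z - d * (y - x)) / \<bar>y - x\<bar>) x 0)"

definition is_approx_gradient :: "real set \<Rightarrow> (real \<Rightarrow> real) \<Rightarrow> (real \<Rightarrow> real) \<Rightarrow> bool" where
  "is_approx_gradient U u g \<longleftrightarrow> (AE x in lebesgue_on U. has_approx_deriv U u x (g x))"

text \<open>
  The distributional derivative \<open>Du\<close> is a finite signed Radon measure on \<open>U\<close> with Lebesgue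
  decomposition \<open>Du = g dx + D\<^sup>su\<close>. As there is no type of signed measures, \<open>D\<^sup>su\<close> is given by its
  Jordan decomposition \<open>\<sigma> - \<tau>\<close>, so that \<open>|D\<^sup>su| = \<sigma> + \<tau>\<close>.
\<close>

definition BV_derivative ::
    "real set \<Rightarrow> (real \<Rightarrow> real) \<Rightarrow> (real \<Rightarrow> real) \<Rightarrow> real measure \<Rightarrow> real measure \<Rightarrow> bool" where
  "BV_derivative U u g \<sigma> \<tau> \<longleftrightarrow>
     g \<in> L1 U \<and>
     finite_measure \<sigma> \<and> sets \<sigma> = sets borel \<and> emeasure \<sigma> (- U) = 0 \<and>
     finite_measure \<tau> \<and> sets \<tau> = sets borel \<and> emeasure \<tau> (- U) = 0 \<and>
     (\<exists>N\<in>null_sets lborel. emeasure \<sigma> (- N) = 0 \<and> emeasure \<tau> (- N) = 0) \<and>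
     (\<exists>P\<in>sets borel. emeasure \<sigma> (- P) = 0 \<and> emeasure \<tau> P = 0) \<and>
     (\<forall>\<psi>\<in>C1c U. (LINT x|lebesgue_on U. u x * deriv \<psi> x) =
        - ((LINT x|lebesgue_on U. g x * \<psi> x) + (LINT x|\<sigma>. \<psi> x) - (LINT x|\<tau>. \<psi> x)))"

text \<open>\<open>SBV\<close>: the Cantor part of \<open>Du\<close>, i.e. the restriction of \<open>D\<^sup>su\<close> to the complement of the
  approximate discontinuity set, vanishes.\<close>

definition SBV :: "real set \<Rightarrow> (real \<Rightarrow> real) set" where
  "SBV U = {u \<in> L1 U. \<exists>g \<sigma> \<tau>. BV_derivative U u g \<sigma> \<tau> \<and>
     (AE x in \<sigma>. x \<in> approx_discont_set U u) \<and> (AE x in \<tau>. x \<in> approx_discont_set U u)}"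

definition SBV_loc :: "real set \<Rightarrow> (real \<Rightarrow> real) set" where
  "SBV_loc U = {u. \<forall>V. open V \<and> compact (closure V) \<and> closure V \<subseteq> U \<longrightarrow> u \<in> SBV V}"

definition GSBV :: "real set \<Rightarrow> (real \<Rightarrow> real) set" where
  "GSBV U = {u \<in> borel_measurable (lebesgue_on U).
     \<forall>N>0. (\<lambda>x. max (- N) (min N (u x))) \<in> SBV_loc U}"

definition equi_integrable :: "'a measure \<Rightarrow> ('a \<Rightarrow> real) set \<Rightarrow> bool" where
  "equi_integrable M F \<longleftrightarrow> (\<forall>\<eta>>0. \<exists>\<delta>>0. \<forall>g\<in>F. \<forall>A\<in>sets M.
     emeasure M A < ennreal \<delta> \<longrightarrow> (LINT x:A|M. \<bar>g x\<bar>) < \<eta>)"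

definition degradation :: "(real \<Rightarrow> real) \<Rightarrow> (real \<Rightarrow> real) \<Rightarrow> real \<Rightarrow> real" where
  "degradation ell Q t = sqrt (ell t / Q (1 - t))"

text \<open>\<open>t \<mapsto> \<phi>(\<epsilon> f\<^sup>2(t))\<close>, extended to \<open>t = 1\<close> by the limit \<open>\<phi>inf\<close> of \<open>\<phi>\<close> at infinity.\<close>

definition elastic_coeff ::
    "(real \<Rightarrow> real) \<Rightarrow> real \<Rightarrow> (real \<Rightarrow> real) \<Rightarrow> real \<Rightarrow> real \<Rightarrow> real" where
  "elastic_coeff \<phi> \<phi>inf f \<epsilon> t = (if t = 1 then \<phi>inf else \<phi> (\<epsilon> * (f t)\<^sup>2))"

definition phase_field_energy ::
    "real set \<Rightarrow> (real \<Rightarrow> real) \<Rightarrow> real \<Rightarrow> (real \<Rightarrow> real) \<Rightarrow> (real \<Rightarrow> real) \<Rightarrow>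
     real \<Rightarrow> (real \<Rightarrow> real) \<Rightarrow> (real \<Rightarrow> real) \<Rightarrow> ennreal" where
  "phase_field_energy \<Omega> \<phi> \<phi>inf f \<omega> \<epsilon> u v =
     (if u \<in> H1 \<Omega> \<and> v \<in> H1 \<Omega> \<and> (AE x in lebesgue_on \<Omega>. v x \<in> {0..1})
      then \<integral>\<^sup>+x. ennreal (elastic_coeff \<phi> \<phi>inf f \<epsilon> (v x) * \<bar>weak_deriv \<Omega> u x\<bar>\<^sup>2
              + \<omega> (1 - v x) / (4 * \<epsilon>)
              + \<epsilon> * \<bar>weak_deriv \<Omega> v x\<bar>\<^sup>2) \<partial>lebesgue_on \<Omega>
      else \<infinity>)"

end

theory Submission
  imports Defs "HOL-Probability.Helly_Selection"
begin

text \<open>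
  Let \<open>E\<^sub>\<epsilon>(x)\<close> be the energy of \<open>(u\<^sub>\<epsilon>, v\<^sub>\<epsilon>)\<close> on \<open>(a, x)\<close> and let \<open>\<mu>\<close> be the Stieltjes measure of a
  limit given by Helly's theorem. Passing from \<open>v\<^sub>\<epsilon> \<ge> 1 - \<delta>/2\<close> to \<open>v\<^sub>\<epsilon> \<le> 1 - \<delta>\<close> costs a fixed amount of
  energy, so \<open>v\<^sub>\<epsilon> \<ge> 1 - \<delta>\<close> eventually holds away from the finitely many large atoms of \<open>\<mu>\<close>. Where
  \<open>v\<^sub>\<epsilon>\<close> is close to 1, the energy density \<open>e\<close> dominates the gradient: \<open>|u\<^sub>\<epsilon>'| \<le> c\<surd>e + \<eta>e\<close>, the first
  term where \<open>\<epsilon>f\<^sup>2 \<ge> 1\<close>, the second elsewhere by the arithmetic-geometric mean inequality. Here \<open>\<eta>\<close> may be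
  taken arbitrarily small because \<open>\<omega>/Q\<close> tends to infinity at 0. Hence
  \<open>|u\<^sub>\<epsilon>(y) - u\<^sub>\<epsilon>(x)| \<le> c\<surd>((y - x)(E\<^sub>\<epsilon>(y) - E\<^sub>\<epsilon>(x))) + \<eta>(E\<^sub>\<epsilon>(y) - E\<^sub>\<epsilon>(x))\<close>
  on intervals without large atoms. This makes the \<open>u\<^sub>\<epsilon>\<close> equicontinuous at each point that is not an
  atom, gives convergence there, and passes to the limit \<open>w\<close> with \<open>\<mu>\<close> in place of \<open>E\<^sub>\<epsilon>\<close>. Such a \<open>w\<close>
  jumps only at atoms, its jumps are summable, and removing them leaves a function satisfying the bound with
  \<open>\<eta> = 0\<close>, that is, a primitive of an \<open>L\<^sup>2\<close> function: there is no Cantor part. As the bound only involves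
  \<open>|w(y) - w(x)|\<close>, it is inherited by truncations.
\<close>

section \<open>Primitives with respect to a measure on the line\<close>

text \<open>The bound is needed for every \<eta>: with one fixed \<eta>, \<mu> could have a diffuse
  singular part and \<open>w\<close> a Cantor part dominated by it. But a smaller \<eta> demands
  \<open>v\<close> closer to 1, hence a smaller threshold \<kappa> for the atoms that may be
  crossed, so no single finite partition of the interval serves all \<eta>. The way out is that the
  function left after subtracting all jumps does not depend on \<eta>: for each \<eta> finitely many
  atoms are skipped, nothing is lost across them, and then \<eta> tends to 0. The jumps at the large
  atoms are summable whatever their size, being finitely many; the others are dominated by the
  masses of \<mu>.

  The constant \<open>c\<^sub>0\<close> is \<open>1 / sqrt (\<phi> 1)\<close>: where
  \<open>\<epsilon> * (f t)\<^sup>2\<close> exceeds 1 the elastic coefficient is at least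
  \<open>\<phi> 1\<close>. Elsewhere the positive derivative of \<phi> at 0 bounds it below by a
  multiple of \<open>\<epsilon> * (f t)\<^sup>2\<close>, and \<epsilon> cancels against the
  denominator of the potential term.\<close>

text \<open>With Lebesgue measure this is the absolutely continuous part of a function of bounded variation, with
  counting measure on a countable set its jump part. The half-line is open, so that primitives are
  left-continuous.\<close>

definition primitive :: "real measure \<Rightarrow> (real \<Rightarrow> real) \<Rightarrow> real \<Rightarrow> real" where
  "primitive M w x = (LINT t|M. w t * indicator {..<x} t)"

text \<open>Measurability of the identity says that Borel sets are measurable for \<open>M\<close>.
  In this form Lebesgue measure on an interval and counting measure on a countable set are covered
  by the same statements, although their sigma-algebras are not the Borel one.\<close>

lemma integrable_mult_indicator_borel:
  fixes w :: "real \<Rightarrow> real"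
  assumes "integrable M w" "(\<lambda>t. t) \<in> borel_measurable M" "A \<in> sets borel"
  shows "integrable M (\<lambda>t. w t * indicator A t)"
proof -
  have "(\<lambda>t. indicator A t :: real) \<in> borel_measurable M"
    using borel_measurable_indicator[OF assms(3)] assms(2)
    by (rule measurable_compose[rotated])
  then have "(\<lambda>t. w t * indicator A t) \<in> borel_measurable M"
    using borel_measurable_integrable[OF assms(1)] by (rule borel_measurable_times[rotated])
  then show ?thesis
    by (rule Bochner_Integration.integrable_bound[OF assms(1)]) (simp add: indicator_def)
qed

lemma primitive_diff:
  assumes "integrable M w" "(\<lambda>t. t) \<in> borel_measurable M" "x \<le> y"
  shows "primitive M w y - primitive M w x = (LINT t|M. w t * indicator {x..<y} t)"
proof -
  have "primitive M w y - primitive M w x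
      = (LINT t|M. w t * indicator {..<y} t - w t * indicator {..<x} t)"
    unfolding primitive_def
    by (intro Bochner_Integration.integral_diff[symmetric] integrable_mult_indicator_borel assms) auto
  also have "\<dots> = (LINT t|M. w t * indicator {x..<y} t)"
    by (intro Bochner_Integration.integral_cong refl) (use assms(3) in \<open>auto simp: indicator_def\<close>)
  finally show ?thesis .
qed

lemma primitive_tendsto_left:
  assumes "integrable M w" "(\<lambda>t. t) \<in> borel_measurable M"
  shows "(primitive M w \<longlongrightarrow> primitive M w z) (at_left z)"
proof (rule tendsto_at_left_sequentially[where b="z - 1"])
  fix S :: "nat \<Rightarrow> real" assume S: "\<And>n. S n < z" "S \<longlonglongrightarrow> z"
  show "(\<lambda>n. primitive M w (S n)) \<longlonglongrightarrow> primitive M w z"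
    unfolding primitive_def
  proof (rule integral_dominated_convergence[where w="\<lambda>t. \<bar>w t\<bar>"])
    show "AE t in M. (\<lambda>n. w t * indicator {..<S n} t) \<longlonglongrightarrow> w t * indicator {..<z} t"
    proof (intro AE_I2 tendsto_mult tendsto_const)
      fix t
      show "(\<lambda>n. indicator {..<S n} t :: real) \<longlonglongrightarrow> indicator {..<z} t"
      proof (cases "t < z")
        case True
        then have "eventually (\<lambda>n. t < S n) sequentially"
          using S(2) order_tendstoD(1) by blast
        then have "eventually (\<lambda>n. indicator {..<S n} t = (indicator {..<z} t :: real)) sequentially"
          by eventually_elim (use True in auto)
        then show ?thesis by (rule tendsto_eventually)
      next
        case False
        then have "indicator {..<S n} t = (indicator {..<z} t :: real)" for n
          using S(1)[of n] by auto
        then show ?thesis by simp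
      qed
    qed
  qed (auto simp: abs_mult intro!: mult_left_le borel_measurable_integrable
      integrable_mult_indicator_borel[OF assms] integrable_abs[OF assms(1)])
qed simp

text \<open>The half-lines \<open>{..<S n}\<close> shrink to \<open>{..z}\<close>, not to
  \<open>{..<z}\<close>: the limit from the right includes the mass at \<open>z\<close>, the limit
  from the left does not.\<close>

lemma primitive_tendsto_right:
  assumes "integrable M w" "(\<lambda>t. t) \<in> borel_measurable M"
  shows "(primitive M w \<longlongrightarrow> (LINT t|M. w t * indicator {..z} t)) (at_right z)"
proof (rule tendsto_at_right_sequentially[where b="z + 1"])
  fix S :: "nat \<Rightarrow> real" assume S: "\<And>n. z < S n" "S \<longlonglongrightarrow> z"
  show "(\<lambda>n. primitive M w (S n)) \<longlonglongrightarrow> (LINT t|M. w t * indicator {..z} t)"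
    unfolding primitive_def
  proof (rule integral_dominated_convergence[where w="\<lambda>t. \<bar>w t\<bar>"])
    show "AE t in M. (\<lambda>n. w t * indicator {..<S n} t) \<longlonglongrightarrow> w t * indicator {..z} t"
    proof (intro AE_I2 tendsto_mult tendsto_const)
      fix t
      show "(\<lambda>n. indicator {..<S n} t :: real) \<longlonglongrightarrow> indicator {..z} t"
      proof (cases "z < t")
        case True
        then have "eventually (\<lambda>n. S n < t) sequentially"
          using S(2) order_tendstoD(2) by blast
        then have "eventually (\<lambda>n. indicator {..<S n} t = (indicator {..z} t :: real)) sequentially"
          by eventually_elim (use True in auto)
        then show ?thesis by (rule tendsto_eventually)
      next
        case False
        then have "indicator {..<S n} t = (indicator {..z} t :: real)" for n
          using S(1)[of n] by (auto simp: indicator_def)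
        then show ?thesis by simp
      qed
    qed
  qed (auto simp: abs_mult intro!: mult_left_le borel_measurable_integrable
      integrable_mult_indicator_borel[OF assms] integrable_abs[OF assms(1)])
qed simp

lemma primitive_count_space_tendsto_right:
  assumes int: "integrable (count_space D) j" and z: "z \<in> D"
  shows "(primitive (count_space D) j \<longlongrightarrow> primitive (count_space D) j z + j z) (at_right z)"
proof -
  have "(LINT t|count_space D. j t * indicator {..z} t) - primitive (count_space D) j z
      = (LINT t|count_space D. j t * indicator {..z} t - j t * indicator {..<z} t)"
    unfolding primitive_def
    by (intro Bochner_Integration.integral_diff[symmetric] integrable_mult_indicator_borel int) auto
  also have "\<dots> = (LINT t|count_space D. indicator {z} t *\<^sub>R j z)"
    by (intro Bochner_Integration.integral_cong) (auto simp: indicator_def)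
  also have "\<dots> = j z"
    by (subst integral_scaleR_left) (use z in \<open>auto simp: integrable_indicator_iff\<close>)
  finally have "(LINT t|count_space D. j t * indicator {..z} t) = primitive (count_space D) j z + j z"
    by simp
  with primitive_tendsto_right[OF int, of z] show ?thesis by simp
qed

lemma isCont_primitive:
  assumes "integrable M w" "(\<lambda>t. t) \<in> borel_measurable M" "AE t in M. t \<noteq> z"
  shows "isCont (primitive M w) z"
proof -
  have "(LINT t|M. w t * indicator {..z} t) = primitive M w z"
    unfolding primitive_def
  proof (rule integral_cong_AE)
    show "AE t in M. w t * indicator {..z} t = w t * indicator {..<z} t"
      using assms(3) by eventually_elim (auto simp: indicator_def)
  qed (intro borel_measurable_integrable integrable_mult_indicator_borel[OF assms(1,2)], simp)+
  with primitive_tendsto_left[OF assms(1,2), of z] primitive_tendsto_right[OF assms(1,2), of z]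
  show ?thesis
    by (simp add: isCont_def filterlim_at_split)
qed

lemma abs_primitive_le:
  assumes "integrable M w" "(\<lambda>t. t) \<in> borel_measurable M"
  shows "\<bar>primitive M w x\<bar> \<le> (LINT t|M. \<bar>w t\<bar>)"
proof -
  have "\<bar>primitive M w x\<bar> \<le> (LINT t|M. \<bar>w t * indicator {..<x} t\<bar>)"
    unfolding primitive_def by (rule integral_abs_bound)
  also have "\<dots> \<le> (LINT t|M. \<bar>w t\<bar>)"
    by (intro integral_mono integrable_abs integrable_mult_indicator_borel assms)
       (auto simp: indicator_def)
  finally show ?thesis .
qed

text \<open>\<open>w\<close> may change sign, so monotonicity is of no help. The primitive is an
  integral depending on a parameter, and its measurability is part of Fubini's theorem.\<close>

lemma borel_measurable_primitive:
  assumes "sigma_finite_measure M" "integrable M w" "(\<lambda>t. t) \<in> borel_measurable M"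
  shows "primitive M w \<in> borel_measurable borel"
proof -
  interpret sigma_finite_measure M by fact
  have [measurable]: "w \<in> borel_measurable M" "(\<lambda>t. t) \<in> borel_measurable M"
    using assms by auto
  have "(\<lambda>(x, t). w t * (if t < x then 1 else 0)) \<in> borel_measurable (borel \<Otimes>\<^sub>M M)"
    by measurable
  then have "(\<lambda>x. LINT t|M. w t * (if t < x then 1 else 0)) \<in> borel_measurable borel"
    by (rule borel_measurable_lebesgue_integral)
  moreover have "primitive M w = (\<lambda>x. LINT t|M. w t * (if t < x then 1 else 0))"
    unfolding primitive_def by (auto intro!: Bochner_Integration.integral_cong ext simp: indicator_def)
  ultimately show ?thesis by simp
qed

section \<open>Test functions, integrals over open intervals and integration by parts\<close>

lemma C1c_Ioo:
  assumes "\<psi> \<in> C1c {a<..<b}"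
  shows "(\<psi> has_real_derivative deriv \<psi> x) (at x)" "continuous_on UNIV (deriv \<psi>)"
    "x \<notin> {a<..<b} \<Longrightarrow> \<psi> x = 0"
proof -
  from assms obtain D where D: "\<And>x. (\<psi> has_vector_derivative D x) (at x)" "continuous_on UNIV D"
    and supp: "closure {x. \<psi> x \<noteq> 0} \<subseteq> {a<..<b}"
    unfolding C1c_def C1_differentiable_on_def by auto
  have "deriv \<psi> = D"
    using D(1) by (auto intro!: DERIV_imp_deriv simp: has_real_derivative_iff_has_vector_derivative)
  with D supp closure_subset[of "{x. \<psi> x \<noteq> 0}"]
  show "(\<psi> has_real_derivative deriv \<psi> x) (at x)" "continuous_on UNIV (deriv \<psi>)"
    "x \<notin> {a<..<b} \<Longrightarrow> \<psi> x = 0"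
    by (auto simp: has_real_derivative_iff_has_vector_derivative)
qed

lemma finite_measure_lebesgue_on_Ioo: "finite_measure (lebesgue_on {a<..<b::real})"
  by (intro finite_measure_lebesgue_on) auto

lemma measurable_ident_lebesgue_on: "(\<lambda>t. t) \<in> borel_measurable (lebesgue_on S)"
  by (intro measurable_restrict_space1 measurable_completion) simp

lemma integrable_lebesgue_on_iff:
  fixes f :: "real \<Rightarrow> real"
  assumes "S \<in> sets lebesgue"
  shows "integrable (lebesgue_on S) f \<longleftrightarrow> integrable lebesgue (\<lambda>x. indicator S x * f x)"
  using integrable_restrict_space[of S lebesgue f] assms by simp

lemma integral_lebesgue_on_eq:
  fixes f :: "real \<Rightarrow> real"
  assumes "S \<in> sets lebesgue"
  shows "(LINT x|lebesgue_on S. f x) = (LINT x|lebesgue. indicator S x * f x)"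
  using integral_restrict_space[of S lebesgue f] assms by simp

lemma negligible_of_countable: "countable S \<Longrightarrow> negligible (S :: real set)"
  by (simp add: negligible_iff_null_sets null_sets_completionI countable_imp_null_set_lborel)

lemma AE_lebesgue_on_neq: "AE t in lebesgue_on {a<..<b}. t \<noteq> (z :: real)"
proof -
  have "AE t in lebesgue. t \<noteq> z" by (rule AE_completion) (rule AE_lborel_singleton)
  then show ?thesis by (subst AE_restrict_space_iff) auto
qed

lemma LINT_Ioo_eq:
  fixes f :: "real \<Rightarrow> real"
  assumes "continuous_on UNIV f"
  shows "(LINT x|lebesgue_on {a<..<b}. f x) = integral {a..b} f"
    and "integrable (lebesgue_on {a<..<b}) f"
proof -
  have "f absolutely_integrable_on {a..b}"
    using assms by (intro absolutely_integrable_continuous_real) (auto intro: continuous_on_subset)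
  then have "f absolutely_integrable_on {a<..<b}"
    by (simp add: absolutely_integrable_on_Icc_iff_Ioo)
  then show "integrable (lebesgue_on {a<..<b}) f"
    by (simp add: absolutely_integrable_imp_integrable)
  then have "(LINT x|lebesgue_on {a<..<b}. f x) = integral {a<..<b} f"
    by (simp add: lebesgue_integral_eq_integral)
  then show "(LINT x|lebesgue_on {a<..<b}. f x) = integral {a..b} f"
    by (simp add: integral_open_interval_real)
qed

text \<open>Fubini's theorem: the inner integral of \<open>deriv \<psi>\<close> over
  \<open>{t<..<b}\<close> is \<open>- \<psi> t\<close>, since \<psi> vanishes at \<open>b\<close>.
  Applied to Lebesgue and to counting measure, this yields the absolutely continuous and the jump
  part of a distributional derivative.\<close>

lemma primitive_by_parts:
  assumes "sigma_finite_measure M" "integrable M w" "(\<lambda>t. t) \<in> borel_measurable M"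
    and sp: "space M \<subseteq> {a<..<b}" and psi: "\<psi> \<in> C1c {a<..<b}"
  shows "(LINT x|lebesgue_on {a<..<b}. primitive M w x * deriv \<psi> x) = - (LINT t|M. w t * \<psi> t)"
proof -
  let ?L = "lebesgue_on {a<..<b}"
  note der = C1c_Ioo(1)[OF psi] and cont = C1c_Ioo(2)[OF psi] and zero = C1c_Ioo(3)[OF psi]
  interpret M: sigma_finite_measure M by fact
  interpret L: finite_measure ?L by (rule finite_measure_lebesgue_on_Ioo)
  interpret P: pair_sigma_finite ?L M ..
  have meas_d: "deriv \<psi> \<in> borel_measurable borel"
    using cont by (simp add: borel_measurable_continuous_onI)
  have [measurable]: "w \<in> borel_measurable M" "(\<lambda>t. t) \<in> borel_measurable M"
     "(\<lambda>t. t) \<in> borel_measurable ?L" "deriv \<psi> \<in> borel_measurable ?L"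
    using assms measurable_ident_lebesgue_on measurable_compose[OF measurable_ident_lebesgue_on meas_d]
    by auto
  let ?f = "\<lambda>x t. (if t < x then 1 else 0) * (w t * deriv \<psi> x)"
  have int: "integrable (?L \<Otimes>\<^sub>M M) (\<lambda>(x, t). ?f x t)"
  proof (rule P.Fubini_integrable)
    have bound: "(LINT t|M. norm (?f x t)) \<le> \<bar>deriv \<psi> x\<bar> * (LINT t|M. \<bar>w t\<bar>)" for x
      unfolding Bochner_Integration.integral_mult_right_zero[symmetric]
      by (rule integral_mono')
         (use assms(2) in \<open>auto simp: abs_mult intro!: mult_nonneg_nonneg\<close>)
    have "integrable ?L (\<lambda>x. \<bar>deriv \<psi> x\<bar> * (LINT t|M. \<bar>w t\<bar>))"
      using LINT_Ioo_eq(2)[OF cont, of a b] by auto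
    then show "integrable ?L (\<lambda>x. LINT t|M. norm (case (x, t) of (x, t) \<Rightarrow> ?f x t))"
      by (rule Bochner_Integration.integrable_bound)
         (use bound in \<open>auto simp: integral_nonneg_AE intro!: AE_I2 mult_nonneg_nonneg\<close>)
    show "AE x in ?L. integrable M (\<lambda>t. case (x, t) of (x, t) \<Rightarrow> ?f x t)"
    proof (rule AE_I2)
      fix x
      have "integrable M (\<lambda>t. w t * deriv \<psi> x)" using assms(2) by simp
      then show "integrable M (\<lambda>t. case (x, t) of (x, t) \<Rightarrow> ?f x t)"
        by (rule Bochner_Integration.integrable_bound) auto
    qed
  qed measurable
  have inner: "(LINT x|?L. ?f x t) = - (w t * \<psi> t)" if "t \<in> space M" for t
  proof -
    have t: "a < t" "t < b" using that sp by auto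
    have "(LINT x|?L. ?f x t) = (LINT x|?L. w t * (indicator {t<..<b} x *\<^sub>R deriv \<psi> x))"
      by (rule Bochner_Integration.integral_cong) (auto simp: indicator_def)
    also have "\<dots> = w t * (LINT x|?L. indicator {t<..<b} x *\<^sub>R deriv \<psi> x)"
      by (rule integral_mult_right_zero)
    also have "(LINT x|?L. indicator {t<..<b} x *\<^sub>R deriv \<psi> x)
      = (LINT x|lebesgue. indicator {a<..<b} x *\<^sub>R indicator {t<..<b} x *\<^sub>R deriv \<psi> x)"
      by (subst integral_restrict_space) auto
    also have "\<dots> = (LINT x|lebesgue. indicator {t<..<b} x *\<^sub>R deriv \<psi> x)"
      using t by (auto intro!: Bochner_Integration.integral_cong simp: indicator_def)
    also have "\<dots> = (LINT x|lebesgue_on {t<..<b}. deriv \<psi> x)"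
      by (subst integral_restrict_space) auto
    also have "\<dots> = integral {t..b} (deriv \<psi>)"
      by (rule LINT_Ioo_eq[OF cont])
    also have "\<dots> = \<psi> b - \<psi> t"
      using t der by (intro integral_unique fundamental_theorem_of_calculus)
        (auto simp: has_real_derivative_iff_has_vector_derivative[symmetric] intro: has_field_derivative_at_within)
    also have "\<psi> b = 0" by (rule zero) simp
    finally show ?thesis by simp
  qed
  have "(LINT x|?L. primitive M w x * deriv \<psi> x) = (LINT x|?L. LINT t|M. ?f x t)"
  proof (rule Bochner_Integration.integral_cong[OF refl])
    fix x
    have "primitive M w x * deriv \<psi> x = (LINT t|M. (w t * indicator {..<x} t) * deriv \<psi> x)"
      unfolding primitive_def by (rule integral_mult_left_zero[symmetric])
    also have "\<dots> = (LINT t|M. ?f x t)"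
      by (rule Bochner_Integration.integral_cong) auto
    finally show "primitive M w x * deriv \<psi> x = (LINT t|M. ?f x t)" .
  qed
  also have "\<dots> = (LINT t|M. LINT x|?L. ?f x t)"
    by (rule P.Fubini_integral[symmetric]) (use int in simp)
  also have "\<dots> = (LINT t|M. - (w t * \<psi> t))"
    by (rule Bochner_Integration.integral_cong[OF refl]) (rule inner)
  finally show ?thesis by simp
qed

section \<open>Primitives of square-integrable functions\<close>

text \<open>As in the proof that L1 is complete, the absolute increments have an integrable sum,
  which is finite almost everywhere. The majorant \<open>W\<close> is recorded because it later
  permits dominated convergence of primitives.\<close>

lemma fast_L1_Cauchy_AE_convergent:
  fixes G :: "nat \<Rightarrow> 'a \<Rightarrow> real"
  assumes int: "\<And>k. integrable M (G k)"
    and sum: "summable (\<lambda>k. LINT x|M. \<bar>G (Suc k) x - G k x\<bar>)"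
  obtains W where "integrable M W" "AE x in M. convergent (\<lambda>k. G k x)"
    "\<And>k. AE x in M. \<bar>G k x\<bar> \<le> W x"
proof -
  define d where "d = (\<lambda>k x. \<bar>G (Suc k) x - G k x\<bar>)"
  have d_int: "integrable M (d k)" for k
    unfolding d_def using int by simp
  have "(\<integral>\<^sup>+x. (\<Sum>k. ennreal (d k x)) \<partial>M) = (\<Sum>k. \<integral>\<^sup>+x. ennreal (d k x) \<partial>M)"
    using d_int by (intro nn_integral_suminf) auto
  also have "\<dots> = (\<Sum>k. ennreal (LINT x|M. d k x))"
    using d_int by (subst nn_integral_eq_integral) (auto simp: d_def)
  also have "\<dots> < \<infinity>"
    using sum by (subst suminf_ennreal2) (auto simp: d_def)
  finally have "AE x in M. (\<Sum>k. ennreal (d k x)) \<noteq> \<infinity>"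
    by (intro nn_integral_PInf_AE) (use d_int in auto)
  then have ae: "AE x in M. summable (\<lambda>k. d k x)"
    by eventually_elim (auto intro!: summable_suminf_not_top simp: d_def)
  define W where "W x = \<bar>G 0 x\<bar> + (\<Sum>k. d k x)" for x
  have W: "integrable M W"
    unfolding W_def
    by (intro Bochner_Integration.integrable_add integrable_abs int integrable_suminf d_int)
       (use ae sum in \<open>auto simp: d_def\<close>)
  have tele: "G k x = G 0 x + (\<Sum>j<k. G (Suc j) x - G j x)" for k x
    by (induction k) auto
  show ?thesis
  proof (rule that[of W])
    show "integrable M W" by fact
    show "AE x in M. convergent (\<lambda>k. G k x)"
      using ae
    proof eventually_elim
      case (elim x)
      then have "summable (\<lambda>k. G (Suc k) x - G k x)"
        unfolding d_def by (rule summable_rabs_cancel)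
      then have "convergent (\<lambda>k. \<Sum>j<k. G (Suc j) x - G j x)"
        by (simp add: summable_iff_convergent)
      then have conv: "convergent (\<lambda>k. G 0 x + (\<Sum>j<k. G (Suc j) x - G j x))"
        by (rule convergent_add[OF convergent_const])
      have eq: "(\<lambda>k. G 0 x + (\<Sum>j<k. G (Suc j) x - G j x)) = (\<lambda>k. G k x)"
        by (rule ext) (rule tele[symmetric])
      show ?case by (rule subst[where P=convergent, OF eq conv])
    qed
    fix k
    show "AE x in M. \<bar>G k x\<bar> \<le> W x"
      using ae
    proof eventually_elim
      case (elim x)
      have "\<bar>G k x\<bar> \<le> \<bar>G 0 x\<bar> + \<bar>\<Sum>j<k. G (Suc j) x - G j x\<bar>"
        using tele[of k x] by linarith
      also have "\<bar>\<Sum>j<k. G (Suc j) x - G j x\<bar> \<le> (\<Sum>j<k. d j x)"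
        unfolding d_def by (rule sum_abs)
      also have "\<dots> \<le> (\<Sum>j. d j x)"
        using elim by (intro sum_le_suminf) (auto simp: d_def)
      finally show ?case by (simp add: W_def)
    qed
  qed
qed

lemma dyadic_approximation:
  fixes a b x :: real
  assumes "a < b" "x \<in> {a..b}"
  obtains j :: "nat \<Rightarrow> nat" where "\<And>n. j n \<le> 2 ^ n" "(\<lambda>n. a + real (j n) * ((b - a) / 2 ^ n)) \<longlonglongrightarrow> x"
proof
  define h where "h n = (b - a) / 2 ^ n" for n :: nat
  \<comment> \<open>Rounding down; for \<open>x = b\<close> this is the last grid point,
    \<open>j n = 2 ^ n\<close>.\<close>
  define j where "j n = nat \<lfloor>(x - a) / h n\<rfloor>" for n
  have h: "h n > 0" for n using assms by (simp add: h_def)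
  have nn: "0 \<le> (x - a) / h n" for n using assms h[of n] by auto
  have le: "(x - a) / h n \<le> 2 ^ n" for n
    using assms h[of n] by (simp add: h_def field_simps)
  show "j n \<le> 2 ^ n" for n
  proof -
    have "\<lfloor>(x - a) / h n\<rfloor> \<le> 2 ^ n" using floor_mono[OF le[of n]] by simp
    then show ?thesis by (simp add: j_def nat_le_iff)
  qed
  have j: "real (j n) \<le> (x - a) / h n" "(x - a) / h n < real (j n) + 1" for n
  proof -
    have fl: "real (j n) = of_int \<lfloor>(x - a) / h n\<rfloor>" using nn[of n] by (simp add: j_def)
    show "real (j n) \<le> (x - a) / h n" "(x - a) / h n < real (j n) + 1"
      unfolding fl by (rule of_int_floor_le, rule real_of_int_floor_add_one_gt)
  qed
  have close: "dist (a + real (j n) * h n) x \<le> h n" for n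
  proof -
    have "real (j n) * h n \<le> x - a"
      using j(1)[of n] h[of n] by (simp only: pos_le_divide_eq)
    moreover have "x - a < (real (j n) + 1) * h n"
      using j(2)[of n] h[of n] by (simp only: pos_divide_less_eq)
    ultimately show ?thesis unfolding dist_real_def distrib_right by linarith
  qed
  have "h \<longlonglongrightarrow> 0"
    unfolding h_def by (rule LIMSEQ_divide_realpow_zero) simp
  then have "(\<lambda>n. a + real (j n) * h n) \<longlonglongrightarrow> x"
  proof (rule metric_tendsto_imp_tendsto)
    show "\<forall>\<^sub>F n in sequentially. dist (a + real (j n) * h n) x \<le> dist (h n) 0"
      using close h by (intro always_eventually allI) (simp add: less_imp_le)
  qed
  then show "(\<lambda>n. a + real (j n) * ((b - a) / 2 ^ n)) \<longlonglongrightarrow> x"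
    unfolding h_def .
qed

text \<open>The difference quotients of \<open>c\<close> on the dyadic grids form an \<open>L\<^sup>2\<close>-bounded martingale; its limit
  is the derivative of \<open>c\<close>.\<close>

lemma primitive_of_L2I:
  fixes c :: "real \<Rightarrow> real"
  assumes ab: "a < b" and cont: "continuous_on {a..b} c"
    and mu: "finite_measure \<mu>" "sets \<mu> = sets borel"
    and bound: "\<And>x y. a \<le> x \<Longrightarrow> x < y \<Longrightarrow> y \<le> b \<Longrightarrow> (c y - c x)\<^sup>2 \<le> (y - x) * measure \<mu> {x<..<y}"
  obtains g where "g \<in> L2 {a<..<b}"
    "\<And>x. x \<in> {a..b} \<Longrightarrow> c x = c a + primitive (lebesgue_on {a<..<b}) g x"
proof -
  interpret finite_measure \<mu> by fact
  define h where "h n = (b - a) / 2 ^ n" for n :: nat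
  define t where "t n i = a + real i * h n" for n i :: nat
  define s where "s n i = (c (t n (Suc i)) - c (t n i)) / h n" for n i
  \<comment> \<open>\<open>G n\<close> has the slope of \<open>c\<close> on each dyadic cell, and
    \<open>Q n\<close> is the square of its L2 norm.\<close>
  define G where "G n x = (\<Sum>i<2^n. s n i * indicator {t n i..<t n (Suc i)} x)" for n x
  define Q where "Q n = (\<Sum>i<2^n. (s n i)\<^sup>2 * h n)" for n
  have h: "h n > 0" for n using ab by (simp add: h_def)
  have t_Suc: "t n (Suc i) = t n i + h n" for n i by (simp add: t_def algebra_simps)
  have t_mono: "t n i \<le> t n j \<longleftrightarrow> i \<le> j" for n i j
    using h[of n] by (simp add: t_def)
  have t_end: "t n (2 ^ n) = b" for n unfolding t_def h_def by simp
  have t_0: "t n 0 = a" for n by (simp add: t_def)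
  have t_refine: "t n i = t m (i * 2 ^ (m - n))" if le: "n \<le> m" for n m i
  proof -
    obtain d where "m = n + d" using le by (auto simp: le_iff_add)
    then show ?thesis
      unfolding t_def h_def \<open>m = n + d\<close> of_nat_mult of_nat_power power_add by simp
  qed
  have G_meas[measurable]: "G n \<in> borel_measurable borel" for n
    unfolding G_def
    by (intro borel_measurable_sum borel_measurable_times borel_measurable_const borel_measurable_indicator) simp
  have int_cell: "integrable lborel (indicator {x..<y} :: real \<Rightarrow> real)" for x y :: real
  proof (rule integrable_real_indicator)
    show "emeasure lborel {x..<y} < \<infinity>"
    proof (cases "x \<le> y")
      case True
      then show ?thesis by (subst emeasure_lborel_Ico) auto
    qed simp
  qed simp
  have G_int: "integrable lborel (G n)" for n
    unfolding G_def by (intro Bochner_Integration.integrable_sum integrable_mult_right int_cell)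
  have GA_int: "integrable lborel (\<lambda>x. G n x * indicator A x)" if "A \<in> sets borel" for n A
    by (rule integrable_mult_indicator_borel[OF G_int]) (use that in auto)
  have G_below: "(LINT x|lborel. G n x * indicator {..<t n j} x) = c (t n j) - c a" if j: "j \<le> 2 ^ n" for n j
  proof -
    have "G n x * indicator {..<t n j} x = (\<Sum>i<j. s n i * indicator {t n i..<t n (Suc i)} x)" for x
    proof -
      have "G n x * indicator {..<t n j} x
          = (\<Sum>i<2^n. s n i * indicator {t n i..<t n (Suc i)} x * indicator {..<t n j} x)"
        unfolding G_def by (rule sum_distrib_right)
      also have "\<dots> = (\<Sum>i<j. s n i * indicator {t n i..<t n (Suc i)} x)"
      proof (rule sum.mono_neutral_cong_right)
        show "\<forall>i\<in>{..<2 ^ n} - {..<j}. s n i * indicator {t n i..<t n (Suc i)} x * indicator {..<t n j} x = 0"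
        proof
          fix i assume "i \<in> {..<2 ^ n} - {..<j}"
          then have "t n j \<le> t n i" by (simp add: t_mono)
          then show "s n i * indicator {t n i..<t n (Suc i)} x * indicator {..<t n j} x = 0"
            by (simp add: indicator_def)
        qed
        show "s n i * indicator {t n i..<t n (Suc i)} x * indicator {..<t n j} x
            = s n i * indicator {t n i..<t n (Suc i)} x" if "i \<in> {..<j}" for i
          using t_mono[of n "Suc i" j] that by (auto simp: indicator_def)
      qed (use j in auto)
      finally show ?thesis .
    qed
    then have "(LINT x|lborel. G n x * indicator {..<t n j} x)
        = (\<Sum>i<j. LINT x|lborel. s n i * indicator {t n i..<t n (Suc i)} x)"
      by (simp only:) (intro Bochner_Integration.integral_sum integrable_mult_right int_cell)
    also have "\<dots> = (\<Sum>i<j. s n i * h n)"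
      using h[of n] by (simp add: t_Suc)
    also have "\<dots> = (\<Sum>i<j. c (t n (Suc i)) - c (t n i))"
      using h[of n] by (simp add: s_def)
    also have "\<dots> = c (t n j) - c a"
      using sum_lessThan_telescope[of "\<lambda>i. c (t n i)" j] by (simp add: t_0)
    finally show ?thesis .
  qed
  \<comment> \<open>Martingale property: refining the grid does not change the integral up to a
    coarse grid point.\<close>
  have G_below_refine: "(LINT x|lborel. G m x * indicator {..<t n j} x) = c (t n j) - c a"
    if "n \<le> m" "j \<le> 2 ^ n" for n m j
  proof -
    have "j * 2 ^ (m - n) \<le> 2 ^ n * 2 ^ (m - n)" using that by simp
    also have "(2 ^ n * 2 ^ (m - n) :: nat) = 2 ^ m"
      using that by (simp add: power_add[symmetric])
    finally show ?thesis
      using G_below[of "j * 2 ^ (m - n)" m] that by (simp add: t_refine)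
  qed
  have G_cell: "(LINT x|lborel. G m x * indicator {t n i..<t n (Suc i)} x) = s n i * h n"
    if "n \<le> m" "i < 2 ^ n" for n m i
  proof -
    have "(LINT x|lborel. G m x * indicator {t n i..<t n (Suc i)} x)
        = primitive lborel (G m) (t n (Suc i)) - primitive lborel (G m) (t n i)"
      by (rule primitive_diff[symmetric]) (use G_int t_mono in auto)
    then show ?thesis
      unfolding primitive_def using G_below_refine[OF that(1)] that h[of n] by (simp add: s_def)
  qed
  \<comment> \<open>Orthogonality: \<open>G n\<close> is constant on the coarse cells, so by the
    martingale property the product integrates to the squared norm of the coarser function.
    Pythagoras' theorem \<open>diff_sq\<close> follows.\<close>
  have GG: "integrable lborel (\<lambda>x. G m x * G n x)" "(LINT x|lborel. G m x * G n x) = Q n"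
    if "n \<le> m" for n m
  proof -
    have eq: "G m x * G n x = (\<Sum>i<2^n. s n i * (G m x * indicator {t n i..<t n (Suc i)} x))" for x
      unfolding G_def[of n] sum_distrib_left by (rule sum.cong) (auto simp: mult_ac)
    show "integrable lborel (\<lambda>x. G m x * G n x)"
      unfolding eq by (intro Bochner_Integration.integrable_sum integrable_mult_right GA_int) auto
    show "(LINT x|lborel. G m x * G n x) = Q n"
    proof -
      have "(LINT x|lborel. G m x * G n x)
          = (\<Sum>i<2^n. LINT x|lborel. s n i * (G m x * indicator {t n i..<t n (Suc i)} x))"
        unfolding eq by (intro Bochner_Integration.integral_sum integrable_mult_right GA_int) auto
      also have "\<dots> = Q n"
        unfolding Q_def integral_mult_right_zero
        by (rule sum.cong) (simp_all add: G_cell[OF that] power2_eq_square)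
      finally show ?thesis .
    qed
  qed
  have sq_expand: "(G m x - G n x)\<^sup>2 = G m x * G m x - 2 * (G m x * G n x) + G n x * G n x" for m n x
    by (simp add: power2_eq_square algebra_simps)
  have diff_int: "integrable lborel (\<lambda>x. (G m x - G n x)\<^sup>2)" if "n \<le> m" for n m
    unfolding sq_expand
    by (intro Bochner_Integration.integrable_add Bochner_Integration.integrable_diff integrable_mult_right GG) (use that in auto)
  have diff_sq: "(LINT x|lborel. (G m x - G n x)\<^sup>2) = Q m - Q n" if "n \<le> m" for n m
    unfolding sq_expand using that GG[OF that] GG[of m m] GG[of n n] by simp
  have Q_mono: "Q n \<le> Q m" if "n \<le> m" for n m
  proof -
    have "0 \<le> (LINT x|lborel. (G m x - G n x)\<^sup>2)" by simp
    then show ?thesis using diff_sq[OF that] by simp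
  qed
  \<comment> \<open>On each cell the hypothesis bounds the squared slope times the length by the
    mass of the open cell, and the open cells are disjoint.\<close>
  have Q_bound: "Q n \<le> measure \<mu> (space \<mu>)" for n
  proof -
    have "Q n \<le> (\<Sum>i<2^n. measure \<mu> {t n i<..<t n (Suc i)})"
      unfolding Q_def
    proof (rule sum_mono)
      fix i assume "i \<in> {..<(2::nat) ^ n}"
      then have i: "Suc i \<le> 2 ^ n" by auto
      have "(c (t n (Suc i)) - c (t n i))\<^sup>2 \<le> h n * measure \<mu> {t n i<..<t n (Suc i)}"
        using bound[of "t n i" "t n (Suc i)"] t_mono[of n 0 i] t_mono[of n "Suc i" "2 ^ n"] i h[of n]
        by (simp add: t_0 t_end t_Suc)
      then have "(c (t n (Suc i)) - c (t n i))\<^sup>2 / h n \<le> measure \<mu> {t n i<..<t n (Suc i)}"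
        using h[of n] by (simp only: pos_divide_le_eq mult.commute)
      moreover have "(s n i)\<^sup>2 * h n = (c (t n (Suc i)) - c (t n i))\<^sup>2 / h n"
        using h[of n] unfolding s_def power_divide by (simp add: power2_eq_square)
      ultimately show "(s n i)\<^sup>2 * h n \<le> measure \<mu> {t n i<..<t n (Suc i)}"
        by simp
    qed
    also have "\<dots> = measure \<mu> (\<Union>i<2^n. {t n i<..<t n (Suc i)})"
    proof (rule finite_measure_finite_Union[symmetric])
      show "finite {..<(2::nat) ^ n}" by simp
      show "(\<lambda>i. {t n i<..<t n (Suc i)}) ` {..<2 ^ n} \<subseteq> sets \<mu>"
        unfolding mu(2) by auto
      have "{t n i<..<t n (Suc i)} \<inter> {t n j<..<t n (Suc j)} = {}" if "i < j" for i j
        using t_mono[of n "Suc i" j] that by auto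
      then show "disjoint_family_on (\<lambda>i. {t n i<..<t n (Suc i)}) {..<2 ^ n}"
        unfolding disjoint_family_on_def by (metis Int_commute linorder_neqE_nat)
    qed
    also have "\<dots> \<le> measure \<mu> (space \<mu>)"
      by (rule bounded_measure)
    finally show ?thesis .
  qed
  \<comment> \<open>\<open>Q\<close> is increasing and bounded, so the squared L2 distances tend to
    0; the rate 4^-k is then achieved along a subsequence.\<close>
  have "\<exists>N. \<forall>n\<ge>N. \<forall>m\<ge>n. Q m - Q n \<le> (1/4) ^ k" for k
  proof -
    obtain L where L: "Q \<longlonglongrightarrow> L" "\<And>n. Q n \<le> L"
      using incseq_convergent[of Q "measure \<mu> (space \<mu>)"] Q_mono Q_bound by (auto simp: incseq_def)
    have "eventually (\<lambda>n. L - (1/4) ^ k < Q n) sequentially"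
      using L(1) by (rule order_tendstoD) simp
    then obtain N where N: "\<And>n. N \<le> n \<Longrightarrow> L - (1/4) ^ k < Q n"
      by (auto simp: eventually_sequentially)
    have "Q m - Q n \<le> (1/4) ^ k" if "N \<le> n" for n m
      using N[OF that] L(2)[of m] by linarith
    then show ?thesis by blast
  qed
  then obtain N0 where N0: "\<And>k n m. N0 k \<le> n \<Longrightarrow> n \<le> m \<Longrightarrow> Q m - Q n \<le> (1/4) ^ k"
    by metis
  \<comment> \<open>Summing makes \<open>N\<close> strictly increasing while keeping it above
    \<open>N0\<close>.\<close>
  define N where "N k = (\<Sum>j\<le>k. Suc (N0 j))" for k
  have N_Suc: "N k < N (Suc k)" for k by (simp add: N_def)
  have N_ge: "N0 k \<le> N k" for k
    unfolding N_def by (cases k) auto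
  have N_strict: "strict_mono N" using N_Suc by (rule strict_monoI_Suc)
  have L1: "(LINT x|lborel. \<bar>G (N (Suc k)) x - G (N k) x\<bar>) \<le> (1/2) ^ k * (b - a + 1)" for k
  proof -
    let ?z = "\<lambda>x. G (N (Suc k)) x - G (N k) x"
    have le: "N k \<le> N (Suc k)" using N_Suc[of k] by simp
    have supp: "G n x = 0" if "x \<notin> {a..<b}" for n x
      unfolding G_def
    proof (rule sum.neutral, rule ballI)
      fix i assume "i \<in> {..<(2::nat) ^ n}"
      then have "a \<le> t n i" "t n (Suc i) \<le> b"
        using t_mono[of n 0 i] t_mono[of n "Suc i" "2 ^ n"] by (auto simp: t_0 t_end)
      then show "s n i * indicator {t n i..<t n (Suc i)} x = 0" using that by auto
    qed
    \<comment> \<open>Young's inequality with weight 2^k: the squared L2 distance is at most 4^-k,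
      so both terms contribute a multiple of 2^-k to the L1 distance, which is summable.\<close>
    have pt: "\<bar>?z x\<bar> \<le> (1/2) ^ k * indicator {a..<b} x + 2 ^ k * (?z x)\<^sup>2" for x
    proof (cases "x \<in> {a..<b}")
      case True
      define q where "q = (2::real) ^ k"
      have q: "q > 0" by (simp add: q_def)
      have "\<bar>?z x\<bar> \<le> 2 * \<bar>?z x\<bar>" by simp
      also have "2 * \<bar>?z x\<bar> \<le> 1 / q + q * (?z x)\<^sup>2"
      proof -
        have "0 \<le> (1 - q * \<bar>?z x\<bar>)\<^sup>2 / q" using q by simp
        also have "\<dots> = 1 / q - 2 * \<bar>?z x\<bar> + q * (?z x)\<^sup>2"
          using q by (simp add: power2_eq_square field_simps)
        finally show ?thesis by simp
      qed
      finally have "\<bar>?z x\<bar> \<le> 1 / q + q * (?z x)\<^sup>2" .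
      then show ?thesis using True by (simp add: q_def power_one_over)
    next
      case False
      then show ?thesis by (simp add: supp)
    qed
    have "(LINT x|lborel. \<bar>?z x\<bar>) \<le> (LINT x|lborel. (1/2) ^ k * indicator {a..<b} x + 2 ^ k * (?z x)\<^sup>2)"
      using pt G_int diff_int[OF le]
      by (intro integral_mono Bochner_Integration.integrable_add integrable_mult_right int_cell) auto
    also have "\<dots> = (1/2) ^ k * (b - a) + 2 ^ k * (Q (N (Suc k)) - Q (N k))"
      using diff_int[OF le] int_cell[of a b] ab diff_sq[OF le] by simp
    also have "2 ^ k * (Q (N (Suc k)) - Q (N k)) \<le> 2 ^ k * (1/4) ^ k"
      using N0[OF N_ge[of k] le] by (intro mult_left_mono) auto
    also have "(2::real) ^ k * (1/4) ^ k = (1/2) ^ k"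
      by (simp add: power_mult_distrib[symmetric])
    finally show ?thesis by (simp add: algebra_simps)
  qed
  have "summable (\<lambda>k. LINT x|lborel. \<bar>G (N (Suc k)) x - G (N k) x\<bar>)"
    by (rule summable_comparison_test'[where g="\<lambda>k. (1/2) ^ k * (b - a + 1)" and N=0])
       (use L1 in \<open>auto intro!: summable_mult2 summable_geometric\<close>)
  from fast_L1_Cauchy_AE_convergent[of lborel "\<lambda>k. G (N k)", OF G_int this]
  obtain W where W: "integrable lborel W" and conv: "AE x in lborel. convergent (\<lambda>k. G (N k) x)"
    and dom: "\<And>k. AE x in lborel. \<bar>G (N k) x\<bar> \<le> W x" by auto
  define g where "g x = lim (\<lambda>k. G (N k) x)" for x
  have g_meas[measurable]: "g \<in> borel_measurable borel"
    unfolding g_def by (rule borel_measurable_lim_metric) measurable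
  have lim_g: "AE x in lborel. (\<lambda>k. G (N k) x) \<longlonglongrightarrow> g x"
    using conv by eventually_elim (simp add: g_def convergent_LIMSEQ_iff)
  have g_int: "integrable lborel g"
    by (rule integrable_dominated_convergence[OF _ _ W lim_g]) (use dom in auto)
  have g_lim: "(\<lambda>k. LINT x|lborel. G (N k) x * indicator {..<y} x) \<longlonglongrightarrow> primitive lborel g y" for y
    unfolding primitive_def
  proof (rule integral_dominated_convergence[OF _ _ W])
    show "AE x in lborel. (\<lambda>k. G (N k) x * indicator {..<y} x) \<longlonglongrightarrow> g x * indicator {..<y} x"
      using lim_g by eventually_elim (intro tendsto_intros)
    show "AE x in lborel. norm (G (N k) x * indicator {..<y} x) \<le> W x" for k
      using dom[of k] by eventually_elim (auto simp: indicator_def)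
  qed auto
  \<comment> \<open>At a grid point the sequence in \<open>g_lim\<close> is constant as soon as
    \<open>N k\<close> reaches \<open>n\<close>; continuity then covers the remaining
    points.\<close>
  have dyadic: "primitive lborel g (t n j) = c (t n j) - c a" if "j \<le> 2 ^ n" for n j
  proof (rule LIMSEQ_unique[OF g_lim])
    have "eventually (\<lambda>k. n \<le> N k) sequentially"
      using filterlim_subseq[OF N_strict] by (simp add: filterlim_at_top)
    then have "eventually (\<lambda>k. (LINT x|lborel. G (N k) x * indicator {..<t n j} x) = c (t n j) - c a) sequentially"
      by eventually_elim (use G_below_refine that in blast)
    then show "(\<lambda>k. LINT x|lborel. G (N k) x * indicator {..<t n j} x) \<longlonglongrightarrow> c (t n j) - c a"
      by (rule tendsto_eventually)
  qed
  have prim: "primitive lborel g x = c x - c a" if x: "x \<in> {a..b}" for x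
  proof -
    obtain j where j: "\<And>n. j n \<le> 2 ^ n" "(\<lambda>n. t n (j n)) \<longlonglongrightarrow> x"
      using dyadic_approximation[OF ab x] unfolding t_def h_def by metis
    have "isCont (primitive lborel g) x"
      by (rule isCont_primitive[OF g_int]) (auto intro: AE_lborel_singleton)
    then have "(\<lambda>n. primitive lborel g (t n (j n))) \<longlonglongrightarrow> primitive lborel g x"
      using j(2) by (rule isCont_tendsto_compose)
    moreover have "(\<lambda>n. primitive lborel g (t n (j n))) \<longlonglongrightarrow> c x - c a"
    proof -
      have "t n (j n) \<in> {a..b}" for n
        using t_mono[of n 0 "j n"] t_mono[of n "j n" "2 ^ n"] j(1)[of n] by (auto simp: t_0 t_end)
      then have "(\<lambda>n. c (t n (j n))) \<longlonglongrightarrow> c x"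
        using j(2) cont x by (auto simp: continuous_on_sequentially o_def)
      then show ?thesis by (simp add: dyadic j(1)) (intro tendsto_intros)
    qed
    ultimately show ?thesis by (rule LIMSEQ_unique)
  qed
  \<comment> \<open>Fatou's lemma carries the bound on \<open>Q\<close> over to the limit, so
    \<open>g\<close> is square-integrable.\<close>
  have "(\<integral>\<^sup>+x. ennreal ((g x)\<^sup>2) \<partial>lborel) \<le> ennreal (measure \<mu> (space \<mu>))"
  proof -
    have "(\<integral>\<^sup>+x. ennreal ((g x)\<^sup>2) \<partial>lborel) = (\<integral>\<^sup>+x. liminf (\<lambda>k. ennreal ((G (N k) x)\<^sup>2)) \<partial>lborel)"
    proof (rule nn_integral_cong_AE)
      show "AE x in lborel. ennreal ((g x)\<^sup>2) = liminf (\<lambda>k. ennreal ((G (N k) x)\<^sup>2))"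
        using lim_g
      proof eventually_elim
        case (elim x)
        then have "(\<lambda>k. ennreal ((G (N k) x)\<^sup>2)) \<longlonglongrightarrow> ennreal ((g x)\<^sup>2)"
          by (intro tendsto_ennrealI tendsto_power)
        then show ?case by (rule lim_imp_Liminf[OF trivial_limit_sequentially, symmetric])
      qed
    qed
    also have "\<dots> \<le> liminf (\<lambda>k. \<integral>\<^sup>+x. ennreal ((G (N k) x)\<^sup>2) \<partial>lborel)"
      by (rule nn_integral_liminf) measurable
    also have "(\<lambda>k. \<integral>\<^sup>+x. ennreal ((G (N k) x)\<^sup>2) \<partial>lborel) = (\<lambda>k. ennreal (Q (N k)))"
      using GG by (intro ext) (simp add: power2_eq_square nn_integral_eq_integral)
    also have "liminf \<dots> \<le> ennreal (measure \<mu> (space \<mu>))"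
      by (rule Liminf_le) (use Q_bound in \<open>auto intro!: always_eventually ennreal_leI\<close>)
    finally show ?thesis .
  qed
  then have "integrable lborel (\<lambda>x. (g x)\<^sup>2)"
    by (intro integrableI_bounded) (auto intro: le_less_trans)
  then have "integrable lebesgue (\<lambda>x. (g x)\<^sup>2)" by (simp add: integrable_completion)
  then have "integrable lebesgue (\<lambda>x. indicator {a<..<b} x *\<^sub>R (g x)\<^sup>2)"
    by (rule integrable_mult_indicator[rotated]) simp
  then have g2: "integrable (lebesgue_on {a<..<b}) (\<lambda>x. (g x)\<^sup>2)"
    by (subst integrable_restrict_space) simp_all
  have gm: "g \<in> borel_measurable (lebesgue_on {a<..<b})"
    by (intro measurable_restrict_space1 measurable_completion) simp
  show ?thesis
  proof (rule that)
    show "g \<in> L2 {a<..<b}" using g2 gm by (simp add: L2_def)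
    fix x assume x: "x \<in> {a..b}"
    have "primitive (lebesgue_on {a<..<b}) g x
        = (LINT t|lebesgue. indicator {a<..<b} t *\<^sub>R (g t * indicator {..<x} t))"
      unfolding primitive_def by (subst integral_restrict_space) auto
    also have "\<dots> = (LINT t|lborel. indicator {a<..<b} t *\<^sub>R (g t * indicator {..<x} t))"
      by (rule integral_completion) measurable
    also have "\<dots> = (LINT t|lborel. g t * indicator {a<..<x} t)"
      using x by (intro Bochner_Integration.integral_cong) (auto simp: indicator_def)
    also have "\<dots> = (LINT t|lborel. g t * indicator {a..<x} t)"
      by (intro integral_cong_AE) (use AE_lborel_singleton[of a] in \<open>auto simp: indicator_def\<close>)
    also have "\<dots> = primitive lborel g x - primitive lborel g a"
      by (rule primitive_diff[symmetric]) (use x g_int in auto)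
    also have "\<dots> = c x - c a" using prim[OF x] prim[of a] ab by simp
    finally show "c x = c a + primitive (lebesgue_on {a<..<b}) g x" by simp
  qed
qed

section \<open>Functions whose oscillation is controlled by a measure\<close>

lemma (in finite_measure) finite_large_atoms:
  assumes "\<And>x. {x} \<in> sets M" "\<kappa> > 0"
  shows "finite {x. \<kappa> \<le> measure M {x}}"
proof (rule ccontr)
  assume inf: "infinite {x. \<kappa> \<le> measure M {x}}"
  obtain n :: nat where n: "measure M (space M) / \<kappa> < n"
    using reals_Archimedean2 by blast
  obtain F where F: "F \<subseteq> {x. \<kappa> \<le> measure M {x}}" "finite F" "card F = n"
    using infinite_arbitrarily_large[OF inf] by blast
  have "n * \<kappa> = (\<Sum>x\<in>F. \<kappa>)" using F by simp
  also have "\<dots> \<le> (\<Sum>x\<in>F. measure M {x})" using F by (intro sum_mono) auto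
  also have "\<dots> = measure M (\<Union>x\<in>F. {x})"
    by (rule finite_measure_finite_Union[symmetric])
       (use F assms in \<open>auto simp: disjoint_family_on_def\<close>)
  also have "\<dots> \<le> measure M (space M)" by (rule bounded_measure)
  finally show False using n assms(2) by (simp add: pos_divide_less_eq)
qed

text \<open>Continuity from above: the punctured balls decrease to the empty set.\<close>

lemma punctured_ball_small:
  fixes z :: real
  assumes "finite_measure M" "sets M = sets borel" "e > 0"
  obtains r where "r > 0" "measure M (ball z r - {z}) < e"
proof -
  interpret finite_measure M by fact
  define A where "A n = ball z (1 / Suc n) - {z}" for n
  have "(\<lambda>n. measure M (A n)) \<longlonglongrightarrow> measure M (\<Inter>n. A n)"
  proof (rule finite_Lim_measure_decseq)
    show "range A \<subseteq> sets M" unfolding assms(2) by (auto simp: A_def)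
    show "decseq A"
      unfolding A_def decseq_def by (intro allI impI Diff_mono subset_ball) (auto simp: frac_le)
  qed
  moreover have "(\<Inter>n. A n) = {}"
  proof (intro equals0I)
    fix x assume x: "x \<in> (\<Inter>n. A n)"
    then have "dist z x > 0" by (auto simp: A_def)
    then obtain n where "1 / real (Suc n) < dist z x" using nat_approx_posE by blast
    moreover have "dist z x < 1 / real (Suc n)" using x by (auto simp: A_def)
    ultimately show False by simp
  qed
  ultimately have "(\<lambda>n. measure M (A n)) \<longlonglongrightarrow> 0" by simp
  then have "\<forall>\<^sub>F n in sequentially. measure M (A n) < e"
    using assms(3) by (rule order_tendstoD)
  then obtain n where "measure M (A n) < e" by (auto simp: eventually_sequentially)
  then show ?thesis by (intro that[of "1 / Suc n"]) (auto simp: A_def)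
qed

lemma isolated_from_finite:
  fixes z :: real
  assumes "finite F"
  obtains r where "r > 0" "\<And>x. x \<in> F \<Longrightarrow> x \<in> ball z r \<Longrightarrow> x = z"
proof -
  obtain r where "r > 0" "\<forall>x\<in>F. x \<noteq> z \<longrightarrow> r \<le> dist z x"
    using finite_set_avoid[OF assms] by blast
  then show ?thesis by (intro that[of r]) auto
qed

text \<open>Completeness of the reals, along a set \<open>S\<close> that accumulates at
  \<open>z\<close>. The set is kept general because \<open>w\<close> is controlled only off the
  atoms and one side of \<open>z\<close> has to be singled out.\<close>

lemma cauchy_imp_limit_along:
  fixes w :: "real \<Rightarrow> real"
  assumes cauchy: "\<And>e. e > 0 \<Longrightarrow> \<exists>r>0. \<forall>x\<in>S. \<forall>y\<in>S. \<bar>x - z\<bar> < r \<longrightarrow> \<bar>y - z\<bar> < r \<longrightarrow> \<bar>w x - w y\<bar> < e"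
    and acc: "\<And>r. r > 0 \<Longrightarrow> \<exists>x\<in>S. \<bar>x - z\<bar> < r"
  obtains L where "\<And>e. e > 0 \<Longrightarrow> \<exists>r>0. \<forall>x\<in>S. \<bar>x - z\<bar> < r \<longrightarrow> \<bar>w x - L\<bar> < e"
proof -
  have "\<exists>s. \<forall>n. s n \<in> S \<and> \<bar>s n - z\<bar> < 1 / Suc n"
    using acc by (intro choice allI) (auto simp: Bex_def)
  then obtain s where s: "\<And>n::nat. s n \<in> S" "\<And>n. \<bar>s n - z\<bar> < 1 / Suc n" by auto
  have s_close: "\<exists>N. \<forall>n\<ge>N. \<bar>s n - z\<bar> < r" if pos: "r > 0" for r
  proof -
    obtain N where N: "1 / real (Suc N) < r" using nat_approx_posE[OF pos] by blast
    have "\<bar>s n - z\<bar> < r" if "N \<le> n" for n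
    proof -
      have "1 / real (Suc n) \<le> 1 / real (Suc N)" using that by (intro frac_le) auto
      then show ?thesis using s(2)[of n] N by linarith
    qed
    then show ?thesis by (intro exI[of _ N]) simp
  qed
  have "Cauchy (\<lambda>n. w (s n))"
  proof (rule CauchyI)
    fix e :: real assume "e > 0"
    then obtain r where r: "r > 0" "\<forall>x\<in>S. \<forall>y\<in>S. \<bar>x - z\<bar> < r \<longrightarrow> \<bar>y - z\<bar> < r \<longrightarrow> \<bar>w x - w y\<bar> < e"
      using cauchy by blast
    with s_close[OF r(1)] s(1) show "\<exists>M. \<forall>m\<ge>M. \<forall>n\<ge>M. norm (w (s m) - w (s n)) < e"
      unfolding real_norm_def by blast
  qed
  then obtain L where L: "(\<lambda>n. w (s n)) \<longlonglongrightarrow> L"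
    using Cauchy_convergent_iff convergent_def by blast
  show ?thesis
  proof (rule that[of L])
    fix e :: real assume "e > 0"
    then obtain r where r: "r > 0" "\<forall>x\<in>S. \<forall>y\<in>S. \<bar>x - z\<bar> < r \<longrightarrow> \<bar>y - z\<bar> < r \<longrightarrow> \<bar>w x - w y\<bar> < e / 2"
      using cauchy[of "e / 2"] by auto
    obtain N where N: "\<forall>n\<ge>N. \<bar>s n - z\<bar> < r" using s_close[OF r(1)] by (rule exE)
    have "\<bar>w x - L\<bar> < e" if x: "x \<in> S" "\<bar>x - z\<bar> < r" for x
    proof -
      have "(\<lambda>n. \<bar>w x - w (s n)\<bar>) \<longlonglongrightarrow> \<bar>w x - L\<bar>" by (intro tendsto_intros L)
      moreover have "\<exists>N. \<forall>n\<ge>N. \<bar>w x - w (s n)\<bar> \<le> e / 2"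
        using r(2) x s(1) N by (meson less_imp_le)
      ultimately have "\<bar>w x - L\<bar> \<le> e / 2" by (rule LIMSEQ_le_const2)
      with \<open>e > 0\<close> show ?thesis by linarith
    qed
    with r(1) show "\<exists>r>0. \<forall>x\<in>S. \<bar>x - z\<bar> < r \<longrightarrow> \<bar>w x - L\<bar> < e" by blast
  qed
qed

text \<open>Cauchy's inequality for the vectors \<open>(sqrt p, sqrt r)\<close> and
  \<open>(sqrt q, sqrt s)\<close>. It lets the oscillation bounds of two disjoint intervals be
  added.\<close>

lemma sqrt_mult_superadditive:
  assumes "0 \<le> p" "0 \<le> q" "0 \<le> r" "0 \<le> (s::real)"
  shows "sqrt (p * q) + sqrt (r * s) \<le> sqrt ((p + r) * (q + s))"
proof (rule real_le_rsqrt)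
  have "2 * (sqrt (p * s) * sqrt (r * q)) \<le> (sqrt (p * s))\<^sup>2 + (sqrt (r * q))\<^sup>2"
    using sum_squares_bound[of "sqrt (p * s)" "sqrt (r * q)"] by (simp add: mult.assoc)
  moreover have "sqrt (p * s) * sqrt (r * q) = sqrt (p * q) * sqrt (r * s)"
    by (simp add: real_sqrt_mult mult_ac)
  ultimately show "(sqrt (p * q) + sqrt (r * s))\<^sup>2 \<le> (p + r) * (q + s)"
    using assms by (simp add: power2_sum algebra_simps)
qed

lemma integrable_atoms:
  assumes "finite_measure M" "\<And>x. {x} \<in> sets M" "countable D"
  shows "integrable (count_space D) (\<lambda>z. measure M {z})"
    "D \<in> sets M \<Longrightarrow> (LINT z|count_space D. measure M {z}) = measure M D"
proof -
  interpret finite_measure M by fact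
  have "(\<integral>\<^sup>+z. ennreal (measure M {z}) \<partial>count_space D) = emeasure M D"
    using assms by (subst emeasure_countable_singleton[of D M]) (auto simp: emeasure_eq_measure)
  then show int: "integrable (count_space D) (\<lambda>z. measure M {z})"
    by (intro integrableI_nonneg) (simp_all add: emeasure_eq_measure)
  assume "D \<in> sets M"
  have "ennreal (LINT z|count_space D. measure M {z}) = emeasure M D"
    using \<open>_ = emeasure M D\<close> int by (subst nn_integral_eq_integral[symmetric]) auto
  then show "(LINT z|count_space D. measure M {z}) = measure M D"
    by (metis emeasure_eq_measure ennreal_inj integral_nonneg_AE measure_nonneg AE_I2)
qed

lemma card_less_of_missing: "finite B \<Longrightarrow> A \<subseteq> B \<Longrightarrow> z \<in> B \<Longrightarrow> z \<notin> A \<Longrightarrow> card A < card B"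
  by (metis psubsetI psubset_card_mono)

text \<open>The bound expresses that the part of \<open>Dw\<close> not dominated by the \<open>L\<^sup>2\<close> term is concentrated on the
  atoms of \<open>\<mu>\<close>. It controls \<open>w\<close> only at points that are not atoms; all other values of \<open>w\<close> are irrelevant.\<close>

locale controlled_oscillation =
  fixes \<mu> :: "real measure" and a b c\<^sub>0 :: real and w :: "real \<Rightarrow> real"
  assumes ab: "a < b" and fin: "finite_measure \<mu>" and sets_mu: "sets \<mu> = sets borel" and c0: "0 \<le> c\<^sub>0"
    and key: "\<And>\<eta>. \<eta> > 0 \<Longrightarrow> \<exists>\<kappa>>0. \<forall>x y. a < x \<longrightarrow> x < y \<longrightarrow> y < b \<longrightarrow> measure \<mu> {x} = 0 \<longrightarrow>
      measure \<mu> {y} = 0 \<longrightarrow> (\<forall>z\<in>{x<..<y}. measure \<mu> {z} < \<kappa>) \<longrightarrow>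
      \<bar>w y - w x\<bar> \<le> c\<^sub>0 * sqrt ((y - x) * measure \<mu> {x<..<y}) + \<eta> * measure \<mu> {x<..<y}"
begin

sublocale finite_measure \<mu> by (rule fin)

abbreviation m :: "real set \<Rightarrow> real" where "m \<equiv> measure \<mu>"

definition G :: "real set" where "G = {x \<in> {a<..<b}. m {x} = 0}"
definition D :: "real set" where "D = {x \<in> {a<..<b}. m {x} \<noteq> 0}"

text \<open>Names the dependence of the atom threshold \<kappa> on \<eta>; the same pair enters the
  estimates for the single jumps, for the jump part and for the remainder.\<close>

definition adm :: "real \<Rightarrow> real \<Rightarrow> bool" where
  "adm \<eta> \<kappa> \<longleftrightarrow> \<kappa> > 0 \<and> (\<forall>x\<in>G. \<forall>y\<in>G. x < y \<longrightarrow> (\<forall>z\<in>{x<..<y}. m {z} < \<kappa>) \<longrightarrow>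
     \<bar>w y - w x\<bar> \<le> c\<^sub>0 * sqrt ((y - x) * m {x<..<y}) + \<eta> * m {x<..<y})"

lemma ex_adm: "\<eta> > 0 \<Longrightarrow> \<exists>\<kappa>. adm \<eta> \<kappa>"
  using key[of \<eta>] unfolding adm_def G_def by auto

lemma admD:
  assumes "adm \<eta> \<kappa>" "x \<in> G" "y \<in> G" "x < y" "\<And>z. x < z \<Longrightarrow> z < y \<Longrightarrow> m {z} < \<kappa>"
  shows "\<bar>w y - w x\<bar> \<le> c\<^sub>0 * sqrt ((y - x) * m {x<..<y}) + \<eta> * m {x<..<y}"
  using assms unfolding adm_def by auto

lemma m_mono: "A \<subseteq> B \<Longrightarrow> B \<in> sets borel \<Longrightarrow> m A \<le> m B"
  by (rule finite_measure_mono) (simp_all add: sets_mu)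

lemma m_le: "m A \<le> m (space \<mu>)"
  by (rule bounded_measure)

lemma countable_D: "countable D"
  by (rule countable_subset[OF _ countable_support]) (auto simp: D_def)

lemma D_borel: "D \<in> sets borel"
  by (rule sets.countable[OF _ countable_D]) auto

lemma G_dense:
  assumes "a \<le> x" "x < y" "y \<le> b"
  obtains z where "z \<in> G" "x < z" "z < y"
proof -
  have "uncountable ({x<..<y} - D)"
    by (rule uncountable_minus_countable[OF _ countable_D]) (use assms in \<open>simp add: uncountable_open_interval\<close>)
  then obtain z where "z \<in> {x<..<y} - D" by (metis countable_empty equals0I)
  with assms show ?thesis by (intro that[of z]) (auto simp: G_def D_def)
qed

lemma small_atoms_near:
  assumes "\<kappa> > 0"
  obtains r where "r > 0" "\<And>x. x \<in> ball z r \<Longrightarrow> x \<noteq> z \<Longrightarrow> m {x} < \<kappa>"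
proof -
  have "finite {x. \<kappa> \<le> m {x}}"
    by (rule finite_large_atoms) (use assms sets_mu in auto)
  from isolated_from_finite[OF this, of z] obtain r
    where r: "r > 0" "\<And>x. x \<in> {x. \<kappa> \<le> m {x}} \<Longrightarrow> x \<in> ball z r \<Longrightarrow> x = z" by blast
  show ?thesis
  proof (rule that[OF r(1)])
    fix x assume "x \<in> ball z r" "x \<noteq> z"
    then show "m {x} < \<kappa>" using r(2)[of x] by (cases "\<kappa> \<le> m {x}") auto
  qed
qed

lemma small_sqrt:
  assumes "e > 0"
  obtains r where "r > 0" "\<And>p q. 0 \<le> p \<Longrightarrow> p \<le> r \<Longrightarrow> c\<^sub>0 * sqrt (p * m q) < e"
proof -
  let ?M = "m (space \<mu>)"
  \<comment> \<open>The added ones keep the quotients meaningful when \<open>c\<^sub>0\<close> or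
    \<mu> vanishes, and the one next to \<open>c\<^sub>0\<close> makes the final inequality
    strict.\<close>
  define r where "r = (e / (c\<^sub>0 + 1))\<^sup>2 / (?M + 1)"
  have pos: "c\<^sub>0 + 1 > 0" "?M + 1 > 0" using c0 measure_nonneg[of \<mu> "space \<mu>"] by linarith+
  have r: "r > 0" unfolding r_def using assms pos by simp
  show ?thesis
  proof (rule that[OF r])
    fix p q assume p: "0 \<le> p" "p \<le> r"
    have "p * m q \<le> r * (?M + 1)"
      using p r m_le[of q] by (intro mult_mono) (auto simp: measure_nonneg)
    also have "\<dots> = (e / (c\<^sub>0 + 1))\<^sup>2" unfolding r_def using pos by simp
    finally have "sqrt (p * m q) \<le> e / (c\<^sub>0 + 1)"
      using assms pos by (intro real_le_lsqrt) auto
    then have "c\<^sub>0 * sqrt (p * m q) \<le> c\<^sub>0 * (e / (c\<^sub>0 + 1))"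
      using c0 by (rule mult_left_mono)
    also have "\<dots> < e" using assms pos by (simp add: field_simps)
    finally show "c\<^sub>0 * sqrt (p * m q) < e" .
  qed
qed

text \<open>An interval between two points on the same side of \<open>z\<close> does not meet
  \<open>z\<close>. Near \<open>z\<close> all other atoms are below the threshold for \<eta> = 1 and
  the punctured neighbourhood has small mass, so the bound yields Cauchy's criterion, however large
  the mass of \<open>z\<close> is.\<close>

lemma limit_along_one_side:
  assumes S: "S \<subseteq> G" and side: "S \<subseteq> {..<z} \<or> S \<subseteq> {z<..}"
    and acc: "\<And>r. r > 0 \<Longrightarrow> \<exists>x\<in>S. \<bar>x - z\<bar> < r"
  obtains L where "\<And>e. e > 0 \<Longrightarrow> \<exists>r>0. \<forall>x\<in>S. \<bar>x - z\<bar> < r \<longrightarrow> \<bar>w x - L\<bar> < e"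
proof -
  have cauchy: "\<exists>r>0. \<forall>x\<in>S. \<forall>y\<in>S. \<bar>x - z\<bar> < r \<longrightarrow> \<bar>y - z\<bar> < r \<longrightarrow> \<bar>w x - w y\<bar> < e"
    if e: "e > 0" for e
  proof -
    obtain \<kappa> where \<kappa>: "adm 1 \<kappa>" using ex_adm[of 1] by auto
    then have \<kappa>0: "\<kappa> > 0" by (simp add: adm_def)
    obtain r1 where r1: "r1 > 0" "\<And>x. x \<in> ball z r1 \<Longrightarrow> x \<noteq> z \<Longrightarrow> m {x} < \<kappa>"
      using small_atoms_near[OF \<kappa>0] by blast
    obtain r2 where r2: "r2 > 0" "m (ball z r2 - {z}) < e / 2"
      using punctured_ball_small[OF fin sets_mu, of "e / 2"] e by auto
    obtain r3 where r3: "r3 > 0" "\<And>p q. 0 \<le> p \<Longrightarrow> p \<le> r3 \<Longrightarrow> c\<^sub>0 * sqrt (p * m q) < e / 2"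
      using small_sqrt[of "e / 2"] e by auto
    define r where "r = Min {r1, r2, r3 / 2}"
    have r: "r > 0" "r \<le> r1" "r \<le> r2" "r \<le> r3 / 2" using r1 r2 r3 by (auto simp: r_def)
    have less: "\<bar>w y - w x\<bar> < e" if xy: "x \<in> S" "y \<in> S" "\<bar>x - z\<bar> < r" "\<bar>y - z\<bar> < r" "x < y" for x y
    proof -
      have sub: "{x<..<y} \<subseteq> ball z r - {z}"
        using xy side by (auto simp: dist_real_def)
      have "\<bar>w y - w x\<bar> \<le> c\<^sub>0 * sqrt ((y - x) * m {x<..<y}) + 1 * m {x<..<y}"
      proof (rule admD[OF \<kappa>])
        fix t assume "x < t" "t < y"
        then have "t \<in> ball z r - {z}" using sub by auto
        then show "m {t} < \<kappa>" using r(2) r1(2)[of t] by auto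
      qed (use xy S in auto)
      also have "c\<^sub>0 * sqrt ((y - x) * m {x<..<y}) < e / 2"
        using xy r by (intro r3) auto
      also have "m {x<..<y} \<le> m (ball z r2 - {z})"
        using sub r by (intro m_mono) auto
      finally show ?thesis using r2 by linarith
    qed
    have "\<bar>w x - w y\<bar> < e" if "x \<in> S" "y \<in> S" "\<bar>x - z\<bar> < r" "\<bar>y - z\<bar> < r" for x y
      using less[of x y] less[of y x] that e by (cases x y rule: linorder_cases) (auto simp: abs_minus_commute)
    with r(1) show ?thesis by blast
  qed
  show ?thesis
    by (rule cauchy_imp_limit_along[of S z w, OF cauchy acc that])
qed

text \<open>Limits are taken along \<open>G\<close>, since the values of \<open>w\<close> at atoms
  carry no information.\<close>

definition right_lim :: "real \<Rightarrow> real \<Rightarrow> bool" where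
  "right_lim z L \<longleftrightarrow> (\<forall>e>0. \<exists>r>0. \<forall>x\<in>G. z < x \<longrightarrow> x < z + r \<longrightarrow> \<bar>w x - L\<bar> < e)"
definition left_lim :: "real \<Rightarrow> real \<Rightarrow> bool" where
  "left_lim z L \<longleftrightarrow> (\<forall>e>0. \<exists>r>0. \<forall>x\<in>G. z - r < x \<longrightarrow> x < z \<longrightarrow> \<bar>w x - L\<bar> < e)"
definition jump :: "real \<Rightarrow> real" where
  "jump z = (SOME L. right_lim z L) - (SOME L. left_lim z L)"

lemma ex_right_lim:
  assumes "a < z" "z < b"
  shows "\<exists>L. right_lim z L"
proof -
  have acc: "\<exists>x\<in>G \<inter> {z<..}. \<bar>x - z\<bar> < r" if r: "r > 0" for r
  proof -
    obtain x where "x \<in> G" "z < x" "x < min b (z + r)"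
      using G_dense[of z "min b (z + r)"] assms r by auto
    then show ?thesis by (intro bexI[of _ x]) auto
  qed
  obtain L where L: "\<And>e. e > 0 \<Longrightarrow> \<exists>r>0. \<forall>x\<in>G \<inter> {z<..}. \<bar>x - z\<bar> < r \<longrightarrow> \<bar>w x - L\<bar> < e"
    by (rule limit_along_one_side[of "G \<inter> {z<..}" z, OF _ _ acc]) auto
  have "right_lim z L"
    unfolding right_lim_def
  proof (intro allI impI)
    fix e :: real assume "e > 0"
    from L[OF this] obtain r where "r > 0" "\<forall>x\<in>G \<inter> {z<..}. \<bar>x - z\<bar> < r \<longrightarrow> \<bar>w x - L\<bar> < e" by auto
    then show "\<exists>r>0. \<forall>x\<in>G. z < x \<longrightarrow> x < z + r \<longrightarrow> \<bar>w x - L\<bar> < e"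
      by (intro exI[of _ r]) auto
  qed
  then show ?thesis by blast
qed

lemma ex_left_lim:
  assumes "a < z" "z < b"
  shows "\<exists>L. left_lim z L"
proof -
  have acc: "\<exists>x\<in>G \<inter> {..<z}. \<bar>x - z\<bar> < r" if r: "r > 0" for r
  proof -
    obtain x where "x \<in> G" "max a (z - r) < x" "x < z"
      using G_dense[of "max a (z - r)" z] assms r by auto
    then show ?thesis by (intro bexI[of _ x]) auto
  qed
  obtain L where L: "\<And>e. e > 0 \<Longrightarrow> \<exists>r>0. \<forall>x\<in>G \<inter> {..<z}. \<bar>x - z\<bar> < r \<longrightarrow> \<bar>w x - L\<bar> < e"
    by (rule limit_along_one_side[of "G \<inter> {..<z}" z, OF _ _ acc]) auto
  have "left_lim z L"
    unfolding left_lim_def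
  proof (intro allI impI)
    fix e :: real assume "e > 0"
    from L[OF this] obtain r where "r > 0" "\<forall>x\<in>G \<inter> {..<z}. \<bar>x - z\<bar> < r \<longrightarrow> \<bar>w x - L\<bar> < e" by auto
    then show "\<exists>r>0. \<forall>x\<in>G. z - r < x \<longrightarrow> x < z \<longrightarrow> \<bar>w x - L\<bar> < e"
      by (intro exI[of _ r]) auto
  qed
  then show ?thesis by blast
qed

lemma jump_limits:
  assumes z: "a < z" "z < b" and e: "e > 0"
  obtains r where "r > 0" "\<And>x y. x \<in> G \<Longrightarrow> y \<in> G \<Longrightarrow> z - r < x \<Longrightarrow> x < z \<Longrightarrow> z < y \<Longrightarrow> y < z + r
    \<Longrightarrow> \<bar>w y - w x - jump z\<bar> < e"
proof -
  define R where "R = (SOME L. right_lim z L)"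
  define L where "L = (SOME L. left_lim z L)"
  have R: "right_lim z R" unfolding R_def by (rule someI_ex[OF ex_right_lim[OF z]])
  have L: "left_lim z L" unfolding L_def by (rule someI_ex[OF ex_left_lim[OF z]])
  have e2: "e / 2 > 0" using e by simp
  obtain r1 where r1: "r1 > 0" "\<forall>x\<in>G. z < x \<longrightarrow> x < z + r1 \<longrightarrow> \<bar>w x - R\<bar> < e / 2"
    using R e2 unfolding right_lim_def by blast
  obtain r2 where r2: "r2 > 0" "\<forall>x\<in>G. z - r2 < x \<longrightarrow> x < z \<longrightarrow> \<bar>w x - L\<bar> < e / 2"
    using L e2 unfolding left_lim_def by blast
  show ?thesis
  proof (rule that[of "min r1 r2"])
    fix x y assume xy: "x \<in> G" "y \<in> G" "z - min r1 r2 < x" "x < z" "z < y" "y < z + min r1 r2"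
    have "\<bar>w y - R\<bar> < e / 2" using r1(2) xy by auto
    moreover have "\<bar>w x - L\<bar> < e / 2" using r2(2) xy by auto
    moreover have "jump z = R - L" by (simp add: jump_def R_def L_def)
    ultimately show "\<bar>w y - w x - jump z\<bar> < e" by linarith
  qed (use r1 r2 in auto)
qed

lemma pair_around:
  assumes z: "a < z" "z < b" and r: "r > 0"
  obtains x y where "x \<in> G" "y \<in> G" "z - r < x" "x < z" "z < y" "y < z + r"
proof -
  obtain x where "x \<in> G" "max a (z - r) < x" "x < z"
    using G_dense[of "max a (z - r)" z] z r by auto
  moreover obtain y where "y \<in> G" "z < y" "y < min b (z + r)"
    using G_dense[of z "min b (z + r)"] z r by auto
  ultimately show ?thesis by (intro that[of x y]) auto
qed

text \<open>The bound is applied to points of \<open>G\<close> closing in on \<open>z\<close> from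
  both sides: the root vanishes with the length, the mass tends to that of \<open>z\<close>, and the
  increment tends to \<open>jump z\<close>.\<close>

lemma jump_bound:
  assumes adm: "adm \<eta> \<kappa>" and \<eta>: "\<eta> > 0" and z: "a < z" "z < b" "m {z} < \<kappa>"
  shows "\<bar>jump z\<bar> \<le> \<eta> * m {z}"
proof (rule field_le_epsilon)
  fix e :: real assume e: "e > 0"
  have e3: "e / 3 > 0" "e / 3 / \<eta> > 0" using e \<eta> by auto
  have \<kappa>0: "\<kappa> > 0" using adm by (simp add: adm_def)
  obtain r1 where r1: "r1 > 0" "\<And>x. x \<in> ball z r1 \<Longrightarrow> x \<noteq> z \<Longrightarrow> m {x} < \<kappa>"
    using small_atoms_near[OF \<kappa>0] by blast
  obtain r2 where r2: "r2 > 0" "m (ball z r2 - {z}) < e / 3 / \<eta>"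
    using punctured_ball_small[OF fin sets_mu e3(2)] by auto
  obtain r3 where r3: "r3 > 0" "\<And>p q. 0 \<le> p \<Longrightarrow> p \<le> r3 \<Longrightarrow> c\<^sub>0 * sqrt (p * m q) < e / 3"
    using small_sqrt[OF e3(1)] by auto
  obtain r4 where r4: "r4 > 0" "\<And>x y. x \<in> G \<Longrightarrow> y \<in> G \<Longrightarrow> z - r4 < x \<Longrightarrow> x < z \<Longrightarrow> z < y \<Longrightarrow> y < z + r4
    \<Longrightarrow> \<bar>w y - w x - jump z\<bar> < e / 3"
    using jump_limits[OF z(1,2) e3(1)] by blast
  \<comment> \<open>\<open>x\<close> and \<open>y\<close> lie on opposite sides of \<open>z\<close>,
    hence less than \<open>2 * r\<close> apart; this is why \<open>r3\<close> is halved.\<close>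
  define r where "r = Min {r1, r2, r3 / 2, r4}"
  have r: "r > 0" "r \<le> r1" "r \<le> r2" "r \<le> r3 / 2" "r \<le> r4" using r1 r2 r3 r4 by (auto simp: r_def)
  obtain x y where xy: "x \<in> G" "y \<in> G" "z - r < x" "x < z" "z < y" "y < z + r"
    using pair_around[OF z(1,2) r(1)] by blast
  have "\<bar>w y - w x\<bar> \<le> c\<^sub>0 * sqrt ((y - x) * m {x<..<y}) + \<eta> * m {x<..<y}"
  proof (rule admD[OF adm])
    fix t assume "x < t" "t < y"
    then have "t \<in> ball z r1" using xy r by (auto simp: dist_real_def)
    then show "m {t} < \<kappa>" using r1(2)[of t] z(3) by (cases "t = z") auto
  qed (use xy in auto)
  moreover have "c\<^sub>0 * sqrt ((y - x) * m {x<..<y}) < e / 3"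
    using xy r by (intro r3) auto
  moreover have "\<eta> * m {x<..<y} \<le> \<eta> * m {z} + e / 3"
  proof -
    have "m {x<..<y} \<le> m ({z} \<union> (ball z r2 - {z}))"
      using xy r by (intro m_mono) (auto simp: dist_real_def)
    also have "\<dots> \<le> m {z} + m (ball z r2 - {z})"
      by (rule measure_Un_le) (auto simp: sets_mu)
    also have "\<dots> \<le> m {z} + e / 3 / \<eta>" using r2 by simp
    finally have "\<eta> * m {x<..<y} \<le> \<eta> * (m {z} + e / 3 / \<eta>)" using \<eta> by simp
    then show ?thesis using \<eta> by (simp add: distrib_left)
  qed
  moreover have "\<bar>w y - w x - jump z\<bar> < e / 3"
    using xy r by (intro r4(2)) auto
  ultimately show "\<bar>jump z\<bar> \<le> \<eta> * m {z} + e" by linarith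
qed

text \<open>Away from finitely many atoms, \<open>jump_bound\<close> with \<eta> = 1 dominates the
  jumps by the masses; at the exceptional atoms the jumps may have any size.\<close>

lemma integrable_jump: "integrable (count_space D) jump"
proof -
  obtain \<kappa> where \<kappa>: "adm 1 \<kappa>" using ex_adm[of 1] by auto
  then have \<kappa>0: "\<kappa> > 0" by (simp add: adm_def)
  define F where "F = {x. \<kappa> \<le> m {x}}"
  have F: "finite F"
    unfolding F_def by (rule finite_large_atoms) (use \<kappa>0 sets_mu in auto)
  have "Infinite_Set_Sum.abs_summable_on (\<lambda>z. m {z}) D"
    unfolding Infinite_Set_Sum.abs_summable_on_def by (rule integrable_atoms) (use fin sets_mu countable_D in auto)
  then have "Infinite_Set_Sum.abs_summable_on (\<lambda>z. m {z}) (D - F)"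
    by (rule Infinite_Set_Sum.abs_summable_on_subset) auto
  then have "Infinite_Set_Sum.abs_summable_on jump (D - F)"
  proof (rule Infinite_Set_Sum.abs_summable_on_comparison_test)
    fix z assume "z \<in> D - F"
    then show "norm (jump z) \<le> norm (m {z})"
      using jump_bound[OF \<kappa>, of z] by (auto simp: D_def F_def)
  qed
  moreover have "Infinite_Set_Sum.abs_summable_on jump (D \<inter> F)"
    using F by (intro Infinite_Set_Sum.abs_summable_on_finite) auto
  ultimately have "Infinite_Set_Sum.abs_summable_on jump ((D - F) \<union> (D \<inter> F))"
    by (rule Infinite_Set_Sum.abs_summable_on_union)
  moreover have "(D - F) \<union> (D \<inter> F) = D" by blast
  ultimately show ?thesis
    unfolding Infinite_Set_Sum.abs_summable_on_def by simp
qed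

text \<open>The saltus function of \<open>w\<close>, normalised to be left-continuous.\<close>

definition U :: "real \<Rightarrow> real" where "U = primitive (count_space D) jump"

text \<open>\<open>jump_bound\<close> is summed over the atoms between \<open>x\<close> and
  \<open>y\<close>. The half-open interval of \<open>primitive_diff\<close> may be replaced by the
  open one because \<open>x\<close>, being in \<open>G\<close>, is not an atom.\<close>

lemma U_diff:
  assumes adm: "adm \<eta> \<kappa>" and \<eta>: "\<eta> > 0" and xy: "x \<in> G" "y \<in> G" "x < y"
    and small: "\<And>z. x < z \<Longrightarrow> z < y \<Longrightarrow> m {z} < \<kappa>"
  shows "\<bar>U y - U x\<bar> \<le> \<eta> * m {x<..<y}"
proof -
  let ?I = "\<lambda>z. m {z} * indicator {x<..<y} z"
  have int_m: "integrable (count_space D) (\<lambda>z. m {z})"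
    by (rule integrable_atoms) (use fin sets_mu countable_D in auto)
  have int: "integrable (count_space D) ?I"
    by (rule integrable_mult_indicator_borel[OF int_m]) auto
  have "\<bar>U y - U x\<bar> = \<bar>LINT t|count_space D. jump t * indicator {x..<y} t\<bar>"
    unfolding U_def by (subst primitive_diff) (use integrable_jump xy in auto)
  also have "\<dots> \<le> (LINT t|count_space D. \<bar>jump t * indicator {x..<y} t\<bar>)"
    by (rule integral_abs_bound)
  also have "\<dots> \<le> (LINT t|count_space D. \<eta> * ?I t)"
  proof (rule integral_mono)
    show "integrable (count_space D) (\<lambda>t. \<bar>jump t * indicator {x..<y} t\<bar>)"
      by (intro integrable_abs integrable_mult_indicator_borel integrable_jump) auto
    show "integrable (count_space D) (\<lambda>t. \<eta> * ?I t)" using int by (rule integrable_mult_right)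
    fix t assume "t \<in> space (count_space D)"
    then have t: "t \<in> D" by simp
    then have "t \<noteq> x" using xy by (auto simp: D_def G_def)
    show "\<bar>jump t * indicator {x..<y} t\<bar> \<le> \<eta> * ?I t"
    proof (cases "x < t \<and> t < y")
      case True
      then show ?thesis using jump_bound[OF adm \<eta>, of t] small[of t] t by (auto simp: D_def)
    next
      case False
      then show ?thesis using \<open>t \<noteq> x\<close> by (auto simp: indicator_def)
    qed
  qed
  also have "\<dots> = \<eta> * (LINT t|count_space D. ?I t)" by (rule integral_mult_right_zero)
  also have "(LINT t|count_space D. ?I t) = (LINT t|count_space (D \<inter> {x<..<y}). m {t})"
  proof -
    have "restrict_space (count_space D) {x<..<y} = count_space (D \<inter> {x<..<y})"
      by (simp add: restrict_count_space Int_commute)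
    then show ?thesis
      using integral_restrict_space[of "{x<..<y}" "count_space D" "\<lambda>t. m {t}"]
      by (simp add: mult.commute)
  qed
  also have "\<dots> = m (D \<inter> {x<..<y})"
    by (rule integrable_atoms) (use fin sets_mu countable_D D_borel in auto)
  also have "\<dots> \<le> m {x<..<y}" by (rule m_mono) auto
  finally show ?thesis using \<eta> by simp
qed

definition c :: "real \<Rightarrow> real" where "c x = w x - U x"

text \<open>Across an atom the increments of \<open>w\<close> and of \<open>U\<close> both tend to
  \<open>jump z\<close>, so those of \<open>c\<close> tend to 0. Two nearby points of
  \<open>G\<close> stand in for \<open>z\<close> itself, where \<open>w\<close> is
  arbitrary.\<close>

lemma no_jump:
  assumes z: "z \<in> D" and r: "r > 0" and e: "e > 0"
  obtains x y where "x \<in> G" "y \<in> G" "z - r < x" "x < z" "z < y" "y < z + r" "\<bar>c y - c x\<bar> \<le> e"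
proof -
  have zab: "a < z" "z < b" using z by (auto simp: D_def)
  have e3: "e / 3 > 0" using e by simp
  have UR: "(U \<longlongrightarrow> U z + jump z) (at_right z)"
    unfolding U_def by (rule primitive_count_space_tendsto_right[OF integrable_jump z])
  have UL: "(U \<longlongrightarrow> U z) (at_left z)"
    unfolding U_def by (rule primitive_tendsto_left[OF integrable_jump]) simp
  have "\<forall>\<^sub>F x in at_right z. dist (U x) (U z + jump z) < e / 3"
    using tendstoD[OF UR e3] .
  then obtain b' where b': "b' > z" "\<forall>x>z. x < b' \<longrightarrow> dist (U x) (U z + jump z) < e / 3"
    unfolding eventually_at_right_field by blast
  obtain a' where a': "a' < z" "\<forall>x>a'. x < z \<longrightarrow> dist (U x) (U z) < e / 3"
    using tendstoD[OF UL e3] unfolding eventually_at_left_field by blast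
  obtain r4 where r4: "r4 > 0" "\<And>x y. x \<in> G \<Longrightarrow> y \<in> G \<Longrightarrow> z - r4 < x \<Longrightarrow> x < z \<Longrightarrow> z < y \<Longrightarrow> y < z + r4
    \<Longrightarrow> \<bar>w y - w x - jump z\<bar> < e / 3"
    using jump_limits[OF zab e3] by blast
  define q where "q = Min {r, r4, b' - z, z - a'}"
  have q: "q > 0" "q \<le> r" "q \<le> r4" "q \<le> b' - z" "q \<le> z - a'"
    using r r4 b' a' by (auto simp: q_def)
  obtain x y where xy: "x \<in> G" "y \<in> G" "z - q < x" "x < z" "z < y" "y < z + q"
    using pair_around[OF zab q(1)] by blast
  have "dist (U y) (U z + jump z) < e / 3" using xy q b'(2) by auto
  moreover have "dist (U x) (U z) < e / 3" using xy q a'(2) by auto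
  moreover have "\<bar>w y - w x - jump z\<bar> < e / 3" using xy q by (intro r4(2)) auto
  ultimately have "\<bar>c y - c x\<bar> \<le> e" unfolding c_def dist_real_def by linarith
  then show ?thesis using xy q by (intro that[of x y]) auto
qed

text \<open>Subtracting the jumps allows to bisect at the large atoms: the right-hand side is superadditive on
  disjoint intervals, and nothing is lost across an atom.\<close>

lemma c_bound_adm:
  assumes adm: "adm \<eta> \<kappa>" and \<eta>: "\<eta> > 0" and xy: "x \<in> G" "y \<in> G" "x < y"
  shows "\<bar>c y - c x\<bar> \<le> c\<^sub>0 * sqrt ((y - x) * m {x<..<y}) + 2 * \<eta> * m {x<..<y}"
proof -
  have \<kappa>0: "\<kappa> > 0" using adm by (simp add: adm_def)
  have fin_big: "finite {z. \<kappa> \<le> m {z}}"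
    by (rule finite_large_atoms) (use \<kappa>0 sets_mu in auto)
  show ?thesis
    using xy
  \<comment> \<open>Induction on the number of atoms of mass at least \<kappa> strictly between
    \<open>x\<close> and \<open>y\<close>. The interval is split at such an atom \<open>z\<close>;
    both pieces avoid \<open>z\<close> and so contain fewer of them.\<close>
  proof (induction "card ({z. \<kappa> \<le> m {z}} \<inter> {x<..<y})" arbitrary: x y rule: less_induct)
    case less
    show ?case
    proof (cases "{z. \<kappa> \<le> m {z}} \<inter> {x<..<y} = {}")
      case True
      have small: "m {z} < \<kappa>" if "x < z" "z < y" for z
        using True that by (auto simp: not_le[symmetric])
      have "\<bar>w y - w x\<bar> \<le> c\<^sub>0 * sqrt ((y - x) * m {x<..<y}) + \<eta> * m {x<..<y}"
        by (rule admD[OF adm]) (use less.prems small in auto)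
      moreover have "\<bar>U y - U x\<bar> \<le> \<eta> * m {x<..<y}"
        by (rule U_diff[OF adm \<eta>]) (use less.prems small in auto)
      \<comment> \<open>One \<eta> comes from \<open>w\<close> and one from \<open>U\<close>, hence
        the factor 2.\<close>
      ultimately show ?thesis unfolding c_def by linarith
    next
      case False
      then obtain z where z: "\<kappa> \<le> m {z}" "x < z" "z < y" by auto
      have zD: "z \<in> D" using z \<kappa>0 less.prems by (auto simp: D_def G_def)
      show ?thesis
      proof (rule field_le_epsilon)
        fix e :: real assume e: "e > 0"
        have r: "min (z - x) (y - z) > 0" using z by simp
        obtain x' y' where xy': "x' \<in> G" "y' \<in> G" "z - min (z - x) (y - z) < x'" "x' < z" "z < y'"
          "y' < z + min (z - x) (y - z)" "\<bar>c y' - c x'\<bar> \<le> e"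
          using no_jump[OF zD r e] by blast
        then have o: "x < x'" "x' < z" "z < y'" "y' < y" by auto
        have small1: "card ({z. \<kappa> \<le> m {z}} \<inter> {x<..<x'}) < card ({z. \<kappa> \<le> m {z}} \<inter> {x<..<y})"
          by (rule card_less_of_missing[of _ _ z]) (use fin_big z o in auto)
        have small2: "card ({z. \<kappa> \<le> m {z}} \<inter> {y'<..<y}) < card ({z. \<kappa> \<le> m {z}} \<inter> {x<..<y})"
          by (rule card_less_of_missing[of _ _ z]) (use fin_big z o in auto)
        have 1: "\<bar>c x' - c x\<bar> \<le> c\<^sub>0 * sqrt ((x' - x) * m {x<..<x'}) + 2 * \<eta> * m {x<..<x'}"
          by (rule less.hyps[OF small1]) (use less.prems xy' o in auto)
        have 2: "\<bar>c y - c y'\<bar> \<le> c\<^sub>0 * sqrt ((y - y') * m {y'<..<y}) + 2 * \<eta> * m {y'<..<y}"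
          by (rule less.hyps[OF small2]) (use less.prems xy' o in auto)
        have mm: "m {x<..<x'} + m {y'<..<y} \<le> m {x<..<y}"
        proof -
          have "m {x<..<x'} + m {y'<..<y} = m ({x<..<x'} \<union> {y'<..<y})"
            by (rule finite_measure_Union[symmetric]) (use o sets_mu in auto)
          also have "\<dots> \<le> m {x<..<y}" using o by (intro m_mono) auto
          finally show ?thesis .
        qed
        have "sqrt ((x' - x) * m {x<..<x'}) + sqrt ((y - y') * m {y'<..<y})
            \<le> sqrt (((x' - x) + (y - y')) * (m {x<..<x'} + m {y'<..<y}))"
          using o by (intro sqrt_mult_superadditive) auto
        also have "\<dots> \<le> sqrt ((y - x) * m {x<..<y})"
          using o mm by (intro real_sqrt_le_mono mult_mono) auto
        finally have "c\<^sub>0 * (sqrt ((x' - x) * m {x<..<x'}) + sqrt ((y - y') * m {y'<..<y}))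
            \<le> c\<^sub>0 * sqrt ((y - x) * m {x<..<y})"
          using c0 by (rule mult_left_mono)
        moreover have "2 * \<eta> * (m {x<..<x'} + m {y'<..<y}) \<le> 2 * \<eta> * m {x<..<y}"
          using mm \<eta> by (intro mult_left_mono) auto
        ultimately show "\<bar>c y - c x\<bar> \<le> c\<^sub>0 * sqrt ((y - x) * m {x<..<y}) + 2 * \<eta> * m {x<..<y} + e"
          using 1 2 xy'(7) unfolding distrib_left by linarith
      qed
    qed
  qed
qed

text \<open>\<open>c\<close> is the same function for every \<eta>, and the mass is bounded, so
  \<eta> may tend to 0 in \<open>c_bound_adm\<close>. The linear term, which alone could produce a
  Cantor part, disappears.\<close>

lemma c_bound:
  assumes xy: "x \<in> G" "y \<in> G" "x < y"
  shows "\<bar>c y - c x\<bar> \<le> c\<^sub>0 * sqrt ((y - x) * m {x<..<y})"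
proof (rule field_le_epsilon)
  fix e :: real assume e: "e > 0"
  define M where "M = m (space \<mu>) + 1"
  have M: "M > 0" "m (space \<mu>) \<le> M" using measure_nonneg[of \<mu> "space \<mu>"] unfolding M_def by linarith+
  define \<eta> where "\<eta> = e / (2 * M)"
  have \<eta>: "\<eta> > 0" using e M by (simp add: \<eta>_def)
  obtain \<kappa> where "adm \<eta> \<kappa>" using ex_adm[OF \<eta>] by blast
  from c_bound_adm[OF this \<eta> xy]
  have "\<bar>c y - c x\<bar> \<le> c\<^sub>0 * sqrt ((y - x) * m {x<..<y}) + 2 * \<eta> * m {x<..<y}" .
  also have "2 * \<eta> * m {x<..<y} \<le> 2 * \<eta> * M"
    using order.trans[OF m_le[of "{x<..<y}"] M(2)] \<eta> by (intro mult_left_mono) auto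
  also have "2 * \<eta> * M = e" using M by (simp add: \<eta>_def)
  finally show "\<bar>c y - c x\<bar> \<le> c\<^sub>0 * sqrt ((y - x) * m {x<..<y}) + e" by simp
qed

lemma approach_from_right:
  assumes "a \<le> x" "x < y" "y \<le> b"
  obtains s where "\<And>n. s n \<in> G" "\<And>n::nat. x < s n" "\<And>n. s n < y" "s \<longlonglongrightarrow> x"
proof -
  have "\<exists>z. z \<in> G \<and> x < z \<and> z < min y (x + 1 / Suc n)" for n
  proof -
    have "x < min y (x + 1 / Suc n)" using assms by simp
    moreover have "min y (x + 1 / Suc n) \<le> b" using assms by simp
    ultimately obtain z where "z \<in> G" "x < z" "z < min y (x + 1 / Suc n)"
      using G_dense[OF assms(1)] by blast
    then show ?thesis by blast
  qed
  then obtain s where s: "\<And>n. s n \<in> G" "\<And>n. x < s n" "\<And>n. s n < min y (x + 1 / Suc n)" by metis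
  have "s \<longlonglongrightarrow> x"
  proof (rule tendsto_sandwich[of "\<lambda>_. x" _ _ "\<lambda>n. x + 1 / real (Suc n)"])
    show "(\<lambda>n. x + 1 / real (Suc n)) \<longlonglongrightarrow> x"
      using tendsto_add[OF tendsto_const LIMSEQ_Suc[OF lim_1_over_n]] by simp
  qed (use s in \<open>auto intro!: always_eventually less_imp_le\<close>)
  then show ?thesis using s by (intro that[of s]) auto
qed

lemma approach_from_left:
  assumes "a \<le> x" "x < y" "y \<le> b"
  obtains s where "\<And>n. s n \<in> G" "\<And>n::nat. x < s n" "\<And>n. s n < y" "s \<longlonglongrightarrow> y"
proof -
  have "\<exists>z. z \<in> G \<and> max x (y - 1 / Suc n) < z \<and> z < y" for n
  proof -
    have "max x (y - 1 / Suc n) < y" using assms by simp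
    moreover have "a \<le> max x (y - 1 / Suc n)" using assms by simp
    ultimately obtain z where "z \<in> G" "max x (y - 1 / Suc n) < z" "z < y"
      using G_dense[OF _ _ assms(3)] by blast
    then show ?thesis by blast
  qed
  then obtain s where s: "\<And>n. s n \<in> G" "\<And>n. max x (y - 1 / Suc n) < s n" "\<And>n. s n < y" by metis
  have "s \<longlonglongrightarrow> y"
  proof (rule tendsto_sandwich[of "\<lambda>n. y - 1 / real (Suc n)" _ _ "\<lambda>_. y"])
    show "(\<lambda>n. y - 1 / real (Suc n)) \<longlonglongrightarrow> y"
      using tendsto_diff[OF tendsto_const LIMSEQ_Suc[OF lim_1_over_n]] by simp
  qed (use s in \<open>auto intro!: always_eventually less_imp_le\<close>)
  then show ?thesis using s by (intro that[of s]) auto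
qed

text \<open>By \<open>c_bound\<close> the function \<open>c\<close> is uniformly continuous on the
  dense set \<open>G\<close>, so it has a continuous extension \<open>h\<close> to the closed
  interval. The bound survives the extension, and \<open>primitive_of_L2I\<close> represents
  \<open>h\<close>.\<close>

theorem representation:
  obtains u\<^sub>0 g where "g \<in> L2 {a<..<b}"
    "\<And>x. x \<in> G \<Longrightarrow> w x = u\<^sub>0 + primitive (lebesgue_on {a<..<b}) g x + primitive (count_space D) jump x"
proof -
  have "uniformly_continuous_on G c"
    unfolding uniformly_continuous_on_def
  proof (intro allI impI)
    fix e :: real assume "e > 0"
    then obtain r where r: "r > 0" "\<And>p q. 0 \<le> p \<Longrightarrow> p \<le> r \<Longrightarrow> c\<^sub>0 * sqrt (p * m q) < e"
      using small_sqrt by blast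
    have less: "dist (c y) (c x) < e" if "x \<in> G" "y \<in> G" "x < y" "dist y x < r" for x y
      using c_bound[OF that(1-3)] r(2)[of "y - x" "{x<..<y}"] that by (auto simp: dist_real_def)
    have "dist (c y) (c x) < e" if "x \<in> G" "y \<in> G" "dist y x < r" for x y
      using less[of x y] less[of y x] that \<open>e > 0\<close>
      by (cases x y rule: linorder_cases) (auto simp: dist_commute)
    with r(1) show "\<exists>d>0. \<forall>x\<in>G. \<forall>x'\<in>G. dist x' x < d \<longrightarrow> dist (c x') (c x) < e" by blast
  qed
  then obtain h where h: "uniformly_continuous_on (closure G) h" "\<And>x. x \<in> G \<Longrightarrow> c x = h x"
    by (rule uniformly_continuous_on_extension_on_closure) blast
  have "{a..b} \<subseteq> closure G"
  proof
    fix x assume x: "x \<in> {a..b}"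
    show "x \<in> closure G"
    proof (cases "x < b")
      case True
      then obtain s where "\<And>n. s n \<in> G" "s \<longlonglongrightarrow> x"
        using approach_from_right[of x b] x by (metis atLeastAtMost_iff order_refl)
      then show ?thesis by (auto simp: closure_sequential)
    next
      case False
      then obtain s where "\<And>n. s n \<in> G" "s \<longlonglongrightarrow> x"
        using approach_from_left[of a b] x ab by (metis atLeastAtMost_iff order_refl order.antisym linorder_not_less)
      then show ?thesis by (auto simp: closure_sequential)
    qed
  qed
  then have h_cont: "continuous_on {a..b} h"
    using h(1) uniformly_continuous_imp_continuous continuous_on_subset by blast
  \<comment> \<open>The constant is absorbed into the measure, since \<open>primitive_of_L2I\<close>
    is stated without one.\<close>
  define \<mu>' where "\<mu>' = scale_measure (ennreal (c\<^sub>0\<^sup>2)) \<mu>"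
  have mu': "finite_measure \<mu>'" "sets \<mu>' = sets borel"
    unfolding \<mu>'_def using sets_mu
    by (auto intro!: finite_measureI simp: emeasure_scale_measure emeasure_eq_measure ennreal_mult[symmetric])
  have m': "measure \<mu>' A = c\<^sub>0\<^sup>2 * m A" for A
    by (simp add: \<mu>'_def measure_scale_measure)
  have bound: "(h y - h x)\<^sup>2 \<le> (y - x) * measure \<mu>' {x<..<y}" if xy: "a \<le> x" "x < y" "y \<le> b" for x y
  proof -
    \<comment> \<open>The midpoint separates the two approximating sequences, so that
      \<open>s n < t n\<close> for every \<open>n\<close>. Approximation from inside gives
      \<open>{s n<..<t n} \<subseteq> {x<..<y}\<close>, and monotonicity of the measure suffices in
      the limit.\<close>
    define p where "p = (x + y) / 2"
    have p: "x < p" "p < y" using xy by (auto simp: p_def)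
    obtain s where s: "\<And>n. s n \<in> G" "\<And>n::nat. x < s n" "\<And>n. s n < p" "s \<longlonglongrightarrow> x"
      using approach_from_right[of x p] xy p by auto
    obtain t where t: "\<And>n. t n \<in> G" "\<And>n::nat. p < t n" "\<And>n. t n < y" "t \<longlonglongrightarrow> y"
      using approach_from_left[of p y] xy p by auto
    have s_ab: "s n \<in> {a..b}" for n using s(2)[of n] s(3)[of n] xy p by auto
    have t_ab: "t n \<in> {a..b}" for n using t(2)[of n] t(3)[of n] xy p by auto
    have "(\<lambda>n. h (s n)) \<longlonglongrightarrow> h x"
      by (rule continuous_on_tendsto_compose[OF h_cont s(4)])
         (use xy s_ab in \<open>auto intro!: always_eventually\<close>)
    moreover have "(\<lambda>n. h (t n)) \<longlonglongrightarrow> h y"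
      by (rule continuous_on_tendsto_compose[OF h_cont t(4)])
         (use xy t_ab in \<open>auto intro!: always_eventually\<close>)
    ultimately have "(\<lambda>n. (h (t n) - h (s n))\<^sup>2) \<longlonglongrightarrow> (h y - h x)\<^sup>2"
      by (intro tendsto_intros)
    moreover have "(h (t n) - h (s n))\<^sup>2 \<le> (y - x) * measure \<mu>' {x<..<y}" for n
    proof -
      have st: "s n < t n" using s(3)[of n] t(2)[of n] by linarith
      have "\<bar>h (t n) - h (s n)\<bar> \<le> c\<^sub>0 * sqrt ((t n - s n) * m {s n<..<t n})"
        using c_bound[OF s(1) t(1) st] h(2) s(1) t(1) by simp
      then have "(h (t n) - h (s n))\<^sup>2 \<le> (c\<^sub>0 * sqrt ((t n - s n) * m {s n<..<t n}))\<^sup>2"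
        by (rule order.trans[OF eq_refl[OF power2_abs[symmetric]] power_mono]) simp
      also have "\<dots> = (t n - s n) * (c\<^sub>0\<^sup>2 * m {s n<..<t n})"
        using st by (simp add: power_mult_distrib)
      also have "\<dots> \<le> (y - x) * (c\<^sub>0\<^sup>2 * m {x<..<y})"
        using st s(2)[of n] t(3)[of n] by (intro mult_mono mult_nonneg_nonneg m_mono) auto
      finally show ?thesis unfolding m' .
    qed
    ultimately show ?thesis by (intro LIMSEQ_le_const2) auto
  qed
  obtain g where g: "g \<in> L2 {a<..<b}"
    "\<And>x. x \<in> {a..b} \<Longrightarrow> h x = h a + primitive (lebesgue_on {a<..<b}) g x"
    using primitive_of_L2I[OF ab h_cont mu' bound] by blast
  show ?thesis
  proof (rule that[OF g(1)])
    fix x assume x: "x \<in> G"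
    then have "h x = h a + primitive (lebesgue_on {a<..<b}) g x"
      by (intro g(2)) (auto simp: G_def)
    with h(2)[OF x] show "w x = h a + primitive (lebesgue_on {a<..<b}) g x + primitive (count_space D) jump x"
      by (simp add: c_def U_def)
  qed
qed

end

section \<open>Differentiability almost everywhere\<close>

text \<open>Weak-type estimate for the maximal function of \<nu> restricted to \<open>B\<close>, by
  Vitali's covering lemma: disjoint balls of radius r each carry mass above \<theta> r in
  \<open>B\<close>, while their fivefold enlargements, of length 10 r, cover the exceptional set.
  Passing to the cover \<open>T\<close> avoids the measurability of that set.\<close>

lemma maximal_inequality:
  fixes \<nu> :: "real measure"
  assumes fin: "finite_measure \<nu>" and sets_nu: "sets \<nu> = sets borel" and B: "B \<in> sets borel" and \<theta>: "\<theta> > 0"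
  obtains T where "T \<in> lmeasurable" "measure lebesgue T \<le> 10 * measure \<nu> B / \<theta>"
    "\<And>x r. 0 < r \<Longrightarrow> r \<le> 1 \<Longrightarrow> \<theta> * r < measure \<nu> (cball x r \<inter> B) \<Longrightarrow> x \<in> T"
proof -
  interpret finite_measure \<nu> by fact
  define S where "S = {x. \<exists>r. 0 < r \<and> r \<le> 1 \<and> \<theta> * r < measure \<nu> (cball x r \<inter> B)}"
  define \<rho> where "\<rho> x = (SOME r. 0 < r \<and> r \<le> 1 \<and> \<theta> * r < measure \<nu> (cball x r \<inter> B))" for x
  have \<rho>: "0 < \<rho> x \<and> \<rho> x \<le> 1 \<and> \<theta> * \<rho> x < measure \<nu> (cball x (\<rho> x) \<inter> B)" if "x \<in> S" for x
    unfolding \<rho>_def by (rule someI_ex) (use that in \<open>simp add: S_def\<close>)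
  have cover: "S \<subseteq> (\<Union>i\<in>S. cball i (\<rho> i))" using \<rho> by force
  obtain C where C: "countable C" "C \<subseteq> S"
     "pairwise (\<lambda>i j. disjnt (cball i (\<rho> i)) (cball j (\<rho> j))) C"
     "S \<subseteq> (\<Union>i\<in>C. cball i (5 * \<rho> i))"
    using Vitali_covering_lemma_cballs[OF cover, of 1] \<rho> by blast
  have mle: "measure lebesgue (\<Union>i\<in>I. cball i (5 * \<rho> i)) \<le> 10 * measure \<nu> B / \<theta>"
    if I: "I \<subseteq> C" "finite I" for I
  proof -
    have disj: "disjoint_family_on (\<lambda>i. cball i (\<rho> i) \<inter> B) I"
      using C(3) I(1) unfolding disjoint_family_on_def pairwise_def disjnt_def by blast
    have "measure lebesgue (\<Union>i\<in>I. cball i (5 * \<rho> i)) \<le> (\<Sum>i\<in>I. measure lebesgue (cball i (5 * \<rho> i)))"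
      using I(2) by (intro measure_UNION_le) auto
    also have "\<dots> \<le> (\<Sum>i\<in>I. 10 / \<theta> * measure \<nu> (cball i (\<rho> i) \<inter> B))"
    proof (rule sum_mono)
      fix i assume "i \<in> I"
      then have r: "0 < \<rho> i" "\<theta> * \<rho> i < measure \<nu> (cball i (\<rho> i) \<inter> B)" using \<rho> I C by blast+
      have "measure lebesgue (cball i (5 * \<rho> i)) = 10 * \<rho> i"
        using r(1) by (simp add: cball_eq_atLeastAtMost)
      also have "\<dots> = 10 / \<theta> * (\<theta> * \<rho> i)" using \<theta> by simp
      also have "\<dots> \<le> 10 / \<theta> * measure \<nu> (cball i (\<rho> i) \<inter> B)"
        using r \<theta> by (intro mult_left_mono) auto
      finally show "measure lebesgue (cball i (5 * \<rho> i)) \<le> 10 / \<theta> * measure \<nu> (cball i (\<rho> i) \<inter> B)" .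
    qed
    also have "\<dots> = 10 / \<theta> * measure \<nu> (\<Union>i\<in>I. cball i (\<rho> i) \<inter> B)"
    proof -
      have "measure \<nu> (\<Union>i\<in>I. cball i (\<rho> i) \<inter> B) = (\<Sum>i\<in>I. measure \<nu> (cball i (\<rho> i) \<inter> B))"
        by (rule finite_measure_finite_Union[OF I(2) _ disj]) (unfold sets_nu, use B in auto)
      then show ?thesis by (simp only: sum_distrib_left)
    qed
    also have "\<dots> \<le> 10 / \<theta> * measure \<nu> B"
      using \<theta> B sets_nu by (intro mult_left_mono finite_measure_mono) auto
    finally show ?thesis by simp
  qed
  show ?thesis
  proof (rule that[of "\<Union>i\<in>C. cball i (5 * \<rho> i)"])
    show "(\<Union>i\<in>C. cball i (5 * \<rho> i)) \<in> lmeasurable"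
      by (rule fmeasurable_UN_bound[OF C(1) _ mle]) auto
    show "measure lebesgue (\<Union>i\<in>C. cball i (5 * \<rho> i)) \<le> 10 * measure \<nu> B / \<theta>"
      by (rule measure_UN_bound[OF C(1) _ mle]) auto
    fix x r :: real assume "0 < r" "r \<le> 1" "\<theta> * r < measure \<nu> (cball x r \<inter> B)"
    then have "x \<in> S" by (auto simp: S_def)
    then show "x \<in> (\<Union>i\<in>C. cball i (5 * \<rho> i))" using C(4) by blast
  qed
qed

text \<open>The sum of \<open>w z\<close> times the Dirac mass at \<open>z\<close> over
  \<open>J\<close>. The image under the identity changes the sigma-algebra to the Borel one, as
  \<open>BV_derivative\<close> demands; \<open>ennreal\<close> turns negative weights into
  0.\<close>

definition atoms :: "real set \<Rightarrow> (real \<Rightarrow> real) \<Rightarrow> real measure" where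
  "atoms J w = distr (density (count_space J) (\<lambda>z. ennreal (w z))) borel (\<lambda>z. z)"

lemma sets_atoms: "sets (atoms J w) = sets borel"
  by (simp add: atoms_def)

lemma emeasure_atoms:
  assumes "A \<in> sets borel"
  shows "emeasure (atoms J w) A = (\<integral>\<^sup>+z. ennreal (w z) * indicator A z \<partial>count_space J)"
proof -
  have "emeasure (atoms J w) A = emeasure (density (count_space J) (\<lambda>z. ennreal (w z))) (A \<inter> J)"
    unfolding atoms_def using assms by (subst emeasure_distr) auto
  also have "\<dots> = (\<integral>\<^sup>+z. ennreal (w z) * indicator (A \<inter> J) z \<partial>count_space J)"
    by (rule emeasure_density) auto
  also have "\<dots> = (\<integral>\<^sup>+z. ennreal (w z) * indicator A z \<partial>count_space J)"
    by (rule nn_integral_cong) (auto simp: indicator_def)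
  finally show ?thesis .
qed

lemma emeasure_atoms_eq_0:
  assumes "A \<in> sets borel" "\<And>z. z \<in> A \<Longrightarrow> z \<in> J \<Longrightarrow> w z \<le> 0"
  shows "emeasure (atoms J w) A = 0"
proof -
  have "(\<integral>\<^sup>+z. ennreal (w z) * indicator A z \<partial>count_space J) = (\<integral>\<^sup>+z. 0 \<partial>count_space J)"
    by (rule nn_integral_cong) (use assms(2) in \<open>auto simp: indicator_def ennreal_neg\<close>)
  then show ?thesis by (simp add: emeasure_atoms[OF assms(1)])
qed

lemma finite_measure_atoms:
  assumes "integrable (count_space J) w" "\<And>z. z \<in> J \<Longrightarrow> 0 \<le> w z"
  shows "finite_measure (atoms J w)"
proof (rule finite_measureI)
  have "emeasure (atoms J w) UNIV = ennreal (LINT z|count_space J. w z)"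
    using assms by (auto simp: emeasure_atoms intro!: nn_integral_eq_integral)
  then show "emeasure (atoms J w) (space (atoms J w)) \<noteq> \<infinity>"
    by (simp add: atoms_def)
qed

lemma measure_atoms:
  assumes "integrable (count_space J) w" "\<And>z. z \<in> J \<Longrightarrow> 0 \<le> w z" "A \<in> sets borel"
  shows "measure (atoms J w) A = (LINT z|count_space J. w z * indicator A z)"
proof -
  have "integrable (count_space J) (\<lambda>z. w z * indicator A z)"
    by (rule integrable_mult_indicator_borel) (use assms in auto)
  then have "(\<integral>\<^sup>+z. ennreal (w z * indicator A z) \<partial>count_space J)
      = ennreal (LINT z|count_space J. w z * indicator A z)"
    using assms by (intro nn_integral_eq_integral) (auto intro!: mult_nonneg_nonneg)
  moreover have "(\<integral>\<^sup>+z. ennreal (w z * indicator A z) \<partial>count_space J)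
      = (\<integral>\<^sup>+z. ennreal (w z) * indicator A z \<partial>count_space J)"
    by (rule nn_integral_cong) (auto simp: indicator_def)
  moreover have "0 \<le> (LINT z|count_space J. w z * indicator A z)"
    using assms by (intro integral_nonneg_AE AE_I2) auto
  ultimately show ?thesis by (simp add: measure_def emeasure_atoms[OF assms(3)])
qed

lemma integral_atoms:
  assumes "\<And>z. z \<in> J \<Longrightarrow> 0 \<le> w z" "\<psi> \<in> borel_measurable borel"
  shows "(LINT x|atoms J w. \<psi> x) = (LINT z|count_space J. w z * \<psi> z)"
proof -
  have "(LINT x|atoms J w. \<psi> x) = (LINT z|density (count_space J) (\<lambda>z. ennreal (w z)). \<psi> z)"
    unfolding atoms_def by (rule integral_distr) (use assms in auto)
  also have "\<dots> = (LINT z|count_space J. w z *\<^sub>R \<psi> z)"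
    by (rule integral_density) (use assms in \<open>auto intro: AE_I2\<close>)
  finally show ?thesis by simp
qed

text \<open>Continuity from above along the tails of an enumeration of \<open>D\<close>.\<close>

lemma finite_subset_exhausts_atoms:
  assumes fin: "finite_measure \<nu>" and sets_nu: "sets \<nu> = sets borel" and D: "countable (D :: real set)" and e: "e > 0"
  obtains F where "finite F" "F \<subseteq> D" "measure \<nu> (D - F) < e"
proof (cases "D = {}")
  case True
  then show ?thesis using e by (intro that[of "{}"]) auto
next
  case False
  interpret finite_measure \<nu> by fact
  have D_borel: "X \<in> sets borel" if "X \<subseteq> D" for X
    by (rule sets.countable[OF _ countable_subset[OF that D]]) auto
  define A where "A n = D - from_nat_into D ` {..n}" for n
  have "(\<lambda>n. measure \<nu> (A n)) \<longlonglongrightarrow> measure \<nu> (\<Inter>n. A n)"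
  proof (rule finite_Lim_measure_decseq)
    show "range A \<subseteq> sets \<nu>" unfolding sets_nu using D_borel by (auto simp: A_def)
    show "decseq A" unfolding A_def decseq_def by (intro allI impI Diff_mono image_mono) auto
  qed
  moreover have "(\<Inter>n. A n) = {}"
  proof (intro equals0I)
    fix x assume x: "x \<in> (\<Inter>n. A n)"
    then have "x \<in> D" by (auto simp: A_def)
    then obtain n where "from_nat_into D n = x" using from_nat_into_surj[OF D] by blast
    moreover have "x \<in> A n" using x by blast
    ultimately show False by (auto simp: A_def)
  qed
  ultimately have "(\<lambda>n. measure \<nu> (A n)) \<longlonglongrightarrow> 0" by simp
  then have "\<forall>\<^sub>F n in sequentially. measure \<nu> (A n) < e"
    using e by (rule order_tendstoD)
  then obtain n where "measure \<nu> (A n) < e" by (auto simp: eventually_sequentially)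
  moreover have "A n = D - (from_nat_into D ` {..n})" by (simp add: A_def)
  ultimately show ?thesis
    using from_nat_into[OF False] by (intro that[of "from_nat_into D ` {..n}"]) auto
qed

lemma has_real_derivative_of_bounds:
  assumes "\<And>e. e > 0 \<Longrightarrow> \<exists>r>0. \<forall>y. y \<noteq> x \<longrightarrow> \<bar>y - x\<bar> < r \<longrightarrow> \<bar>f y - f x - d * (y - x)\<bar> \<le> e * \<bar>y - x\<bar>"
  shows "(f has_real_derivative d) (at x)"
  unfolding has_field_derivative_iff LIM_def
proof (intro allI impI)
  fix e :: real assume e: "e > 0"
  then obtain r where r: "r > 0" "\<forall>y. y \<noteq> x \<longrightarrow> \<bar>y - x\<bar> < r \<longrightarrow> \<bar>f y - f x - d * (y - x)\<bar> \<le> e / 2 * \<bar>y - x\<bar>"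
    using assms[of "e / 2"] by auto
  have "dist ((f y - f x) / (y - x)) d < e" if y: "y \<noteq> x" "dist y x < r" for y
  proof -
    have "(f y - f x) / (y - x) - d = (f y - f x - d * (y - x)) / (y - x)"
      using y by (simp add: field_simps)
    then have "dist ((f y - f x) / (y - x)) d = \<bar>f y - f x - d * (y - x)\<bar> / \<bar>y - x\<bar>"
      by (simp add: dist_real_def abs_divide)
    also have "\<dots> \<le> e / 2"
      using r(2) y by (simp add: pos_divide_le_eq dist_real_def)
    also have "\<dots> < e" using e by simp
    finally show ?thesis .
  qed
  with r(1) show "\<exists>s>0. \<forall>xa. xa \<noteq> x \<and> dist xa x < s \<longrightarrow> dist ((f xa - f x) / (xa - x)) d < e"
    by blast
qed

text \<open>A point outside \<open>D\<close> keeps a positive distance from any finite set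
  \<open>F\<close> of jumps, so near it only the jumps in \<open>D - F\<close> count. Their total
  size can be made small, and the maximal inequality bounds the set where they still cause
  difference quotients above \<theta>.\<close>

lemma jump_function_deriv_zero:
  assumes D: "countable D" and int: "integrable (count_space D) j"
  obtains N where "negligible N" "\<And>x. x \<notin> N \<Longrightarrow> (primitive (count_space D) j has_real_derivative 0) (at x)"
proof -
  let ?P = "primitive (count_space D) j"
  define \<nu> where "\<nu> = atoms D (\<lambda>z. \<bar>j z\<bar>)"
  have fin: "finite_measure \<nu>"
    unfolding \<nu>_def by (rule finite_measure_atoms) (use int in auto)
  have sets_nu: "sets \<nu> = sets borel" by (simp add: \<nu>_def sets_atoms)
  interpret finite_measure \<nu> by (rule fin)
  have D_borel: "X \<in> sets borel" if "X \<subseteq> D" for X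
    by (rule sets.countable[OF _ countable_subset[OF that D]]) auto
  have diff_le: "\<bar>?P y - ?P x\<bar> \<le> measure \<nu> {x..<y}" if "x \<le> y" for x y
  proof -
    have "\<bar>?P y - ?P x\<bar> = \<bar>LINT t|count_space D. j t * indicator {x..<y} t\<bar>"
      by (subst primitive_diff) (use int that in auto)
    also have "\<dots> \<le> (LINT t|count_space D. \<bar>j t * indicator {x..<y} t\<bar>)"
      by (rule integral_abs_bound)
    also have "\<dots> = (LINT t|count_space D. \<bar>j t\<bar> * indicator {x..<y} t)"
      by (simp add: abs_mult)
    also have "\<dots> = measure \<nu> {x..<y}"
      unfolding \<nu>_def by (rule measure_atoms[symmetric]) (use int in auto)
    finally show ?thesis .
  qed
  have off_D: "measure \<nu> (- D) = 0"
    unfolding \<nu>_def measure_def using D_borel[of D] by (subst emeasure_atoms_eq_0) auto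
  define good where "good \<theta> x \<longleftrightarrow> (\<exists>r>0. \<forall>y. y \<noteq> x \<longrightarrow> \<bar>y - x\<bar> < r \<longrightarrow> \<bar>?P y - ?P x\<bar> \<le> \<theta> * \<bar>y - x\<bar>)"
    for \<theta> :: real and x
  have neg: "negligible {x. x \<notin> D \<and> \<not> good \<theta> x}" if \<theta>: "\<theta> > 0" for \<theta>
    unfolding negligible_outer_le
  proof (intro allI impI)
    fix e :: real assume "e > 0"
    \<comment> \<open>This mass makes the bound of \<open>maximal_inequality\<close>, with its
      factor 10, at most \<open>e\<close>.\<close>
    then have "e * \<theta> / 10 > 0" using \<theta> by simp
    then obtain F where F: "finite F" "F \<subseteq> D" "measure \<nu> (D - F) < e * \<theta> / 10"
      using finite_subset_exhausts_atoms[OF fin sets_nu D] by blast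
    have B: "D - F \<in> sets borel" by (rule D_borel) auto
    obtain T where T: "T \<in> lmeasurable" "measure lebesgue T \<le> 10 * measure \<nu> (D - F) / \<theta>"
      "\<And>x r. 0 < r \<Longrightarrow> r \<le> 1 \<Longrightarrow> \<theta> * r < measure \<nu> (cball x r \<inter> (D - F)) \<Longrightarrow> x \<in> T"
      using maximal_inequality[OF fin sets_nu B \<theta>] by blast
    have "{x. x \<notin> D \<and> \<not> good \<theta> x} \<subseteq> T"
    proof
      fix x assume x: "x \<in> {x. x \<notin> D \<and> \<not> good \<theta> x}"
      obtain r where r: "r > 0" "\<And>t. t \<in> F \<Longrightarrow> t \<in> ball x r \<Longrightarrow> t = x"
        using isolated_from_finite[OF F(1)] by blast
      have "min r 1 > 0" using r(1) by simp
      moreover have "\<not> good \<theta> x" using x by simp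
      ultimately have "\<exists>y. y \<noteq> x \<and> \<bar>y - x\<bar> < min r 1 \<and> \<not> \<bar>?P y - ?P x\<bar> \<le> \<theta> * \<bar>y - x\<bar>"
        unfolding good_def by blast
      then obtain y where y: "y \<noteq> x" "\<bar>y - x\<bar> < min r 1" "\<theta> * \<bar>y - x\<bar> < \<bar>?P y - ?P x\<bar>"
        unfolding not_le by blast
      have "\<bar>?P y - ?P x\<bar> \<le> measure \<nu> (cball x \<bar>y - x\<bar>)"
      proof (cases "x \<le> y")
        case True
        then have "\<bar>?P y - ?P x\<bar> \<le> measure \<nu> {x..<y}" by (rule diff_le)
        also have "\<dots> \<le> measure \<nu> (cball x \<bar>y - x\<bar>)"
          using True sets_nu by (intro finite_measure_mono) (auto simp: dist_real_def)
        finally show ?thesis .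
      next
        case False
        then have "\<bar>?P x - ?P y\<bar> \<le> measure \<nu> {y..<x}" by (intro diff_le) auto
        also have "\<dots> \<le> measure \<nu> (cball x \<bar>y - x\<bar>)"
          using False sets_nu by (intro finite_measure_mono) (auto simp: dist_real_def)
        finally show ?thesis by (simp add: abs_minus_commute)
      qed
      also have "\<dots> \<le> measure \<nu> ((cball x \<bar>y - x\<bar> \<inter> (D - F)) \<union> (- D))"
      proof (rule finite_measure_mono)
        show "cball x \<bar>y - x\<bar> \<subseteq> (cball x \<bar>y - x\<bar> \<inter> (D - F)) \<union> (- D)"
        proof
          fix t assume t: "t \<in> cball x \<bar>y - x\<bar>"
          then have "t \<in> ball x r" using y(2) by auto
          then show "t \<in> (cball x \<bar>y - x\<bar> \<inter> (D - F)) \<union> (- D)" using t r(2)[of t] x by auto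
        qed
      qed (use sets_nu B D_borel[of D] in auto)
      also have "\<dots> \<le> measure \<nu> (cball x \<bar>y - x\<bar> \<inter> (D - F)) + measure \<nu> (- D)"
        by (rule measure_Un_le) (use sets_nu B D_borel[of D] in auto)
      finally have "\<theta> * \<bar>y - x\<bar> < measure \<nu> (cball x \<bar>y - x\<bar> \<inter> (D - F))"
        using y(3) off_D by simp
      then show "x \<in> T" using y by (intro T(3)[of "\<bar>y - x\<bar>"]) auto
    qed
    moreover have "measure lebesgue T \<le> e"
    proof -
      have "10 * measure \<nu> (D - F) / \<theta> \<le> e"
        unfolding pos_divide_le_eq[OF \<theta>] using F(3) by linarith
      then show ?thesis using T(2) by linarith
    qed
    ultimately show "\<exists>T. {x. x \<notin> D \<and> \<not> good \<theta> x} \<subseteq> T \<and> T \<in> lmeasurable \<and> measure lebesgue T \<le> e"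
      using T(1) by blast
  qed
  define N where "N = D \<union> (\<Union>n. {x. x \<notin> D \<and> \<not> good (1 / real (Suc n)) x})"
  show ?thesis
  proof (rule that[of N])
    have "negligible D" using D by (rule negligible_of_countable)
    moreover have "negligible (\<Union>n. {x. x \<notin> D \<and> \<not> good (1 / real (Suc n)) x})"
      by (rule negligible_Union_nat) (rule neg, simp)
    ultimately show "negligible N" unfolding N_def by (rule negligible_Un)
    fix x assume x: "x \<notin> N"
    show "(?P has_real_derivative 0) (at x)"
    proof (rule has_real_derivative_of_bounds)
      fix e :: real assume "e > 0"
      then obtain n where n: "1 / real (Suc n) < e" using nat_approx_posE by blast
      have "good (1 / real (Suc n)) x" using x unfolding N_def by auto
      then obtain r where r: "r > 0"
        "\<And>y. y \<noteq> x \<Longrightarrow> \<bar>y - x\<bar> < r \<Longrightarrow> \<bar>?P y - ?P x\<bar> \<le> 1 / real (Suc n) * \<bar>y - x\<bar>"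
        unfolding good_def by blast
      have "\<bar>?P y - ?P x - 0 * (y - x)\<bar> \<le> e * \<bar>y - x\<bar>" if "y \<noteq> x" "\<bar>y - x\<bar> < r" for y
      proof -
        have "1 / real (Suc n) * \<bar>y - x\<bar> \<le> e * \<bar>y - x\<bar>" using n by (intro mult_right_mono) auto
        then show ?thesis using r(2)[OF that] by simp
      qed
      with r(1) show "\<exists>r>0. \<forall>y. y \<noteq> x \<longrightarrow> \<bar>y - x\<bar> < r \<longrightarrow> \<bar>?P y - ?P x - 0 * (y - x)\<bar> \<le> e * \<bar>y - x\<bar>"
        by blast
    qed
  qed
qed

section \<open>Lebesgue's differentiation theorem for primitives\<close>

lemma L2_imp_integrable:
  assumes "g \<in> L2 {a<..<b}"
  shows "integrable (lebesgue_on {a<..<b}) g"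
proof (rule Bochner_Integration.integrable_bound)
  interpret finite_measure "lebesgue_on {a<..<b}" by (rule finite_measure_lebesgue_on_Ioo)
  show "integrable (lebesgue_on {a<..<b}) (\<lambda>x. 1 + (g x)\<^sup>2)"
    using assms by (intro Bochner_Integration.integrable_add integrable_const) (simp add: L2_def)
  show "g \<in> borel_measurable (lebesgue_on {a<..<b})" using assms by (simp add: L2_def)
  have "\<bar>g x\<bar> \<le> 1 + (g x)\<^sup>2" for x
  proof -
    have "0 \<le> (\<bar>g x\<bar> - 1)\<^sup>2" by simp
    then have "2 * \<bar>g x\<bar> \<le> 1 + (g x)\<^sup>2" by (simp add: power2_diff)
    then show ?thesis using zero_le_power2[of "g x"] by linarith
  qed
  then show "AE x in lebesgue_on {a<..<b}. norm (g x) \<le> norm (1 + (g x)\<^sup>2)"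
    by (intro AE_I2) (simp add: add_nonneg_nonneg)
qed

text \<open>Passage to the gauge integral, for which the differentiation theorem used next is
  formulated. The half-open interval and the closed one differ by a null set.\<close>

lemma integral_lebesgue_on_Ioo_eq_HK:
  fixes g :: "real \<Rightarrow> real"
  assumes g: "integrable (lebesgue_on {a<..<b}) g" and xy: "x \<le> y"
  shows "(LINT t|lebesgue_on {a<..<b}. g t * indicator {x..<y} t)
      = integral {x..y} (\<lambda>t. indicator {a<..<b} t * g t)"
    and "(\<lambda>t. indicator {a<..<b} t * g t) integrable_on {x..y}"
proof -
  have int: "integrable lebesgue (\<lambda>t. indicator {a<..<b} t * g t)"
    using g by (simp add: integrable_lebesgue_on_iff)
  have "integrable lebesgue (\<lambda>t. indicator {x..y} t *\<^sub>R (indicator {a<..<b} t * g t))"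
    by (rule integrable_mult_indicator[OF _ int]) simp
  then have abs: "(\<lambda>t. indicator {a<..<b} t * g t) absolutely_integrable_on {x..y}"
    by (simp add: set_integrable_def)
  then show "(\<lambda>t. indicator {a<..<b} t * g t) integrable_on {x..y}"
    by (rule set_lebesgue_integral_eq_integral)
  have "(LINT t|lebesgue_on {a<..<b}. g t * indicator {x..<y} t)
      = (LINT t|lebesgue. indicator {a<..<b} t * (g t * indicator {x..<y} t))"
    by (simp add: integral_lebesgue_on_eq)
  also have "\<dots> = (LINT t|lebesgue. indicator {x..y} t *\<^sub>R (indicator {a<..<b} t * g t))"
  proof (rule integral_cong_AE)
    have "AE t in lebesgue. t \<noteq> y"
      by (rule AE_completion) (rule AE_lborel_singleton)
    then show "AE t in lebesgue. indicator {a<..<b} t * (g t * indicator {x..<y} t)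
        = indicator {x..y} t *\<^sub>R (indicator {a<..<b} t * g t)"
      by eventually_elim (auto simp: indicator_def)
    have "integrable (lebesgue_on {a<..<b}) (\<lambda>t. g t * indicator {x..<y} t)"
      by (rule integrable_mult_indicator_borel[OF g measurable_ident_lebesgue_on]) simp
    then have "integrable lebesgue (\<lambda>t. indicator {a<..<b} t * (g t * indicator {x..<y} t))"
      by (simp add: integrable_lebesgue_on_iff)
    then show "(\<lambda>t. indicator {a<..<b} t * (g t * indicator {x..<y} t)) \<in> borel_measurable lebesgue"
      by (rule borel_measurable_integrable)
    show "(\<lambda>t. indicator {x..y} t *\<^sub>R (indicator {a<..<b} t * g t)) \<in> borel_measurable lebesgue"
      using abs unfolding set_integrable_def by (rule borel_measurable_integrable)
  qed
  also have "\<dots> = integral {x..y} (\<lambda>t. indicator {a<..<b} t * g t)"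
    using set_lebesgue_integral_eq_integral(2)[OF abs] by (simp add: set_lebesgue_integral_def)
  finally show "(LINT t|lebesgue_on {a<..<b}. g t * indicator {x..<y} t)
      = integral {x..y} (\<lambda>t. indicator {a<..<b} t * g t)" .
qed

text \<open>The averages in \<open>integrable_ccontinuous_explicit\<close> are over intervals to the
  right of the point. The left-hand averages are those of the reflected integrand, whose exceptional
  set \<open>N2\<close> has to be reflected back.\<close>

lemma primitive_deriv_AE:
  assumes g: "integrable (lebesgue_on {a<..<b}) g"
  obtains N where "negligible N"
    "\<And>x. x \<in> {a<..<b} - N \<Longrightarrow> (primitive (lebesgue_on {a<..<b}) g has_real_derivative g x) (at x)"
proof -
  let ?P = "primitive (lebesgue_on {a<..<b}) g"
  define g0 where "g0 = (\<lambda>t. indicator {a<..<b} t * g t)"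
  have g0_int: "g0 integrable_on {x..y}" for x y
    using integral_lebesgue_on_Ioo_eq_HK(2)[OF g, of x y] by (cases "x \<le> y") (auto simp: g0_def)
  have P: "?P y - ?P x = integral {x..y} g0" if "x \<le> y" for x y
    using primitive_diff[OF g measurable_ident_lebesgue_on that] integral_lebesgue_on_Ioo_eq_HK(1)[OF g that]
    by (simp add: g0_def)
  have g0_cbox: "g0 integrable_on cbox x y" for x y
    using g0_int by simp
  have g0_refl: "(\<lambda>t. g0 (- t)) integrable_on cbox x y" for x y
    using g0_int[of "- y" "- x"] Henstock_Kurzweil_Integration.integrable_reflect_real[of g0 "- x" "- y"] by simp
  obtain N1 where N1: "negligible N1" "\<And>x e. x \<notin> N1 \<Longrightarrow> 0 < e \<Longrightarrow>
      \<exists>d>0. \<forall>h. 0 < h \<and> h < d \<longrightarrow> norm (integral (cbox x (x + h *\<^sub>R One)) g0 /\<^sub>R h ^ DIM(real) - g0 x) < e"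
    using integrable_ccontinuous_explicit[OF g0_cbox] by metis
  obtain N2 where N2: "negligible N2" "\<And>x e. x \<notin> N2 \<Longrightarrow> 0 < e \<Longrightarrow>
      \<exists>d>0. \<forall>h. 0 < h \<and> h < d \<longrightarrow>
        norm (integral (cbox x (x + h *\<^sub>R One)) (\<lambda>t. g0 (- t)) /\<^sub>R h ^ DIM(real) - g0 (- x)) < e"
    using integrable_ccontinuous_explicit[OF g0_refl] by metis
  show ?thesis
  proof (rule that[of "N1 \<union> uminus ` N2"])
    have "negligible (uminus ` N2)"
      by (rule negligible_differentiable_image_negligible[OF _ N2(1)])
         (auto intro!: differentiable_on_minus differentiable_on_ident)
    then show "negligible (N1 \<union> uminus ` N2)" using N1(1) by simp
    fix x assume x: "x \<in> {a<..<b} - (N1 \<union> uminus ` N2)"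
    have x1: "x \<notin> N1" and x2: "- x \<notin> N2" using x by (auto simp: image_iff)
    have g0x: "g0 x = g x" using x by (simp add: g0_def)
    show "(?P has_real_derivative g x) (at x)"
    proof (rule has_real_derivative_of_bounds)
      fix e :: real assume e: "e > 0"
      obtain d1 where d1: "d1 > 0"
        "\<And>h. 0 < h \<Longrightarrow> h < d1 \<Longrightarrow> \<bar>integral {x..x + h} g0 / h - g x\<bar> < e"
        using N1(2)[OF x1 e] by (auto simp: g0x divide_inverse mult.commute)
      obtain d2 where d2: "d2 > 0"
        "\<And>h. 0 < h \<Longrightarrow> h < d2 \<Longrightarrow> \<bar>integral {- x..- x + h} (\<lambda>t. g0 (- t)) / h - g x\<bar> < e"
        using N2(2)[OF x2 e] by (auto simp: g0x divide_inverse mult.commute)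
      have main: "\<bar>I - g x * h\<bar> \<le> e * h" if "\<bar>I / h - g x\<bar> < e" "h > 0" for I h :: real
      proof -
        have "I - g x * h = (I / h - g x) * h" using that by (simp add: field_simps)
        then have "\<bar>I - g x * h\<bar> = \<bar>I / h - g x\<bar> * h" using that by (simp add: abs_mult)
        also have "\<dots> \<le> e * h" using that by (intro mult_right_mono) auto
        finally show ?thesis .
      qed
      have "\<bar>?P y - ?P x - g x * (y - x)\<bar> \<le> e * \<bar>y - x\<bar>" if y: "y \<noteq> x" "\<bar>y - x\<bar> < min d1 d2" for y
      proof (cases "x < y")
        case True
        then have "\<bar>integral {x..y} g0 - g x * (y - x)\<bar> \<le> e * (y - x)"
          using main[OF d1(2)[of "y - x"]] y by simp
        then show ?thesis using P[of x y] True by simp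
      next
        case False
        have "integral {- x..- x + (x - y)} (\<lambda>t. g0 (- t)) = integral {y..x} g0"
          using Henstock_Kurzweil_Integration.integral_reflect_real[of x y g0] by simp
        then have "\<bar>integral {y..x} g0 - g x * (x - y)\<bar> \<le> e * (x - y)"
          using main[OF d2(2)[of "x - y"]] y False by simp
        then show ?thesis using P[of y x] False by (simp add: algebra_simps abs_minus_commute)
      qed
      then show "\<exists>r>0. \<forall>y. y \<noteq> x \<longrightarrow> \<bar>y - x\<bar> < r \<longrightarrow> \<bar>?P y - ?P x - g x * (y - x)\<bar> \<le> e * \<bar>y - x\<bar>"
        using d1(1) d2(1) by (intro exI[of _ "min d1 d2"]) auto
    qed
  qed
qed

text \<open>For an ordinary limit off a null set, the superlevel sets of the error lie in
  \<open>D\<close> for small radii, so their densities are eventually equal to 0.\<close>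

lemma has_approx_limI:
  assumes "negligible D" "\<And>\<eta>. \<eta> > 0 \<Longrightarrow> \<exists>r>0. \<forall>y\<in>U - D. \<bar>y - x\<bar> < r \<longrightarrow> \<bar>u y - z\<bar> \<le> \<eta>"
  shows "has_approx_lim U u x z"
  unfolding has_approx_lim_def
proof (intro allI impI)
  fix \<eta> :: real assume "\<eta> > 0"
  then obtain r where r: "r > 0" "\<forall>y\<in>U - D. \<bar>y - x\<bar> < r \<longrightarrow> \<bar>u y - z\<bar> \<le> \<eta>" using assms(2) by blast
  have "\<forall>\<^sub>F s in at_right 0. measure lebesgue {y \<in> U \<inter> ball x s. \<bar>u y - z\<bar> > \<eta>} / (2 * s) = 0"
  proof (rule eventually_at_rightI[of 0 r])
    fix s assume s: "s \<in> {0<..<r}"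
    have "{y \<in> U \<inter> ball x s. \<bar>u y - z\<bar> > \<eta>} \<subseteq> D"
      using r(2) s by (force simp: dist_real_def abs_minus_commute)
    then have "negligible {y \<in> U \<inter> ball x s. \<bar>u y - z\<bar> > \<eta>}"
      using assms(1) negligible_subset by blast
    then show "measure lebesgue {y \<in> U \<inter> ball x s. \<bar>u y - z\<bar> > \<eta>} / (2 * s) = 0"
      by (simp add: negligible_imp_measure0)
  qed (rule r(1))
  then show "((\<lambda>s. measure lebesgue {y \<in> U \<inter> ball x s. \<bar>u y - z\<bar> > \<eta>} / (2 * s)) \<longlongrightarrow> 0) (at_right 0)"
    by (rule tendsto_eventually)
qed

lemma has_approx_derivI:
  assumes D: "negligible D" and eq: "\<And>y. y \<in> U - D \<Longrightarrow> u y = F y"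
    and der: "(F has_real_derivative d) (at x)"
  shows "has_approx_deriv U u x d"
  unfolding has_approx_deriv_def
proof (intro exI conjI)
  show "has_approx_lim U u x (F x)"
  proof (rule has_approx_limI[OF D])
    fix \<eta> :: real assume "\<eta> > 0"
    moreover have "isCont F x" using der by (rule DERIV_isCont)
    ultimately obtain r where "r > 0" "\<forall>y. \<bar>y - x\<bar> < r \<longrightarrow> \<bar>F y - F x\<bar> < \<eta>"
      unfolding continuous_at_eps_delta dist_real_def by blast
    then show "\<exists>r>0. \<forall>y\<in>U - D. \<bar>y - x\<bar> < r \<longrightarrow> \<bar>u y - F x\<bar> \<le> \<eta>"
      using eq by (metis less_imp_le)
  qed
  show "has_approx_lim U (\<lambda>y. (u y - F x - d * (y - x)) / \<bar>y - x\<bar>) x 0"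
  proof (rule has_approx_limI[OF D])
    fix \<eta> :: real assume \<eta>: "\<eta> > 0"
    then obtain r where r: "r > 0" "\<forall>y. y \<noteq> x \<and> \<bar>y - x\<bar> < r \<longrightarrow> \<bar>(F y - F x) / (y - x) - d\<bar> < \<eta>"
      using der unfolding has_field_derivative_iff LIM_def dist_real_def by blast
    have "\<bar>(u y - F x - d * (y - x)) / \<bar>y - x\<bar> - 0\<bar> \<le> \<eta>" if y: "y \<in> U - D" "\<bar>y - x\<bar> < r" for y
    \<comment> \<open>For \<open>y = x\<close> the divisor is 0, and so is the quotient by
      convention.\<close>
    proof (cases "y = x")
      case False
      then have "F y - F x - d * (y - x) = ((F y - F x) / (y - x) - d) * (y - x)"
        by (simp add: field_simps)
      then have "\<bar>(u y - F x - d * (y - x)) / \<bar>y - x\<bar> - 0\<bar> = \<bar>(F y - F x) / (y - x) - d\<bar>"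
        using False eq[OF y(1)] by (simp add: abs_divide abs_mult)
      then show ?thesis using r(2) y False by (simp add: less_imp_le)
    qed (use \<eta> in simp)
    with r(1) show "\<exists>r>0. \<forall>y\<in>U - D. \<bar>y - x\<bar> < r \<longrightarrow> \<bar>(u y - F x - d * (y - x)) / \<bar>y - x\<bar> - 0\<bar> \<le> \<eta>"
      by blast
  qed
qed

section \<open>Absolutely continuous functions plus jumps are in SBV\<close>

lemma C1c_mono: "V \<subseteq> W \<Longrightarrow> C1c V \<subseteq> C1c W"
  by (auto simp: C1c_def)

lemma C1c_outside:
  assumes psi: "\<psi> \<in> C1c V" and x: "x \<notin> V"
  shows "\<psi> x = 0" "deriv \<psi> x = 0"
proof -
  let ?S = "closure {x. \<psi> x \<noteq> 0}"
  have xS: "x \<in> - ?S" using psi x by (auto simp: C1c_def)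
  have zero: "\<psi> y = 0" if "y \<in> - ?S" for y
    using that closure_subset[of "{x. \<psi> x \<noteq> 0}"] by auto
  show "\<psi> x = 0" by (rule zero[OF xS])
  have "(\<psi> has_real_derivative 0) (at x)"
  proof (rule has_field_derivative_transform_within_open[of "\<lambda>_. 0" 0 x "- ?S"])
    show "open (- ?S)" by (simp add: open_Compl)
    show "((\<lambda>_. 0) has_real_derivative 0) (at x)" by (rule DERIV_const)
    show "x \<in> - ?S" by (rule xS)
    show "0 = \<psi> y" if "y \<in> - ?S" for y using zero[OF that] by simp
  qed
  then show "deriv \<psi> x = 0" by (rule DERIV_imp_deriv)
qed

lemma C1c_bounded:
  assumes "\<psi> \<in> C1c {a<..<b}"
  obtains B where "\<And>x. \<bar>\<psi> x\<bar> \<le> B"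
proof -
  have "continuous_on {a..b} \<psi>"
    using C1c_Ioo(1)[OF assms] by (meson DERIV_continuous_on has_field_derivative_at_within)
  then have "bounded (\<psi> ` {a..b})"
    by (intro compact_imp_bounded compact_continuous_image) auto
  then obtain B where B: "\<forall>x\<in>{a..b}. \<bar>\<psi> x\<bar> \<le> B"
    unfolding bounded_iff by auto
  show ?thesis
  proof (rule that[of "max B 0"])
    fix x show "\<bar>\<psi> x\<bar> \<le> max B 0"
    proof (cases "x \<in> {a..b}")
      case True
      then have "\<bar>\<psi> x\<bar> \<le> B" using B by blast
      then show ?thesis by simp
    next
      case False
      then have "x \<notin> {a<..<b}" by auto
      then have "\<psi> x = 0" by (rule C1c_Ioo(3)[OF assms])
      then show ?thesis by simp
    qed
  qed
qed

lemma C1c_borel: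
  assumes "\<psi> \<in> C1c {a<..<b}" shows "\<psi> \<in> borel_measurable borel"
  using C1c_Ioo(1)[OF assms]
  by (intro borel_measurable_continuous_onI) (meson DERIV_continuous_on has_field_derivative_at_within)

lemma integral_deriv_C1c:
  assumes ab: "a < b" and psi: "\<psi> \<in> C1c {a<..<b}"
  shows "(LINT x|lebesgue_on {a<..<b}. deriv \<psi> x) = 0"
proof -
  have "(LINT x|lebesgue_on {a<..<b}. deriv \<psi> x) = integral {a..b} (deriv \<psi>)"
    by (rule LINT_Ioo_eq[OF C1c_Ioo(2)[OF psi]])
  also have "\<dots> = \<psi> b - \<psi> a"
    using ab C1c_Ioo(1)[OF psi] by (intro integral_unique fundamental_theorem_of_calculus)
      (auto simp: has_real_derivative_iff_has_vector_derivative[symmetric] intro: has_field_derivative_at_within)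
  also have "\<dots> = 0" using C1c_Ioo(3)[OF psi, of a] C1c_Ioo(3)[OF psi, of b] by simp
  finally show ?thesis .
qed

lemma integral_lebesgue_on_support:
  fixes h :: "real \<Rightarrow> real"
  assumes "V \<in> sets lebesgue" "W \<in> sets lebesgue" "V \<subseteq> W" "\<And>x. x \<notin> V \<Longrightarrow> h x = 0"
  shows "(LINT x|lebesgue_on V. h x) = (LINT x|lebesgue_on W. h x)"
  unfolding integral_lebesgue_on_eq[OF assms(1)] integral_lebesgue_on_eq[OF assms(2)]
  by (rule Bochner_Integration.integral_cong[OF refl]) (use assms(3,4) in \<open>auto simp: indicator_def\<close>)

text \<open>The set where \<open>u\<close> stays away from \<open>L\<close> fills, up to a null set,
  one half of every small ball around \<open>z\<close>. Its density is at least 1/2 and cannot tend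
  to 0.\<close>

lemma not_has_approx_lim_of_one_sided:
  assumes V: "open V" "z \<in> V" and u: "u \<in> borel_measurable (lebesgue_on V)" and D: "negligible D"
    and \<eta>: "\<eta> > 0" and r0: "r0 > 0"
    and far: "(\<forall>y. z - r0 < y \<longrightarrow> y < z \<longrightarrow> y \<in> V - D \<longrightarrow> \<bar>u y - L\<bar> > \<eta>) \<or>
      (\<forall>y. z < y \<longrightarrow> y < z + r0 \<longrightarrow> y \<in> V - D \<longrightarrow> \<bar>u y - L\<bar> > \<eta>)"
  shows "\<not> has_approx_lim V u z L"
proof
  assume lim: "has_approx_lim V u z L"
  obtain r1 where r1: "r1 > 0" "ball z r1 \<subseteq> V" using V open_contains_ball by blast
  let ?A = "\<lambda>r. {y \<in> V \<inter> ball z r. \<bar>u y - L\<bar> > \<eta>}"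
  have "\<forall>\<^sub>F r in at_right 0. measure lebesgue (?A r) / (2 * r) < 1 / 2"
    using lim \<eta> unfolding has_approx_lim_def by (intro order_tendstoD(2)) auto
  then obtain r2 where r2: "r2 > 0" "\<forall>r>0. r < r2 \<longrightarrow> measure lebesgue (?A r) / (2 * r) < 1 / 2"
    unfolding eventually_at_right_field by blast
  define r where "r = Min {r0, r1, r2} / 2"
  have r: "r > 0" "r < r0" "r < r1" "r < r2" using r0 r1 r2 by (auto simp: r_def)
  have "{y \<in> space (lebesgue_on V). \<bar>u y - L\<bar> > \<eta>} \<in> sets (lebesgue_on V)"
    using u by measurable
  then have "{y \<in> V. \<bar>u y - L\<bar> > \<eta>} \<in> sets lebesgue"
    using V by (simp add: sets_restrict_space_iff borel_open)
  then have "{y \<in> V. \<bar>u y - L\<bar> > \<eta>} \<inter> ball z r \<in> sets lebesgue" by auto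
  moreover have eqA: "{y \<in> V. \<bar>u y - L\<bar> > \<eta>} \<inter> ball z r = ?A r" by auto
  ultimately have A: "?A r \<in> lmeasurable"
    by (intro bounded_set_imp_lmeasurable) (auto intro: bounded_subset[OF bounded_ball[of z r]])
  obtain I where I: "I = {z - r<..<z} \<or> I = {z<..<z + r}" "I - D \<subseteq> ?A r"
  proof (cases "\<forall>y. z - r0 < y \<longrightarrow> y < z \<longrightarrow> y \<in> V - D \<longrightarrow> \<bar>u y - L\<bar> > \<eta>")
    case True
    have "{z - r<..<z} - D \<subseteq> ?A r"
    proof
      fix y assume y: "y \<in> {z - r<..<z} - D"
      then have "y \<in> ball z r" "y \<in> ball z r1" using r by (auto simp: dist_real_def)
      then have yb: "y \<in> ball z r" "y \<in> V - D" using r1(2) y by blast+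
      then have "\<bar>u y - L\<bar> > \<eta>" using True y r by simp
      then show "y \<in> ?A r" using yb by simp
    qed
    then show ?thesis by (intro that[of "{z - r<..<z}"]) auto
  next
    case False
    then have far': "\<forall>y. z < y \<longrightarrow> y < z + r0 \<longrightarrow> y \<in> V - D \<longrightarrow> \<bar>u y - L\<bar> > \<eta>"
      using far by blast
    have "{z<..<z + r} - D \<subseteq> ?A r"
    proof
      fix y assume y: "y \<in> {z<..<z + r} - D"
      then have "y \<in> ball z r" "y \<in> ball z r1" using r by (auto simp: dist_real_def)
      then have yb: "y \<in> ball z r" "y \<in> V - D" using r1(2) y by blast+
      then have "\<bar>u y - L\<bar> > \<eta>" using far' y r by simp
      then show "y \<in> ?A r" using yb by simp
    qed
    then show ?thesis by (intro that[of "{z<..<z + r}"]) auto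
  qed
  have "r = measure lebesgue I" using I(1) r by auto
  also have "\<dots> = measure lebesgue (I - D)"
    by (rule measure_negligible_symdiff[symmetric])
       (use I(1) in \<open>auto intro!: negligible_subset[OF D]\<close>)
  also have "\<dots> \<le> measure lebesgue (?A r)"
  proof (rule measure_mono_fmeasurable[OF I(2) _ A])
    have "I \<in> sets lebesgue" using I(1) by auto
    then show "I - D \<in> sets lebesgue" using negligible_imp_sets[OF D] by (rule sets.Diff)
  qed
  finally have "1 / 2 \<le> measure lebesgue (?A r) / (2 * r)"
    using r(1) by (simp add: field_simps)
  then show False using r2(2) r by force
qed

text \<open>\<open>primitive_by_parts\<close> for the two measures identifies the distributional
  derivative: \<open>g\<close> is its density and the rest is the sum of \<open>j z\<close> times
  the Dirac mass at \<open>z\<close>. At each \<open>z\<close> with \<open>j z \<noteq> 0\<close>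
  the one-sided limits differ, so the singular part sits on the approximate discontinuity
  set.\<close>

lemma SBV_of_representation:
  assumes ab: "a < b" and D: "countable D" "D \<subseteq> {a<..<b}"
    and g: "integrable (lebesgue_on {a<..<b}) g" and j: "integrable (count_space D) j"
    and V: "open V" "V \<subseteq> {a<..<b}"
    and eq: "\<And>x. x \<in> {a<..<b} - D \<Longrightarrow>
      u x = u\<^sub>0 + primitive (lebesgue_on {a<..<b}) g x + primitive (count_space D) j x"
  shows "u \<in> SBV V"
proof -
  let ?L = "lebesgue_on {a<..<b}" and ?C = "count_space D"
  define F where "F x = u\<^sub>0 + primitive ?L g x + primitive ?C j x" for x
  interpret L: finite_measure ?L by (rule finite_measure_lebesgue_on_Ioo)
  have idC: "(\<lambda>t. t) \<in> borel_measurable ?C" by simp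
  have sfC: "sigma_finite_measure ?C" using D(1) by (rule sigma_finite_measure_count_space_countable)
  have P_meas[measurable]: "primitive ?L g \<in> borel_measurable borel" "primitive ?C j \<in> borel_measurable borel"
    by (rule borel_measurable_primitive[OF L.sigma_finite_measure_axioms g measurable_ident_lebesgue_on])
       (rule borel_measurable_primitive[OF sfC j idC])
  have F_meas: "F \<in> borel_measurable borel" unfolding F_def by measurable
  have V_bor: "V \<in> sets borel" "V \<in> sets lebesgue" using V by auto
  have V_lm: "V \<in> lmeasurable"
    by (rule bounded_set_imp_lmeasurable) (use V_bor bounded_subset[OF compact_imp_bounded[OF compact_Icc[of a b]], of V] V in force)+
  interpret LV: finite_measure "lebesgue_on V" by (rule finite_measure_lebesgue_on[OF V_lm])
  have negD: "negligible D" using D(1) by (rule negligible_of_countable)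
  have pt: "{x} \<in> sets (lebesgue_on V)" "emeasure (lebesgue_on V) {x} = 0" if "x \<in> V" for x
    using that V_bor by (auto simp: sets_restrict_space_iff emeasure_restrict_space)
  have borel_V: "h \<in> borel_measurable (lebesgue_on S)" if "h \<in> borel_measurable borel" for h :: "real \<Rightarrow> real" and S
    by (intro measurable_restrict_space1 measurable_completion) (use that in simp)
  have F_int_V: "integrable (lebesgue_on V) F"
  proof (rule LV.integrable_const_bound)
    show "AE x in lebesgue_on V. norm (F x) \<le> \<bar>u\<^sub>0\<bar> + (LINT t|?L. \<bar>g t\<bar>) + (LINT t|?C. \<bar>j t\<bar>)"
    proof (rule AE_I2)
      fix x
      show "norm (F x) \<le> \<bar>u\<^sub>0\<bar> + (LINT t|?L. \<bar>g t\<bar>) + (LINT t|?C. \<bar>j t\<bar>)"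
        using abs_primitive_le[OF g measurable_ident_lebesgue_on, of x] abs_primitive_le[OF j idC, of x]
        unfolding F_def real_norm_def by linarith
    qed
  qed (rule borel_V[OF F_meas])
  have uF: "F x = u x" if "x \<in> V" "x \<notin> D" for x
    using eq[of x] that V by (auto simp: F_def)
  have DV: "countable (D \<inter> V)" using D(1) by (rule countable_Int1)
  have u_int: "integrable (lebesgue_on V) u"
  proof (rule integrable_discrete_difference_aux[OF F_int_V DV])
    show "emeasure (lebesgue_on V) {x} = 0" "{x} \<in> sets (lebesgue_on V)" if "x \<in> D \<inter> V" for x
      using pt[of x] that by simp_all
    show "F x = u x" if "x \<in> space (lebesgue_on V)" "x \<notin> D \<inter> V" for x
      using uF[of x] that by (simp add: space_restrict_space)
  qed
  have uF_integral: "(LINT x|lebesgue_on V. u x * h x) = (LINT x|lebesgue_on V. F x * h x)" for h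
  proof (rule integral_discrete_difference[OF DV])
    show "emeasure (lebesgue_on V) {x} = 0" "{x} \<in> sets (lebesgue_on V)" if "x \<in> D \<inter> V" for x
      using pt[of x] that by simp_all
    show "u x * h x = F x * h x" if "x \<in> space (lebesgue_on V)" "x \<notin> D \<inter> V" for x
      using uF[of x] that by (simp add: space_restrict_space)
  qed
  define J where "J = D \<inter> V"
  have J: "countable J" unfolding J_def using D(1) by blast
  have J_borel: "X \<in> sets borel" if "X \<subseteq> J" for X
    by (rule sets.countable[OF _ countable_subset[OF that J]]) auto
  have restrC: "restrict_space ?C V = count_space J"
    by (simp add: restrict_count_space J_def Int_commute)
  have jJ: "integrable (count_space J) j"
  proof -
    have "integrable ?C (\<lambda>x. indicator V x *\<^sub>R j x)"
      using integrable_mult_indicator_borel[OF j idC V_bor(1)] by (simp add: mult.commute)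
    then show ?thesis
      unfolding restrC[symmetric] by (subst integrable_restrict_space) simp_all
  qed
  \<comment> \<open>The positive and negative parts of \<open>j\<close> are the weights of the
    Jordan decomposition.\<close>
  define p where "p z = max 0 (j z)" for z
  define q where "q z = max 0 (- j z)" for z
  have pq: "integrable (count_space J) p" "integrable (count_space J) q"
    unfolding p_def q_def using jJ by (auto intro!: integrable_max)
  define \<sigma> where "\<sigma> = atoms J p"
  define \<tau> where "\<tau> = atoms J q"
  have fin: "finite_measure \<sigma>" "finite_measure \<tau>"
    unfolding \<sigma>_def \<tau>_def by (rule finite_measure_atoms; use pq in \<open>simp add: p_def q_def\<close>)+
  have sets_st: "sets \<sigma> = sets borel" "sets \<tau> = sets borel" by (simp_all add: \<sigma>_def \<tau>_def sets_atoms)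
  have off: "emeasure \<sigma> X = 0" "emeasure \<tau> X = 0" if "X \<in> sets borel" "X \<inter> J = {}" for X
    unfolding \<sigma>_def \<tau>_def using that by (auto intro!: emeasure_atoms_eq_0)
  have parts: "(LINT x|lebesgue_on V. u x * deriv \<psi> x)
      = - ((LINT x|lebesgue_on V. g x * \<psi> x) + (LINT x|\<sigma>. \<psi> x) - (LINT x|\<tau>. \<psi> x))"
    if psiV: "\<psi> \<in> C1c V" for \<psi>
  proof -
    have psi: "\<psi> \<in> C1c {a<..<b}" using psiV C1c_mono[OF V(2)] by blast
    obtain B where B: "\<And>x. \<bar>\<psi> x\<bar> \<le> B" using C1c_bounded[OF psi] by blast
    have psi_bor: "\<psi> \<in> borel_measurable borel" by (rule C1c_borel[OF psi])
    have d_int: "integrable ?L (deriv \<psi>)" by (rule LINT_Ioo_eq(2)[OF C1c_Ioo(2)[OF psi]])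
    have Pd_int: "integrable ?L (\<lambda>x. primitive M k x * deriv \<psi> x)"
      if "primitive M k \<in> borel_measurable borel" "integrable M k" "(\<lambda>t. t) \<in> borel_measurable M" for M k
    proof (rule Bochner_Integration.integrable_bound)
      show "integrable ?L (\<lambda>x. (LINT t|M. \<bar>k t\<bar>) * deriv \<psi> x)" using d_int by simp
      show "(\<lambda>x. primitive M k x * deriv \<psi> x) \<in> borel_measurable ?L"
        using borel_V[OF that(1)] borel_measurable_integrable[OF d_int] by (rule borel_measurable_times)
      show "AE x in ?L. norm (primitive M k x * deriv \<psi> x) \<le> norm ((LINT t|M. \<bar>k t\<bar>) * deriv \<psi> x)"
      proof (rule AE_I2)
        fix x
        have "\<bar>primitive M k x\<bar> \<le> \<bar>LINT t|M. \<bar>k t\<bar>\<bar>"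
          using abs_primitive_le[OF that(2,3), of x] by linarith
        then show "norm (primitive M k x * deriv \<psi> x) \<le> norm ((LINT t|M. \<bar>k t\<bar>) * deriv \<psi> x)"
          unfolding real_norm_def abs_mult by (rule mult_right_mono) simp
      qed
    qed
    have "(LINT x|lebesgue_on V. u x * deriv \<psi> x) = (LINT x|lebesgue_on V. F x * deriv \<psi> x)"
      by (rule uF_integral)
    also have "\<dots> = (LINT x|?L. F x * deriv \<psi> x)"
      by (rule integral_lebesgue_on_support) (use V V_bor C1c_outside(2)[OF psiV] in auto)
    also have "\<dots> = (LINT x|?L. u\<^sub>0 * deriv \<psi> x + primitive ?L g x * deriv \<psi> x + primitive ?C j x * deriv \<psi> x)"
      by (rule Bochner_Integration.integral_cong) (auto simp: F_def algebra_simps)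
    also have "\<dots> = u\<^sub>0 * (LINT x|?L. deriv \<psi> x) + (LINT x|?L. primitive ?L g x * deriv \<psi> x)
        + (LINT x|?L. primitive ?C j x * deriv \<psi> x)"
      using d_int Pd_int[OF P_meas(1) g measurable_ident_lebesgue_on] Pd_int[OF P_meas(2) j idC] by simp
    also have "(LINT x|?L. deriv \<psi> x) = 0" by (rule integral_deriv_C1c[OF ab psi])
    also have "(LINT x|?L. primitive ?L g x * deriv \<psi> x) = - (LINT t|?L. g t * \<psi> t)"
      by (rule primitive_by_parts[OF L.sigma_finite_measure_axioms g measurable_ident_lebesgue_on _ psi]) simp
    also have "(LINT x|?L. primitive ?C j x * deriv \<psi> x) = - (LINT t|?C. j t * \<psi> t)"
      by (rule primitive_by_parts[OF sfC j idC _ psi]) (use D in simp)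
    also have "(LINT t|?L. g t * \<psi> t) = (LINT t|lebesgue_on V. g t * \<psi> t)"
      by (rule integral_lebesgue_on_support[symmetric]) (use V V_bor C1c_outside(1)[OF psiV] in auto)
    also have "(LINT t|?C. j t * \<psi> t) = (LINT t|count_space J. j t * \<psi> t)"
    proof -
      have "(LINT t|count_space J. j t * \<psi> t) = (LINT t|?C. indicator V t *\<^sub>R (j t * \<psi> t))"
        unfolding restrC[symmetric] by (rule integral_restrict_space) simp
      also have "\<dots> = (LINT t|?C. j t * \<psi> t)"
        by (rule Bochner_Integration.integral_cong) (auto simp: indicator_def C1c_outside(1)[OF psiV])
      finally show ?thesis by simp
    qed
    also have "(LINT t|count_space J. j t * \<psi> t) = (LINT x|\<sigma>. \<psi> x) - (LINT x|\<tau>. \<psi> x)"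
    proof -
      have bd: "integrable (count_space J) (\<lambda>t. k t * \<psi> t)" if k: "integrable (count_space J) k" for k
      proof (rule Bochner_Integration.integrable_bound)
        show "integrable (count_space J) (\<lambda>t. B * k t)" using k by simp
        show "AE t in count_space J. norm (k t * \<psi> t) \<le> norm (B * k t)"
        proof (rule AE_I2)
          fix t
          have "\<bar>\<psi> t\<bar> \<le> \<bar>B\<bar>" using B[of t] by linarith
          then have "\<bar>\<psi> t\<bar> * \<bar>k t\<bar> \<le> \<bar>B\<bar> * \<bar>k t\<bar>" by (rule mult_right_mono) simp
          then show "norm (k t * \<psi> t) \<le> norm (B * k t)"
            unfolding real_norm_def abs_mult by (simp only: mult.commute)
        qed
      qed simp
      have "(LINT t|count_space J. j t * \<psi> t) = (LINT t|count_space J. p t * \<psi> t - q t * \<psi> t)"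
        by (rule Bochner_Integration.integral_cong) (auto simp: p_def q_def max_def)
      also have "\<dots> = (LINT t|count_space J. p t * \<psi> t) - (LINT t|count_space J. q t * \<psi> t)"
        by (rule Bochner_Integration.integral_diff[OF bd[OF pq(1)] bd[OF pq(2)]])
      also have "\<dots> = (LINT x|\<sigma>. \<psi> x) - (LINT x|\<tau>. \<psi> x)"
        unfolding \<sigma>_def \<tau>_def using psi_bor by (subst (1 2) integral_atoms) (auto simp: p_def q_def)
      finally show ?thesis .
    qed
    finally show ?thesis by simp
  qed
  have discont: "z \<in> approx_discont_set V u" if z: "z \<in> J" and jz: "j z \<noteq> 0" for z
    unfolding approx_discont_set_def
  proof (intro CollectI conjI notI)
    show zV: "z \<in> V" using z by (simp add: J_def)
    assume "\<exists>L. has_approx_lim V u z L"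
    then obtain L where L: "has_approx_lim V u z L" by blast
    \<comment> \<open>The one-sided limits of \<open>F\<close> are \<open>4 * \<eta>\<close> apart,
      so one of them is at least \<open>2 * \<eta>\<close> away from \<open>L\<close>; the remaining
      \<eta> absorbs the distance of \<open>u y\<close> from that limit.\<close>
    define \<eta> where "\<eta> = \<bar>j z\<bar> / 4"
    have \<eta>: "\<eta> > 0" using jz by (simp add: \<eta>_def)
    have "isCont (primitive ?L g) z"
      by (rule isCont_primitive[OF g measurable_ident_lebesgue_on AE_lebesgue_on_neq])
    then have cont: "(primitive ?L g \<longlongrightarrow> primitive ?L g z) (at_left z)"
      "(primitive ?L g \<longlongrightarrow> primitive ?L g z) (at_right z)"
      by (simp_all add: isCont_def filterlim_at_split)
    have left: "(F \<longlongrightarrow> F z) (at_left z)"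
      unfolding F_def by (intro tendsto_intros cont primitive_tendsto_left[OF j idC])
    have right: "(F \<longlongrightarrow> F z + j z) (at_right z)"
    proof -
      have "(F \<longlongrightarrow> u\<^sub>0 + primitive ?L g z + (primitive ?C j z + j z)) (at_right z)"
        unfolding F_def
        by (intro tendsto_intros cont primitive_count_space_tendsto_right[OF j]) (use z in \<open>simp add: J_def\<close>)
      then show ?thesis by (simp add: F_def add.assoc)
    qed
    have "\<exists>r0>0. (\<forall>y. z - r0 < y \<longrightarrow> y < z \<longrightarrow> y \<in> V - D \<longrightarrow> \<bar>u y - L\<bar> > \<eta>) \<or>
      (\<forall>y. z < y \<longrightarrow> y < z + r0 \<longrightarrow> y \<in> V - D \<longrightarrow> \<bar>u y - L\<bar> > \<eta>)"
    proof (cases "\<bar>F z - L\<bar> \<ge> 2 * \<eta>")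
      case True
      obtain a' where a': "a' < z" "\<forall>y>a'. y < z \<longrightarrow> dist (F y) (F z) < \<eta>"
        using tendstoD[OF left \<eta>] unfolding eventually_at_left_field by blast
      have "\<bar>u y - L\<bar> > \<eta>" if "z - (z - a') < y" "y < z" "y \<in> V - D" for y
      proof -
        have "dist (F y) (F z) < \<eta>" using a'(2) that by simp
        moreover have "F y = u y" using uF that by simp
        ultimately show ?thesis using True unfolding dist_real_def by linarith
      qed
      then show ?thesis using a'(1) by (intro exI[of _ "z - a'"]) auto
    next
      case False
      obtain b' where b': "b' > z" "\<forall>y>z. y < b' \<longrightarrow> dist (F y) (F z + j z) < \<eta>"
        using tendstoD[OF right \<eta>] unfolding eventually_at_right_field by blast
      have "\<bar>u y - L\<bar> > \<eta>" if "z < y" "y < z + (b' - z)" "y \<in> V - D" for y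
      proof -
        have "dist (F y) (F z + j z) < \<eta>" using b'(2) that by simp
        moreover have "F y = u y" using uF that by simp
        moreover have "\<bar>j z\<bar> = 4 * \<eta>" by (simp add: \<eta>_def)
        ultimately show ?thesis using False unfolding dist_real_def by linarith
      qed
      then show ?thesis using b'(1) by (intro exI[of _ "b' - z"]) auto
    qed
    then obtain r0 where "r0 > 0" "(\<forall>y. z - r0 < y \<longrightarrow> y < z \<longrightarrow> y \<in> V - D \<longrightarrow> \<bar>u y - L\<bar> > \<eta>) \<or>
      (\<forall>y. z < y \<longrightarrow> y < z + r0 \<longrightarrow> y \<in> V - D \<longrightarrow> \<bar>u y - L\<bar> > \<eta>)" by blast
    then show False
      using not_has_approx_lim_of_one_sided[OF V(1) zV borel_measurable_integrable[OF u_int] negD \<eta>] L by blast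
  qed
  have ae: "AE x in \<sigma>. x \<in> approx_discont_set V u" "AE x in \<tau>. x \<in> approx_discont_set V u"
  proof -
    \<comment> \<open>\<open>J\<close> may contain points with \<open>j z = 0\<close>, where
      \<open>u\<close> can be approximately continuous; they carry no mass of \<sigma> or
      \<tau>.\<close>
    define Z where "Z = - {z \<in> J. j z \<noteq> 0}"
    have Z: "Z \<in> sets borel" unfolding Z_def using J_borel[of "{z \<in> J. j z \<noteq> 0}"] by (auto intro: borel_comp)
    have "emeasure \<sigma> Z = 0" "emeasure \<tau> Z = 0"
      unfolding \<sigma>_def \<tau>_def by (rule emeasure_atoms_eq_0[OF Z]; simp add: Z_def p_def q_def)+
    then have "Z \<in> null_sets \<sigma>" "Z \<in> null_sets \<tau>" using Z sets_st by auto
    moreover have "{x. x \<notin> approx_discont_set V u} \<subseteq> Z" using discont by (auto simp: Z_def)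
    ultimately show "AE x in \<sigma>. x \<in> approx_discont_set V u" "AE x in \<tau>. x \<in> approx_discont_set V u"
      by (auto intro!: AE_I'[of Z])
  qed
  have "BV_derivative V u g \<sigma> \<tau>"
    unfolding BV_derivative_def
  proof (intro conjI)
    have "integrable (lebesgue_on V) g"
    proof -
      have "integrable lebesgue (\<lambda>x. indicator V x *\<^sub>R (indicator {a<..<b} x * g x))"
        using g V_bor by (intro integrable_mult_indicator) (simp_all add: integrable_lebesgue_on_iff)
      also have "(\<lambda>x. indicator V x *\<^sub>R (indicator {a<..<b} x * g x)) = (\<lambda>x. indicator V x * g x)"
        using V(2) by (intro ext) (auto simp: indicator_def split: if_splits)
      finally show ?thesis using V_bor by (simp add: integrable_lebesgue_on_iff)
    qed
    then show "g \<in> L1 V" by (simp add: L1_def)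
    show "emeasure \<sigma> (- V) = 0" "emeasure \<tau> (- V) = 0"
      by (rule off; use V_bor in \<open>auto simp: J_def\<close>)+
    show "\<exists>N\<in>null_sets lborel. emeasure \<sigma> (- N) = 0 \<and> emeasure \<tau> (- N) = 0"
      using J J_borel[of J] by (intro bexI[of _ J]) (auto intro!: off countable_imp_null_set_lborel)
    show "\<exists>P\<in>sets borel. emeasure \<sigma> (- P) = 0 \<and> emeasure \<tau> P = 0"
    proof (intro bexI conjI)
      show P: "{z \<in> J. 0 < j z} \<in> sets borel" by (rule J_borel) auto
      show "emeasure \<sigma> (- {z \<in> J. 0 < j z}) = 0"
        unfolding \<sigma>_def using P by (intro emeasure_atoms_eq_0) (auto simp: p_def)
      show "emeasure \<tau> {z \<in> J. 0 < j z} = 0"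
        unfolding \<tau>_def using P by (intro emeasure_atoms_eq_0) (auto simp: q_def)
    qed
  qed (use fin sets_st parts in auto)
  then show ?thesis
    unfolding SBV_def L1_def using u_int ae by blast
qed

section \<open>Representatives of Sobolev functions\<close>

lemma integral_supported_Icc:
  fixes \<rho> :: "real \<Rightarrow> real"
  assumes cont: "continuous_on UNIV \<rho>" and supp: "\<And>x. x \<notin> {p..q} \<Longrightarrow> \<rho> x = 0" and sub: "{p..q} \<subseteq> {c..d}"
  shows "integral {c..d} \<rho> = integral {p..q} \<rho>"
proof -
  have "\<rho> integrable_on {p..q}"
    using cont by (intro integrable_continuous_real) (auto intro: continuous_on_subset)
  then have "(\<rho> has_integral integral {p..q} \<rho>) {p..q}" by (rule integrable_integral)
  then have "(\<rho> has_integral integral {p..q} \<rho>) {c..d}"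
    by (rule has_integral_on_superset) (use supp sub in auto)
  then show ?thesis by (rule integral_unique)
qed

text \<open>The mean value zero makes the antiderivative vanish again to the right of
  \<open>q\<close>, so that it is a test function.\<close>

lemma zero_mean_has_C1c_antiderivative:
  fixes \<rho> :: "real \<Rightarrow> real"
  assumes pq: "a < p" "p \<le> q" "q < b" and cont: "continuous_on UNIV \<rho>"
    and supp: "\<And>x. x \<notin> {p..q} \<Longrightarrow> \<rho> x = 0" and zero: "integral {p..q} \<rho> = 0"
  obtains \<psi> where "\<psi> \<in> C1c {a<..<b}" "deriv \<psi> = \<rho>"
proof -
  \<comment> \<open>Starting at \<open>a - 1\<close> makes every \<open>x \<ge> p\<close> an
    interior point of the interval on which the fundamental theorem is applied.\<close>
  define \<psi> where "\<psi> x = integral {a - 1..x} \<rho>" for x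
  have low: "\<psi> x = 0" if "x < p" for x
  proof -
    have "integral {a - 1..x} \<rho> = integral {a - 1..x} (\<lambda>_. 0)"
      by (rule integral_cong) (use that supp in auto)
    then show ?thesis by (simp add: \<psi>_def)
  qed
  have high: "\<psi> x = 0" if "q < x" for x
    unfolding \<psi>_def using integral_supported_Icc[OF cont supp, of p q "a - 1" x] pq that zero by auto
  have der: "(\<psi> has_real_derivative \<rho> x) (at x)" for x
  proof (cases "x < p")
    case True
    have "(\<psi> has_real_derivative 0) (at x)"
    proof (rule has_field_derivative_transform_within_open[of "\<lambda>_. 0" 0 x "{..<p}"])
      show "0 = \<psi> y" if "y \<in> {..<p}" for y using low[of y] that by simp
    qed (use True in auto)
    then show ?thesis using True supp[of x] by simp
  next
    case False
    have "((\<lambda>u. integral {a - 1..u} \<rho>) has_vector_derivative \<rho> x) (at x within {a - 1..x + 1})"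
      by (rule integral_has_vector_derivative)
         (use cont False pq in \<open>auto intro: continuous_on_subset\<close>)
    moreover have "at x within {a - 1..x + 1} = at x"
      by (rule at_within_interior) (use False pq in auto)
    ultimately show ?thesis
      by (simp add: has_real_derivative_iff_has_vector_derivative \<psi>_def[abs_def])
  qed
  have sub: "closure {x. \<psi> x \<noteq> 0} \<subseteq> {p..q}"
    by (rule closure_minimal) (use low high in \<open>force+\<close>)
  have "compact (closure {x. \<psi> x \<noteq> 0})"
    using sub by (meson bounded_closed_interval bounded_subset closed_closure compact_eq_bounded_closed)
  moreover have "closure {x. \<psi> x \<noteq> 0} \<subseteq> {a<..<b}" using sub pq by fastforce
  moreover have "\<psi> C1_differentiable_on UNIV"
    unfolding C1_differentiable_on_def
    using der cont by (intro exI[of _ \<rho>]) (simp add: has_real_derivative_iff_has_vector_derivative)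
  ultimately have "\<psi> \<in> C1c {a<..<b}" by (simp add: C1c_def)
  moreover have "deriv \<psi> = \<rho>" using der by (auto intro!: DERIV_imp_deriv)
  ultimately show ?thesis by (rule that)
qed

lemma integrable_mult_continuous:
  assumes w: "integrable (lebesgue_on {a<..<b}) w" and h: "continuous_on UNIV (h :: real \<Rightarrow> real)"
  shows "integrable (lebesgue_on {a<..<b}) (\<lambda>x. w x * h x)"
proof -
  have "bounded (h ` {a..b})"
    using h by (intro compact_imp_bounded compact_continuous_image) (auto intro: continuous_on_subset)
  then obtain B where B: "\<forall>x\<in>{a..b}. \<bar>h x\<bar> \<le> B" unfolding bounded_iff by auto
  show ?thesis
  proof (rule Bochner_Integration.integrable_bound)
    show "integrable (lebesgue_on {a<..<b}) (\<lambda>x. B * w x)" using w by simp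
    have "h \<in> borel_measurable (lebesgue_on {a<..<b})"
      using LINT_Ioo_eq(2)[OF h] by (rule borel_measurable_integrable)
    with borel_measurable_integrable[OF w]
    show "(\<lambda>x. w x * h x) \<in> borel_measurable (lebesgue_on {a<..<b})" by (rule borel_measurable_times)
    show "AE x in lebesgue_on {a<..<b}. norm (w x * h x) \<le> norm (B * w x)"
    proof (rule AE_I2)
      fix x assume "x \<in> space (lebesgue_on {a<..<b})"
      then have "\<bar>h x\<bar> \<le> B" using B by auto
      then have "\<bar>h x\<bar> \<le> \<bar>B\<bar>" by linarith
      then have "\<bar>h x\<bar> * \<bar>w x\<bar> \<le> \<bar>B\<bar> * \<bar>w x\<bar>" by (rule mult_right_mono) simp
      then show "norm (w x * h x) \<le> norm (B * w x)"
        unfolding real_norm_def abs_mult by (simp only: mult.commute)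
    qed
  qed
qed

text \<open>Derivatives of test functions in \<open>C1c\<close> only have to be continuous, so
  differences of trapezoids with mean zero are admissible. Hence \<open>w\<close> integrates against
  every trapezoid as a constant \<open>k\<close> does. In the limit its integral over every interval
  is \<open>k\<close> times the length, and differentiation of the primitive gives
  \<open>w = k\<close>.\<close>

lemma du_Bois_Reymond:
  assumes ab: "a < b" and w: "integrable (lebesgue_on {a<..<b}) w"
    and test: "\<And>\<psi>. \<psi> \<in> C1c {a<..<b} \<Longrightarrow> (LINT x|lebesgue_on {a<..<b}. w x * deriv \<psi> x) = 0"
  obtains k where "AE x in lebesgue_on {a<..<b}. w x = k"
proof -
  let ?L = "lebesgue_on {a<..<b}"
  \<comment> \<open>A trapezoid of height at most 1 on \<open>{p..q}\<close> with sides of slope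
    \<open>n\<close>; it tends to the indicator of \<open>{p<..<q}\<close> pointwise.\<close>
  define T where "T p q n x = max 0 (min 1 (min (n * (x - p)) (n * (q - x))))" for p q n x :: real
  have T_cont: "continuous_on UNIV (T p q n)" for p q n
    unfolding T_def by (intro continuous_intros)
  have T_supp: "T p q n x = 0" if "x \<notin> {p..q}" "n \<ge> 0" for p q n x
  proof -
    have "n * (x - p) \<le> 0 \<or> n * (q - x) \<le> 0"
      using that by (auto simp: mult_nonneg_nonpos not_le)
    then show ?thesis unfolding T_def by auto
  qed
  have T_bound: "\<bar>T p q n x\<bar> \<le> 1" for p q n x unfolding T_def by auto
  have T_int: "integrable ?L (T p q n)" for p q n by (rule LINT_Ioo_eq(2)[OF T_cont])
  have wT_int: "integrable ?L (\<lambda>x. w x * T p q n x)" for p q n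
    by (rule integrable_mult_continuous[OF w T_cont])
  have T_lim: "(\<lambda>n. T p q (real n) x) \<longlonglongrightarrow> indicator {p<..<q} x" for p q x
  proof (cases "x \<in> {p<..<q}")
    case True
    define r where "r = min (x - p) (q - x)"
    have r: "r > 0" using True by (simp add: r_def)
    obtain N :: nat where N: "1 / r < real N" using reals_Archimedean2 by blast
    have "T p q (real n) x = 1" if n: "n \<ge> N" for n
    proof -
      have "1 < real N * r" using N r by (simp add: pos_divide_less_eq)
      also have "\<dots> \<le> real n * r" using n r by (intro mult_right_mono) auto
      finally have 1: "1 \<le> real n * r" by simp
      have "real n * r \<le> real n * (x - p)" "real n * r \<le> real n * (q - x)"
        by (rule mult_left_mono; simp add: r_def)+
      with 1 show ?thesis unfolding T_def by auto
    qed
    then have "\<forall>\<^sub>F n in sequentially. T p q (real n) x = indicator {p<..<q} x"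
      using True by (auto simp: eventually_sequentially)
    then show ?thesis by (rule tendsto_eventually)
  next
    case False
    have "T p q (real n) x = 0" for n
    proof -
      have "real n * (x - p) \<le> 0 \<or> real n * (q - x) \<le> 0"
        using False by (auto simp: mult_nonneg_nonpos not_less)
      then show ?thesis unfolding T_def by auto
    qed
    then show ?thesis using False by simp
  qed
  have T_lim_int: "(\<lambda>n. LINT x|?L. T p q (real n) x) \<longlonglongrightarrow> q - p" if "a < p" "p < q" "q < b" for p q
  proof -
    have "(\<lambda>n. LINT x|?L. T p q (real n) x) \<longlonglongrightarrow> (LINT x|?L. indicator {p<..<q} x)"
    proof (rule integral_dominated_convergence[where w="\<lambda>_. 1"])
      show "integrable ?L (\<lambda>_. 1)"
        using finite_measure_lebesgue_on_Ioo by (rule finite_measure.integrable_const)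
      show "(\<lambda>x. indicator {p<..<q} x :: real) \<in> borel_measurable ?L"
        by (rule measurable_compose[OF measurable_ident_lebesgue_on]) simp
    qed (use T_lim T_bound T_int in \<open>auto intro: borel_measurable_integrable\<close>)
    also have "(LINT x|?L. indicator {p<..<q} x) = q - p"
    proof -
      have "(LINT x|?L. indicator {p<..<q} x) = (LINT x|lebesgue. indicator {a<..<b} x * indicator {p<..<q} x :: real)"
        by (rule integral_lebesgue_on_eq) simp
      also have "\<dots> = (LINT x|lebesgue. indicator {p<..<q} x)"
        using that by (intro Bochner_Integration.integral_cong) (auto simp: indicator_def)
      also have "\<dots> = q - p" using that by simp
      finally show ?thesis .
    qed
    finally show ?thesis .
  qed
  have wT_lim_int: "(\<lambda>n. LINT x|?L. w x * T p q (real n) x) \<longlonglongrightarrow> (LINT x|?L. w x * indicator {p<..<q} x)" for p q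
  proof (rule integral_dominated_convergence[where w="\<lambda>x. \<bar>w x\<bar>"])
    show "AE x in ?L. (\<lambda>n. w x * T p q (real n) x) \<longlonglongrightarrow> w x * indicator {p<..<q} x"
      by (intro AE_I2 tendsto_intros T_lim)
    show "AE x in ?L. norm (w x * T p q (real n) x) \<le> \<bar>w x\<bar>" for n
      using T_bound by (intro AE_I2) (simp add: abs_mult mult_left_le)
    show "(\<lambda>x. w x * indicator {p<..<q} x) \<in> borel_measurable ?L"
      by (rule borel_measurable_integrable, rule integrable_mult_indicator_borel[OF w measurable_ident_lebesgue_on]) simp
  qed (use w wT_int in \<open>auto intro: borel_measurable_integrable\<close>)
  \<comment> \<open>A fixed reference trapezoid on the middle third; \<open>n0\<close> is chosen to
    give it a positive integral, by which \<open>k\<close> is normalised.\<close>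
  define p0 where "p0 = (2 * a + b) / 3"
  define q0 where "q0 = (a + 2 * b) / 3"
  have pq0: "a < p0" "p0 < q0" "q0 < b" using ab by (auto simp: p0_def q0_def)
  obtain n0 :: nat where n0: "(LINT x|?L. T p0 q0 (real n0) x) > 0"
  proof -
    have "\<forall>\<^sub>F n in sequentially. 0 < (LINT x|?L. T p0 q0 (real n) x)"
      by (rule order_tendstoD(1)[OF T_lim_int[OF pq0]]) (use pq0 in simp)
    then show ?thesis using that by (auto simp: eventually_sequentially)
  qed
  define I0 where "I0 = (LINT x|?L. T p0 q0 (real n0) x)"
  define k where "k = (LINT x|?L. w x * T p0 q0 (real n0) x) / I0"
  have I0: "I0 > 0" using n0 by (simp add: I0_def)
  have eq_n: "(LINT x|?L. w x * T p q (real n) x) = k * (LINT x|?L. T p q (real n) x)"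
    if pq: "a < p" "p < q" "q < b" for p q n
  proof -
    define J where "J = (LINT x|?L. T p q (real n) x)"
    \<comment> \<open>The multiple of the reference trapezoid is chosen so that \<rho> has mean
      value zero.\<close>
    define \<rho> where "\<rho> x = T p q (real n) x - J / I0 * T p0 q0 (real n0) x" for x
    have \<rho>_cont: "continuous_on UNIV \<rho>" unfolding \<rho>_def by (intro continuous_intros T_cont)
    have \<rho>_supp: "\<rho> x = 0" if "x \<notin> {min p p0..max q q0}" for x
    proof -
      have "x \<notin> {p..q}" "x \<notin> {p0..q0}" using that by auto
      then have "T p q (real n) x = 0" "T p0 q0 (real n0) x = 0" by (auto intro: T_supp)
      then show ?thesis by (simp add: \<rho>_def)
    qed
    have "(LINT x|?L. \<rho> x) = 0"
      unfolding \<rho>_def using T_int I0 by (simp add: J_def I0_def)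
    then have "integral {a..b} \<rho> = 0" using LINT_Ioo_eq(1)[OF \<rho>_cont] by simp
    moreover have "integral {a..b} \<rho> = integral {min p p0..max q q0} \<rho>"
      by (rule integral_supported_Icc[OF \<rho>_cont \<rho>_supp]) (use pq pq0 in auto)
    ultimately have "integral {min p p0..max q q0} \<rho> = 0" by simp
    moreover have "a < min p p0" "min p p0 \<le> max q q0" "max q q0 < b" using pq pq0 by auto
    ultimately obtain \<psi> where \<psi>: "\<psi> \<in> C1c {a<..<b}" "deriv \<psi> = \<rho>"
      using zero_mean_has_C1c_antiderivative[OF _ _ _ \<rho>_cont \<rho>_supp] by blast
    have "0 = (LINT x|?L. w x * \<rho> x)" using test[OF \<psi>(1)] \<psi>(2) by simp
    also have "\<dots> = (LINT x|?L. w x * T p q (real n) x - J / I0 * (w x * T p0 q0 (real n0) x))"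
      by (rule Bochner_Integration.integral_cong) (auto simp: \<rho>_def algebra_simps)
    also have "\<dots> = (LINT x|?L. w x * T p q (real n) x) - J / I0 * (LINT x|?L. w x * T p0 q0 (real n0) x)"
      using wT_int by simp
    finally show ?thesis using I0 by (simp add: k_def J_def)
  qed
  have W: "(LINT x|?L. w x * indicator {p<..<q} x) = k * (q - p)" if pq: "a < p" "p < q" "q < b" for p q
  proof (rule LIMSEQ_unique[OF wT_lim_int])
    show "(\<lambda>n. LINT x|?L. w x * T p q (real n) x) \<longlonglongrightarrow> k * (q - p)"
      unfolding eq_n[OF pq] by (intro tendsto_intros T_lim_int pq)
  qed
  have P: "primitive ?L w q - primitive ?L w p = k * (q - p)" if pq: "a < p" "p < q" "q < b" for p q
  proof -
    have "primitive ?L w q - primitive ?L w p = (LINT x|?L. w x * indicator {p..<q} x)"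
      by (rule primitive_diff[OF w measurable_ident_lebesgue_on]) (use pq in simp)
    also have "\<dots> = (LINT x|?L. w x * indicator {p<..<q} x)"
    proof (rule integral_cong_AE)
      show "AE x in ?L. w x * indicator {p..<q} x = w x * indicator {p<..<q} x"
        using AE_lebesgue_on_neq[of p a b] by eventually_elim (auto simp: indicator_def)
    qed (rule borel_measurable_integrable, rule integrable_mult_indicator_borel[OF w measurable_ident_lebesgue_on], simp)+
    also have "\<dots> = k * (q - p)" by (rule W[OF pq])
    finally show ?thesis .
  qed
  obtain N where N: "negligible N"
    "\<And>x. x \<in> {a<..<b} - N \<Longrightarrow> (primitive ?L w has_real_derivative w x) (at x)"
    using primitive_deriv_AE[OF w] by blast
  have wk: "w x = k" if x: "x \<in> {a<..<b} - N" for x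
  proof -
    \<comment> \<open>\<open>P\<close> compares two interior points of the interval, so a base point
      \<open>c\<close> to the left of \<open>x\<close> is fixed and the primitive is affine on
      \<open>{c<..<b}\<close>.\<close>
    define c where "c = (a + x) / 2"
    have c: "a < c" "c < x" using x by (auto simp: c_def)
    have "((\<lambda>y. primitive ?L w c + k * (y - c)) has_real_derivative k) (at x)"
      by (auto intro!: derivative_eq_intros)
    then have "(primitive ?L w has_real_derivative k) (at x)"
    proof (rule has_field_derivative_transform_within_open[where S="{c<..<b}"])
      show "primitive ?L w c + k * (y - c) = primitive ?L w y" if "y \<in> {c<..<b}" for y
        using P[of c y] c that by simp
    qed (use x c in auto)
    then show ?thesis using N(2)[OF x] DERIV_unique by blast
  qed
  have "AE x in ?L. w x = k"
  proof -
    have "AE x in lebesgue. x \<notin> N" using N(1) by (simp add: AE_not_in negligible_iff_null_sets)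
    then have "AE x in lebesgue. x \<in> {a<..<b} \<longrightarrow> w x = k"
      by eventually_elim (use wk in auto)
    then show ?thesis by (subst AE_restrict_space_iff) auto
  qed
  then show ?thesis by (rule that)
qed

text \<open>By \<open>primitive_by_parts\<close> the difference of \<open>u\<close> and the
  primitive of \<open>g\<close> has weak derivative 0, so \<open>du_Bois_Reymond\<close> makes it
  constant.\<close>

lemma weak_deriv_primitive:
  assumes ab: "a < b" and u: "u \<in> L2 {a<..<b}" and g: "g \<in> L2 {a<..<b}" and wd: "is_weak_deriv {a<..<b} u g"
  obtains k where "AE x in lebesgue_on {a<..<b}. u x = k + primitive (lebesgue_on {a<..<b}) g x"
proof -
  let ?L = "lebesgue_on {a<..<b}"
  interpret finite_measure ?L by (rule finite_measure_lebesgue_on_Ioo)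
  have ui: "integrable ?L u" and gi: "integrable ?L g" using u g by (auto intro: L2_imp_integrable)
  have "primitive ?L g \<in> borel_measurable ?L"
    by (intro measurable_restrict_space1 measurable_completion, simp)
       (rule borel_measurable_primitive[OF sigma_finite_measure_axioms gi measurable_ident_lebesgue_on])
  then have Pi: "integrable ?L (primitive ?L g)"
    by (rule integrable_const_bound[rotated])
       (use abs_primitive_le[OF gi measurable_ident_lebesgue_on] in \<open>auto intro: AE_I2\<close>)
  obtain k where "AE x in ?L. u x - primitive ?L g x = k"
  proof (rule du_Bois_Reymond[OF ab])
    show "integrable ?L (\<lambda>x. u x - primitive ?L g x)" using ui Pi by simp
    fix \<psi> assume psi: "\<psi> \<in> C1c {a<..<b}"
    have "(LINT x|?L. (u x - primitive ?L g x) * deriv \<psi> x)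
        = (LINT x|?L. u x * deriv \<psi> x) - (LINT x|?L. primitive ?L g x * deriv \<psi> x)"
      unfolding left_diff_distrib
      by (intro Bochner_Integration.integral_diff integrable_mult_continuous ui Pi C1c_Ioo(2)[OF psi])
    also have "(LINT x|?L. u x * deriv \<psi> x) = - (LINT x|?L. g x * \<psi> x)"
      using wd psi by (auto simp: is_weak_deriv_def)
    also have "(LINT x|?L. primitive ?L g x * deriv \<psi> x) = - (LINT x|?L. g x * \<psi> x)"
      by (rule primitive_by_parts[OF sigma_finite_measure_axioms gi measurable_ident_lebesgue_on _ psi]) simp
    finally show "(LINT x|?L. (u x - primitive ?L g x) * deriv \<psi> x) = 0" by simp
  qed
  then have "AE x in ?L. u x = k + primitive ?L g x" by eventually_elim simp
  then show ?thesis by (rule that)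
qed

section \<open>Compactness\<close>

lemma diagonal_subsequence_convergent:
  fixes f :: "nat \<Rightarrow> 'a \<Rightarrow> real"
  assumes Q: "countable Q" and bdd: "\<And>q. q \<in> Q \<Longrightarrow> bounded (range (\<lambda>k. f k q))"
  obtains s :: "nat \<Rightarrow> nat" where "strict_mono s" "\<And>q. q \<in> Q \<Longrightarrow> convergent (\<lambda>k. f (s k) q)"
proof (cases "Q = {}")
  case True
  then show ?thesis by (intro that[of id]) (auto simp: strict_mono_def)
next
  case False
  define t where "t = from_nat_into Q"
  have t: "t n \<in> Q" for n unfolding t_def using False by (rule from_nat_into)
  interpret subseqs "\<lambda>n s. convergent (\<lambda>k. f (s k) (t n))"
  proof
    fix n :: nat and s :: "nat \<Rightarrow> nat"
    have "bounded (range (\<lambda>k. f (s k) (t n)))"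
      by (rule bounded_subset[OF bdd[OF t[of n]]]) auto
    then obtain l r where "strict_mono (r :: nat \<Rightarrow> nat)" "((\<lambda>k. f (s k) (t n)) \<circ> r) \<longlonglongrightarrow> l"
      using bounded_imp_convergent_subsequence by blast
    then show "\<exists>r'. strict_mono r' \<and> convergent (\<lambda>k. f ((s \<circ> r') k) (t n))"
      by (intro exI[of _ r]) (auto simp: convergent_def o_def)
  qed
  show ?thesis
  proof (rule that[OF subseq_diagseq])
    fix q assume "q \<in> Q"
    then obtain n where n: "t n = q" unfolding t_def using from_nat_into_surj[OF Q] by blast
    have "convergent (\<lambda>k. f ((diagseq \<circ> ((+) (Suc n))) k) (t n))"
    proof (rule diagseq_holds)
      fix r s :: "nat \<Rightarrow> nat" and m assume r: "strict_mono r" and "convergent (\<lambda>k. f (s k) (t m))"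
      then have "convergent ((\<lambda>k. f (s k) (t m)) \<circ> r)" by (intro convergent_subseq_convergent)
      then show "convergent (\<lambda>k. f ((s \<circ> r) k) (t m))" by (simp add: o_def)
    qed
    then have "convergent (\<lambda>k. f (diagseq (k + Suc n)) q)" by (simp add: n o_def add.commute)
    then show "convergent (\<lambda>k. f (diagseq k) q)" by (rule convergent_ignore_initial_segment[of "\<lambda>k. f (diagseq k) q" "Suc n", THEN iffD1])
  qed
qed

text \<open>\<open>q\<close> is the first point where \<open>v\<close> equals \<beta>, and
  \<open>p\<close> the last one before it where \<open>v\<close> equals \<alpha>. Leaving
  \<open>{\<alpha>..\<beta>}\<close> in between would produce an earlier \<open>q\<close> or a later
  \<open>p\<close> by the intermediate value theorem.\<close>

lemma crossing_interval_increasing: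
  fixes v :: "real \<Rightarrow> real"
  assumes xy: "x \<le> y" and cont: "continuous_on {x..y} v" and v: "v x < \<alpha>" "\<alpha> < \<beta>" "\<beta> < v y"
  obtains p q where "x \<le> p" "p < q" "q \<le> y" "v p = \<alpha>" "v q = \<beta>" "\<And>t. t \<in> {p..q} \<Longrightarrow> v t \<in> {\<alpha>..\<beta>}"
proof -
  define B where "B = {t \<in> {x..y}. v t = \<beta>}"
  have B: "compact B"
    unfolding B_def using continuous_closed_preimage_constant[OF cont] by (auto simp: compact_eq_bounded_closed intro: bounded_subset[OF compact_imp_bounded[OF compact_Icc]])
  have "B \<noteq> {}" using IVT'[of v x \<beta> y] v xy cont unfolding B_def by force
  then obtain q where q: "q \<in> B" "\<And>t. t \<in> B \<Longrightarrow> q \<le> t" using compact_attains_inf[OF B] by blast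
  have q_xy: "x \<le> q" "q \<le> y" "v q = \<beta>" using q(1) by (auto simp: B_def)
  have cont_q: "continuous_on {x..q} v" by (rule continuous_on_subset[OF cont]) (use q_xy in auto)
  define A where "A = {t \<in> {x..q}. v t = \<alpha>}"
  have A: "compact A"
    unfolding A_def using continuous_closed_preimage_constant[OF cont_q] by (auto simp: compact_eq_bounded_closed intro: bounded_subset[OF compact_imp_bounded[OF compact_Icc]])
  have "A \<noteq> {}" using IVT'[of v x \<alpha> q] v q_xy cont_q unfolding A_def by force
  then obtain p where p: "p \<in> A" "\<And>t. t \<in> A \<Longrightarrow> t \<le> p" using compact_attains_sup[OF A] by blast
  have p_xq: "x \<le> p" "p \<le> q" "v p = \<alpha>" using p(1) by (auto simp: A_def)
  have "p \<noteq> q" using p_xq q_xy v by auto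
  have "v t \<in> {\<alpha>..\<beta>}" if t: "t \<in> {p..q}" for t
  proof -
    have "v t \<le> \<beta>"
    proof (rule ccontr)
      assume c: "\<not> v t \<le> \<beta>"
      have "continuous_on {x..t} v" by (rule continuous_on_subset[OF cont]) (use q_xy t in auto)
      then obtain s where "x \<le> s" "s \<le> t" "v s = \<beta>"
        using IVT'[of v x \<beta> t] c v t p_xq by auto
      then have "q \<le> s" using q(2)[of s] t q_xy by (auto simp: B_def)
      then have "t = q" using \<open>s \<le> t\<close> t by auto
      then show False using c q_xy by simp
    qed
    moreover have "\<alpha> \<le> v t"
    proof (rule ccontr)
      assume c: "\<not> \<alpha> \<le> v t"
      have "continuous_on {t..q} v" by (rule continuous_on_subset[OF cont]) (use q_xy t p_xq in auto)
      then obtain s where "t \<le> s" "s \<le> q" "v s = \<alpha>"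
        using IVT'[of v t \<alpha> q] c v t q_xy by auto
      then have "s \<le> p" using p(2)[of s] t p_xq by (auto simp: A_def)
      then have "t = p" using \<open>t \<le> s\<close> t by auto
      then show False using c p_xq by simp
    qed
    ultimately show ?thesis by simp
  qed
  with p_xq q_xy \<open>p \<noteq> q\<close> show ?thesis by (intro that[of p q]) auto
qed

lemma crossing_interval:
  fixes v :: "real \<Rightarrow> real"
  assumes cont: "continuous_on {c..d} v" and xy: "x \<in> {c..d}" "y \<in> {c..d}" and v: "v x < \<alpha>" "\<alpha> < \<beta>" "\<beta> < v y"
  obtains p q where "c \<le> p" "p < q" "q \<le> d" "\<bar>v q - v p\<bar> = \<beta> - \<alpha>" "\<And>t. t \<in> {p..q} \<Longrightarrow> v t \<in> {\<alpha>..\<beta>}"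
proof (cases "x \<le> y")
  case True
  have "continuous_on {x..y} v" by (rule continuous_on_subset[OF cont]) (use xy in auto)
  from crossing_interval_increasing[OF True this v] obtain p q where
    "x \<le> p" "p < q" "q \<le> y" "v p = \<alpha>" "v q = \<beta>" "\<And>t. t \<in> {p..q} \<Longrightarrow> v t \<in> {\<alpha>..\<beta>}" by blast
  then show ?thesis using v xy by (intro that[of p q]) auto
next
  case False
  \<comment> \<open>Reflection reduces a decreasing crossing to the increasing one.\<close>
  have "continuous_on {- x..- y} (\<lambda>t. v (- t))"
    by (rule continuous_on_compose2[OF cont]) (use xy in \<open>auto intro!: continuous_intros\<close>)
  moreover have "- x \<le> - y" using False by simp
  ultimately obtain p q where
    pq: "- x \<le> p" "p < q" "q \<le> - y" "v (- p) = \<alpha>" "v (- q) = \<beta>" "\<And>t. t \<in> {p..q} \<Longrightarrow> v (- t) \<in> {\<alpha>..\<beta>}"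
    using crossing_interval_increasing[of "- x" "- y" "\<lambda>t. v (- t)" \<alpha> \<beta>] v by auto
  have "v t \<in> {\<alpha>..\<beta>}" if "t \<in> {- q..- p}" for t using pq(6)[of "- t"] that by auto
  then show ?thesis using pq v xy by (intro that[of "- q" "- p"]) auto
qed

text \<open>The minimum over \<open>l\<close> of the given bounds is the root, attained at
  \<open>sqrt (I / d)\<close>. For \<open>I = 0\<close> there is no minimiser, and \<open>l\<close>
  tends to 0 instead.\<close>

lemma sqrt_bound_of_AM_GM:
  fixes J d I :: real
  assumes d: "d > 0" and I: "I \<ge> 0" and bd: "\<And>l. l > 0 \<Longrightarrow> J \<le> (l * d + I / l) / 2"
  shows "J \<le> sqrt (d * I)"
proof (cases "I = 0")
  case True
  have "J \<le> 0"
  proof (rule field_le_epsilon)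
    fix e :: real assume "e > 0"
    then show "J \<le> 0 + e" using bd[of "2 * e / d"] d True by simp
  qed
  then show ?thesis using True by simp
next
  case False
  define l where "l = sqrt I / sqrt d"
  have l: "l > 0" using False I d by (simp add: l_def)
  have "l * d = sqrt d * sqrt I" using d by (simp add: l_def real_div_sqrt field_simps)
  moreover have "I / l = sqrt d * sqrt I"
    using d I False by (simp add: l_def field_simps)
  ultimately show ?thesis using bd[OF l] by (simp add: real_sqrt_mult mult.commute)
qed

lemma finite_measure_interval_measure:
  assumes "mono F" "\<And>x. continuous (at_right x) F" "\<And>x. \<bar>F x\<bar> \<le> M"
  shows "finite_measure (interval_measure F)"
proof (rule finite_measureI)
  let ?A = "\<lambda>n::nat. {- real n<..real n}"
  have bd: "emeasure (interval_measure F) (?A n) \<le> ennreal (2 * M)" for n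
  proof -
    have "emeasure (interval_measure F) (?A n) = F (real n) - F (- real n)"
      by (rule emeasure_interval_measure_Ioc) (use assms in \<open>auto simp: mono_def\<close>)
    also have "\<dots> \<le> ennreal (2 * M)"
      using assms(3)[of "real n"] assms(3)[of "- real n"] by (intro ennreal_leI) linarith
    finally show ?thesis .
  qed
  have sup: "(SUP n. emeasure (interval_measure F) (?A n)) = emeasure (interval_measure F) (\<Union>n. ?A n)"
    by (rule SUP_emeasure_incseq) (auto simp: incseq_def)
  have un: "(\<Union>n. ?A n) = UNIV"
  proof -
    have "x \<in> (\<Union>n. ?A n)" for x
    proof -
      obtain n :: nat where "\<bar>x\<bar> < real n" using reals_Archimedean2 by blast
      then have "x \<in> ?A n" by auto
      then show ?thesis by blast
    qed
    then show ?thesis by blast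
  qed
  have "emeasure (interval_measure F) UNIV \<le> ennreal (2 * M)"
    unfolding un[symmetric] sup[symmetric] using bd by (rule SUP_least)
  then show "emeasure (interval_measure F) (space (interval_measure F)) \<noteq> \<infinity>"
    by (auto simp: top_unique)
qed

text \<open>\<open>gu\<close> and \<open>gv\<close> are the derivatives of the continuous representatives \<open>U\<close> and \<open>V\<close>, \<open>e\<close> is the energy
  density, and \<open>F\<close> is a Helly limit of its primitives.\<close>

locale phase_field_sequence =
  fixes a b c\<^sub>0 C M :: real and U V gu gv e :: "nat \<Rightarrow> real \<Rightarrow> real" and eps :: "nat \<Rightarrow> real" and F :: "real \<Rightarrow> real"
  assumes ab: "a < b" and c0: "0 < c\<^sub>0" and C: "0 \<le> C"
    and gu_int: "\<And>k. integrable (lebesgue_on {a<..<b}) (gu k)"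
    and gv_int: "\<And>k. integrable (lebesgue_on {a<..<b}) (gv k)"
    and e_int: "\<And>k. integrable (lebesgue_on {a<..<b}) (e k)"
    and e_nonneg: "\<And>k x. x \<in> {a<..<b} \<Longrightarrow> 0 \<le> e k x"
    and e_bound: "\<And>k. (LINT x|lebesgue_on {a<..<b}. e k x) \<le> C"
    and U_prim: "\<And>k x y. x \<in> {a<..<b} \<Longrightarrow> y \<in> {a<..<b} \<Longrightarrow>
      U k y - U k x = primitive (lebesgue_on {a<..<b}) (gu k) y - primitive (lebesgue_on {a<..<b}) (gu k) x"
    and V_prim: "\<And>k x y. x \<in> {a<..<b} \<Longrightarrow> y \<in> {a<..<b} \<Longrightarrow>
      V k y - V k x = primitive (lebesgue_on {a<..<b}) (gv k) y - primitive (lebesgue_on {a<..<b}) (gv k) x"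
    and U_int: "\<And>k. integrable (lebesgue_on {a<..<b}) (U k)"
    and U_bound: "\<And>k. (LINT x|lebesgue_on {a<..<b}. \<bar>U k x\<bar>) \<le> C"
    and V_le: "\<And>k x. x \<in> {a<..<b} \<Longrightarrow> V k x \<le> 1"
    and elastic: "\<And>\<eta>. \<eta> > 0 \<Longrightarrow> \<exists>\<delta>. 0 < \<delta> \<and> \<delta> < 1 \<and>
      (\<forall>k. \<forall>x\<in>{a<..<b}. 1 - \<delta> \<le> V k x \<longrightarrow> \<bar>gu k x\<bar> \<le> c\<^sub>0 * sqrt (e k x) + \<eta> * e k x)"
    and transition: "\<And>\<delta>. 0 < \<delta> \<Longrightarrow> \<delta> < 1 \<Longrightarrow> \<exists>m>0. \<forall>k. \<forall>x\<in>{a<..<b}.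
      V k x \<in> {1 - \<delta>..1 - \<delta> / 2} \<longrightarrow> m * \<bar>gv k x\<bar> \<le> e k x"
    and well: "\<And>\<delta>. 0 < \<delta> \<Longrightarrow> \<delta> < 1 \<Longrightarrow> \<exists>m>0. \<forall>k. \<forall>x\<in>{a<..<b}.
      V k x \<le> 1 - \<delta> / 2 \<longrightarrow> m \<le> eps k * e k x"
    and eps_pos: "\<And>k. 0 < eps k" and eps_lim: "eps \<longlonglongrightarrow> 0"
    and F_mono: "mono F" and F_rc: "\<And>x. continuous (at_right x) F" and F_bdd: "\<And>x. \<bar>F x\<bar> \<le> M"
    and F_lim: "\<And>x. isCont F x \<Longrightarrow> (\<lambda>k. primitive (lebesgue_on {a<..<b}) (e k) x) \<longlonglongrightarrow> F x"
begin

abbreviation L :: "real measure" where "L \<equiv> lebesgue_on {a<..<b}"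
definition E :: "nat \<Rightarrow> real \<Rightarrow> real" where "E k = primitive L (e k)"
definition \<mu> :: "real measure" where "\<mu> = interval_measure F"

sublocale finite_measure \<mu>
  unfolding \<mu>_def by (rule finite_measure_interval_measure[OF F_mono F_rc F_bdd])

lemma sets_mu: "sets \<mu> = sets borel" by (simp add: \<mu>_def)

lemma ind_int: "integrable L w \<Longrightarrow> A \<in> sets borel \<Longrightarrow> integrable L (\<lambda>t. w t * indicator A t)" for w :: "real \<Rightarrow> real"
  by (rule integrable_mult_indicator_borel[OF _ measurable_ident_lebesgue_on])

lemma E_diff: "x \<le> y \<Longrightarrow> E k y - E k x = (LINT t|L. e k t * indicator {x..<y} t)"
  unfolding E_def by (rule primitive_diff[OF e_int measurable_ident_lebesgue_on])

lemma E_diff_nonneg: "x \<le> y \<Longrightarrow> 0 \<le> E k y - E k x"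
  unfolding E_diff by (intro integral_nonneg_AE AE_I2) (auto intro!: mult_nonneg_nonneg e_nonneg)

lemma E_diff_le: "x \<le> y \<Longrightarrow> E k y - E k x \<le> C"
proof -
  assume "x \<le> y"
  then have "E k y - E k x = (LINT t|L. e k t * indicator {x..<y} t)" by (rule E_diff)
  also have "\<dots> \<le> (LINT t|L. e k t)"
    by (rule integral_mono[OF ind_int[OF e_int] e_int]) (use e_nonneg in \<open>auto simp: indicator_def\<close>)
  finally show ?thesis using e_bound[of k] by linarith
qed

lemma E_diff_mono: "x \<le> x' \<Longrightarrow> x' \<le> y' \<Longrightarrow> y' \<le> y \<Longrightarrow> E k y' - E k x' \<le> E k y - E k x"
  using E_diff_nonneg[of x x' k] E_diff_nonneg[of y' y k] by linarith

lemma measure_Ioc: "p \<le> q \<Longrightarrow> measure \<mu> {p<..q} = F q - F p"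
  unfolding measure_def \<mu>_def
  using F_mono by (subst emeasure_interval_measure_Ioc[OF _ _ F_rc]) (auto simp: mono_def)

lemma F_local_increment:
  assumes "\<epsilon> > 0"
  obtains r where "r > 0" "\<And>p q. x - r < p \<Longrightarrow> p \<le> x \<Longrightarrow> x \<le> q \<Longrightarrow> q < x + r \<Longrightarrow> F q - F p < measure \<mu> {x} + \<epsilon>"
proof -
  obtain r where r: "r > 0" "measure \<mu> (ball x r - {x}) < \<epsilon>"
    using punctured_ball_small[OF finite_measure_axioms sets_mu assms] by blast
  show ?thesis
  proof (rule that[OF r(1)])
    fix p q assume pq: "x - r < p" "p \<le> x" "x \<le> q" "q < x + r"
    have "F q - F p = measure \<mu> {p<..q}" using pq by (simp add: measure_Ioc)
    also have "\<dots> \<le> measure \<mu> ({x} \<union> (ball x r - {x}))"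
      by (rule finite_measure_mono) (use pq sets_mu in \<open>auto simp: dist_real_def\<close>)
    also have "\<dots> \<le> measure \<mu> {x} + measure \<mu> (ball x r - {x})"
      by (rule measure_Un_le) (use sets_mu in auto)
    finally show "F q - F p < measure \<mu> {x} + \<epsilon>" using r(2) by linarith
  qed
qed

lemma isCont_F:
  assumes "measure \<mu> {x} = 0"
  shows "isCont F x"
  unfolding continuous_at_eps_delta
proof (intro allI impI)
  fix \<epsilon> :: real assume "\<epsilon> > 0"
  then obtain r where r: "r > 0"
    "\<And>p q. x - r < p \<Longrightarrow> p \<le> x \<Longrightarrow> x \<le> q \<Longrightarrow> q < x + r \<Longrightarrow> F q - F p < measure \<mu> {x} + \<epsilon>"
    using F_local_increment by blast
  have "dist (F y) (F x) < \<epsilon>" if "dist y x < r" for y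
  proof (cases "x \<le> y")
    case True
    then have "F y - F x < \<epsilon>" using r(2)[of x y] that r(1) assms by (auto simp: dist_real_def)
    moreover have "F x \<le> F y" using F_mono True by (auto simp: mono_def)
    ultimately show ?thesis by (simp add: dist_real_def)
  next
    case False
    then have "F x - F y < \<epsilon>" using r(2)[of y x] that r(1) assms by (auto simp: dist_real_def)
    moreover have "F y \<le> F x" using F_mono False by (auto simp: mono_def)
    ultimately show ?thesis by (simp add: dist_real_def)
  qed
  with r(1) show "\<exists>d>0. \<forall>x'. dist x' x < d \<longrightarrow> dist (F x') (F x) < \<epsilon>" by blast
qed

lemma E_lim: "measure \<mu> {x} = 0 \<Longrightarrow> (\<lambda>k. E k x) \<longlonglongrightarrow> F x"
  unfolding E_def by (rule F_lim[OF isCont_F])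

lemma good_point:
  assumes "x < y"
  obtains z where "x < z" "z < y" "measure \<mu> {z} = 0"
proof -
  have "uncountable ({x<..<y} - {z. measure \<mu> {z} \<noteq> 0})"
    by (rule uncountable_minus_countable[OF _ countable_support]) (use assms in \<open>simp add: uncountable_open_interval\<close>)
  then obtain z where "z \<in> {x<..<y} - {z. measure \<mu> {z} \<noteq> 0}" by (metis countable_empty equals0I)
  then show ?thesis by (intro that[of z]) auto
qed

lemma integral_indicator_Ico: "a < x \<Longrightarrow> x \<le> y \<Longrightarrow> y < b \<Longrightarrow> (LINT t|L. indicator {x..<y} t) = y - x"
proof -
  assume xy: "a < x" "x \<le> y" "y < b"
  have "(LINT t|L. indicator {x..<y} t) = (LINT t|lebesgue. indicator {a<..<b} t * indicator {x..<y} t :: real)"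
    by (rule integral_lebesgue_on_eq) simp
  also have "\<dots> = (LINT t|lebesgue. indicator {x..<y} t)"
    using xy by (intro Bochner_Integration.integral_cong) (auto simp: indicator_def)
  also have "\<dots> = y - x" using xy by simp
  finally show ?thesis .
qed

lemma const_int: "integrable L (\<lambda>_. c)" for c :: real
  by (rule finite_measure.integrable_const[OF finite_measure_lebesgue_on_Ioo])

lemma V_cont: "continuous_on {a<..<b} (V k)"
proof -
  have "continuous_on {a<..<b} (\<lambda>x. primitive L (gv k) x)"
    by (intro continuous_at_imp_continuous_on ballI isCont_primitive[OF gv_int measurable_ident_lebesgue_on] AE_lebesgue_on_neq)
  then have "continuous_on {a<..<b} (\<lambda>x. (V k ((a+b)/2) - primitive L (gv k) ((a+b)/2)) + primitive L (gv k) x)"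
    by (intro continuous_intros)
  then show ?thesis
  proof (rule continuous_on_eq)
    fix x assume "x \<in> {a<..<b}"
    moreover have "(a+b)/2 \<in> {a<..<b}" using ab by auto
    ultimately show "V k ((a+b)/2) - primitive L (gv k) ((a+b)/2) + primitive L (gv k) x = V k x"
      using V_prim[of "(a+b)/2" x k] by simp
  qed
qed

text \<open>For large \<open>k\<close> the potential term forces \<open>V k\<close> above
  \<open>1 - \<delta> / 2\<close> somewhere in \<open>{p..q}\<close>. If \<open>V k\<close> also
  falls below \<open>1 - \<delta>\<close> there, it crosses a gap of height
  \<open>\<delta> / 2\<close> on an interval where \<open>e k\<close> is at least \<open>m\<close>
  times \<open>\<bar>gv k\<bar>\<close>; this costs \<open>m * (\<delta> / 2)\<close>. The index
  from which the claim holds depends on \<open>p\<close> and \<open>q\<close>, but \<kappa> does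
  not.\<close>

lemma transition_cost:
  assumes \<delta>: "0 < \<delta>" "\<delta> < 1"
  obtains \<kappa> where "\<kappa> > 0" "\<And>p q. a < p \<Longrightarrow> p < q \<Longrightarrow> q < b \<Longrightarrow>
    \<forall>\<^sub>F k in sequentially. E k q - E k p < \<kappa> \<longrightarrow> (\<forall>x\<in>{p..q}. 1 - \<delta> \<le> V k x)"
proof -
  obtain m where m: "m > 0" "\<And>k x. x \<in> {a<..<b} \<Longrightarrow> V k x \<in> {1 - \<delta>..1 - \<delta> / 2} \<Longrightarrow> m * \<bar>gv k x\<bar> \<le> e k x"
    using transition[OF \<delta>] by blast
  obtain m' where m': "m' > 0" "\<And>k x. x \<in> {a<..<b} \<Longrightarrow> V k x \<le> 1 - \<delta> / 2 \<Longrightarrow> m' \<le> eps k * e k x"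
    using well[OF \<delta>] by blast
  show ?thesis
  proof (rule that[of "m * (\<delta> / 2)"])
    show "m * (\<delta> / 2) > 0" using m(1) \<delta> by simp
    fix p q assume pq: "a < p" "p < q" "q < b"
    \<comment> \<open>If \<open>V k\<close> were at most \<open>1 - \<delta> / 2\<close> throughout,
      \<open>m' * (q - p)\<close> would be bounded by \<open>eps k\<close> times the energy.\<close>
    have "(\<lambda>k. eps k * C) \<longlonglongrightarrow> 0 * C" by (intro tendsto_intros eps_lim)
    then have "\<forall>\<^sub>F k in sequentially. eps k * C < m' * (q - p)"
      using m'(1) pq by (intro order_tendstoD(2)) auto
    then show "\<forall>\<^sub>F k in sequentially. E k q - E k p < m * (\<delta> / 2) \<longrightarrow> (\<forall>x\<in>{p..q}. 1 - \<delta> \<le> V k x)"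
    proof eventually_elim
      case (elim k)
      have "\<exists>y\<in>{p..q}. V k y > 1 - \<delta> / 2"
      proof (rule ccontr)
        assume "\<not> (\<exists>y\<in>{p..q}. V k y > 1 - \<delta> / 2)"
        then have low: "V k y \<le> 1 - \<delta> / 2" if "y \<in> {p..q}" for y using that by force
        have "m' * (q - p) = (LINT t|L. m' * indicator {p..<q} t)"
          using integral_indicator_Ico[of p q] pq by simp
        also have "\<dots> \<le> (LINT t|L. eps k * (e k t * indicator {p..<q} t))"
        proof (rule integral_mono)
          show "integrable L (\<lambda>t. m' * indicator {p..<q} t)" using ind_int[OF const_int] by simp
          show "integrable L (\<lambda>t. eps k * (e k t * indicator {p..<q} t))"
            by (intro integrable_mult_right ind_int e_int) auto
          fix t assume "t \<in> space L"
          then show "m' * indicator {p..<q} t \<le> eps k * (e k t * indicator {p..<q} t)"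
            using m'(2)[of t k] low[of t] by (cases "t \<in> {p..<q}") auto
        qed
        also have "\<dots> = eps k * (E k q - E k p)"
          using pq by (simp add: E_diff)
        also have "\<dots> \<le> eps k * C"
          using E_diff_le[of p q k] eps_pos[of k] pq by (intro mult_left_mono) auto
        finally show False using elim by simp
      qed
      then obtain y where y: "y \<in> {p..q}" "V k y > 1 - \<delta> / 2" by blast
      show ?case
      proof (intro impI ballI, rule ccontr)
        fix x assume small: "E k q - E k p < m * (\<delta> / 2)" and x: "x \<in> {p..q}" and neg: "\<not> 1 - \<delta> \<le> V k x"
        have cont: "continuous_on {p..q} (V k)" by (rule continuous_on_subset[OF V_cont]) (use pq in auto)
        have lt: "V k x < 1 - \<delta>" "1 - \<delta> < 1 - \<delta> / 2" using neg \<delta> by auto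
        obtain p' q' where pq': "p \<le> p'" "p' < q'" "q' \<le> q" "\<bar>V k q' - V k p'\<bar> = (1 - \<delta> / 2) - (1 - \<delta>)"
          "\<And>t. t \<in> {p'..q'} \<Longrightarrow> V k t \<in> {1 - \<delta>..1 - \<delta> / 2}"
          using crossing_interval[OF cont x y(1) lt y(2)] by blast
        have in_ab: "p' \<in> {a<..<b}" "q' \<in> {a<..<b}" using pq pq' by auto
        have "\<delta> / 2 = \<bar>V k q' - V k p'\<bar>" using pq'(4) by simp
        also have "\<dots> = \<bar>LINT t|L. gv k t * indicator {p'..<q'} t\<bar>"
          using V_prim[OF in_ab] primitive_diff[OF gv_int measurable_ident_lebesgue_on, of p' q'] pq' by simp
        also have "\<dots> \<le> (LINT t|L. \<bar>gv k t * indicator {p'..<q'} t\<bar>)" by (rule integral_abs_bound)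
        finally have "m * (\<delta> / 2) \<le> m * (LINT t|L. \<bar>gv k t * indicator {p'..<q'} t\<bar>)"
          using m(1) by simp
        also have "\<dots> = (LINT t|L. m * \<bar>gv k t * indicator {p'..<q'} t\<bar>)" by simp
        also have "\<dots> \<le> (LINT t|L. e k t * indicator {p'..<q'} t)"
        proof (rule integral_mono)
          show "integrable L (\<lambda>t. m * \<bar>gv k t * indicator {p'..<q'} t\<bar>)"
            by (intro integrable_mult_right integrable_abs ind_int gv_int) auto
          show "integrable L (\<lambda>t. e k t * indicator {p'..<q'} t)" by (intro ind_int e_int) auto
          fix t assume "t \<in> space L"
          then show "m * \<bar>gv k t * indicator {p'..<q'} t\<bar> \<le> e k t * indicator {p'..<q'} t"
            using m(2)[of t k] pq'(5)[of t] by (cases "t \<in> {p'..<q'}") auto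
        qed
        also have "\<dots> = E k q' - E k p'" using pq' by (simp add: E_diff)
        also have "\<dots> \<le> E k q - E k p" using pq' by (intro E_diff_mono) auto
        finally show False using small by simp
      qed
    qed
  qed
qed

text \<open>Integration of the pointwise bound. Cauchy's inequality for the root is replaced by
  Young's inequality with a free parameter \<open>l\<close>, whose integrated form involves
  \<open>e k\<close> itself and no root; \<open>sqrt_bound_of_AM_GM\<close> then picks the best
  \<open>l\<close>.\<close>

lemma oscillation_estimate:
  assumes \<eta>: "\<eta> \<ge> 0" and st: "a < s" "s < t" "t < b"
    and bd: "\<And>x. x \<in> {s..t} \<Longrightarrow> \<bar>gu k x\<bar> \<le> c\<^sub>0 * sqrt (e k x) + \<eta> * e k x"
  shows "\<bar>U k t - U k s\<bar> \<le> c\<^sub>0 * sqrt ((t - s) * (E k t - E k s)) + \<eta> * (E k t - E k s)"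
proof -
  define I where "I = E k t - E k s"
  have I: "I \<ge> 0" unfolding I_def using st by (intro E_diff_nonneg) auto
  have Ieq: "I = (LINT x|L. e k x * indicator {s..<t} x)" unfolding I_def using st by (intro E_diff) auto
  have 1: "\<bar>U k t - U k s\<bar> \<le> c\<^sub>0 * ((l * (t - s) + I / l) / 2) + \<eta> * I" if l: "l > 0" for l
  proof -
    let ?i = "\<lambda>x. indicator {s..<t} x :: real"
    have "\<bar>U k t - U k s\<bar> = \<bar>LINT x|L. gu k x * ?i x\<bar>"
      using U_prim[of s t k] primitive_diff[OF gu_int measurable_ident_lebesgue_on, of s t k] st by simp
    also have "\<dots> \<le> (LINT x|L. \<bar>gu k x * ?i x\<bar>)" by (rule integral_abs_bound)
    also have "\<dots> \<le> (LINT x|L. c\<^sub>0 * l / 2 * ?i x + (c\<^sub>0 / (2 * l) + \<eta>) * (e k x * ?i x))"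
    proof (rule integral_mono)
      show "integrable L (\<lambda>x. \<bar>gu k x * ?i x\<bar>)" by (intro integrable_abs ind_int gu_int) auto
      show "integrable L (\<lambda>x. c\<^sub>0 * l / 2 * ?i x + (c\<^sub>0 / (2 * l) + \<eta>) * (e k x * ?i x))"
        by (intro Bochner_Integration.integrable_add ind_int const_int integrable_mult_right e_int) auto
      fix x assume x: "x \<in> space L"
      show "\<bar>gu k x * ?i x\<bar> \<le> c\<^sub>0 * l / 2 * ?i x + (c\<^sub>0 / (2 * l) + \<eta>) * (e k x * ?i x)"
      proof (cases "x \<in> {s..<t}")
        case True
        have e0: "0 \<le> e k x" using x e_nonneg by simp
        have "0 \<le> (sqrt (e k x) - l)\<^sup>2 / (2 * l)" using l by simp
        also have "\<dots> = l / 2 + e k x / (2 * l) - sqrt (e k x)"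
          using l e0 by (simp add: power2_diff field_simps power2_eq_square)
        finally have "c\<^sub>0 * sqrt (e k x) \<le> c\<^sub>0 * (l / 2 + e k x / (2 * l))"
          using c0 by (intro mult_left_mono) auto
        moreover have "\<bar>gu k x\<bar> \<le> c\<^sub>0 * sqrt (e k x) + \<eta> * e k x" using bd[of x] True by auto
        ultimately show ?thesis using True by (simp add: algebra_simps)
      qed simp
    qed
    also have "\<dots> = (LINT x|L. c\<^sub>0 * l / 2 * ?i x) + (LINT x|L. (c\<^sub>0 / (2 * l) + \<eta>) * (e k x * ?i x))"
      by (intro Bochner_Integration.integral_add ind_int const_int integrable_mult_right e_int) auto
    also have "\<dots> = c\<^sub>0 * l / 2 * (t - s) + (c\<^sub>0 / (2 * l) + \<eta>) * I"
      using integral_indicator_Ico[of s t] st by (simp add: Ieq)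
    also have "\<dots> = c\<^sub>0 * ((l * (t - s) + I / l) / 2) + \<eta> * I"
      using l by (simp add: field_simps)
    finally show ?thesis .
  qed
  have "(\<bar>U k t - U k s\<bar> - \<eta> * I) / c\<^sub>0 \<le> sqrt ((t - s) * I)"
  proof (rule sqrt_bound_of_AM_GM)
    fix l :: real assume "l > 0"
    from 1[OF this] show "(\<bar>U k t - U k s\<bar> - \<eta> * I) / c\<^sub>0 \<le> (l * (t - s) + I / l) / 2"
      unfolding pos_divide_le_eq[OF c0] mult.commute[of _ c\<^sub>0] by linarith
  qed (use st I in auto)
  then have "\<bar>U k t - U k s\<bar> - \<eta> * I \<le> c\<^sub>0 * sqrt ((t - s) * I)"
    unfolding pos_divide_le_eq[OF c0] mult.commute[of _ c\<^sub>0] .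
  then show ?thesis unfolding I_def[symmetric] by linarith
qed

text \<open>Compactness of \<open>{x..y}\<close> in the form of Bolzano's bisection principle: the
  claim passes to unions of adjacent intervals, and around each point it follows from
  \<open>transition_cost\<close>.\<close>

lemma near_one:
  assumes \<delta>: "0 < \<delta>" "\<delta> < 1"
  obtains \<kappa> where "\<kappa> > 0" "\<And>x y. a < x \<Longrightarrow> x \<le> y \<Longrightarrow> y < b \<Longrightarrow> (\<And>z. z \<in> {x..y} \<Longrightarrow> measure \<mu> {z} < \<kappa>) \<Longrightarrow>
    \<forall>\<^sub>F k in sequentially. \<forall>t\<in>{x..y}. 1 - \<delta> \<le> V k t"
proof -
  obtain \<kappa> where \<kappa>: "\<kappa> > 0" "\<And>p q. a < p \<Longrightarrow> p < q \<Longrightarrow> q < b \<Longrightarrow>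
    \<forall>\<^sub>F k in sequentially. E k q - E k p < \<kappa> \<longrightarrow> (\<forall>x\<in>{p..q}. 1 - \<delta> \<le> V k x)"
    using transition_cost[OF \<delta>] by blast
  show ?thesis
  proof (rule that[OF \<kappa>(1)])
    fix x y assume xy: "a < x" "x \<le> y" "y < b" and small: "\<And>z. z \<in> {x..y} \<Longrightarrow> measure \<mu> {z} < \<kappa>"
    show "\<forall>\<^sub>F k in sequentially. \<forall>t\<in>{x..y}. 1 - \<delta> \<le> V k t"
      using xy(2)
    proof (induction rule: Bolzano)
      case (trans p q r)
      then have "\<forall>\<^sub>F k in sequentially. (\<forall>t\<in>{p..q}. 1 - \<delta> \<le> V k t) \<and> (\<forall>t\<in>{q..r}. 1 - \<delta> \<le> V k t)"
        by (simp add: eventually_conj)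
      then show ?case
      proof eventually_elim
        case (elim k)
        show ?case
        proof
          fix t assume "t \<in> {p..r}"
          then have "t \<in> {p..q} \<or> t \<in> {q..r}" by auto
          then show "1 - \<delta> \<le> V k t" using elim by blast
        qed
      qed
    next
      \<comment> \<open>The mass of \<open>z\<close> is below \<kappa>, so non-atoms
        \<open>p < z < q\<close> can be taken so close that \<open>F q - F p < \<kappa>\<close>. At
        non-atoms the energies converge to \<open>F\<close>, hence the energy on
        \<open>{p..q}\<close> is eventually below \<kappa> as well.\<close>
      case (local z)
      then have z: "z \<in> {x..y}" by auto
      have "\<kappa> - measure \<mu> {z} > 0" using small[OF z] by simp
      then obtain r where r: "r > 0"
        "\<And>p q. z - r < p \<Longrightarrow> p \<le> z \<Longrightarrow> z \<le> q \<Longrightarrow> q < z + r \<Longrightarrow> F q - F p < measure \<mu> {z} + (\<kappa> - measure \<mu> {z})"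
        using F_local_increment by blast
      obtain p where p: "max a (z - r) < p" "p < z" "measure \<mu> {p} = 0"
        using good_point[of "max a (z - r)" z] z xy r(1) by auto
      obtain q where q: "z < q" "q < min b (z + r)" "measure \<mu> {q} = 0"
        using good_point[of z "min b (z + r)"] z xy r(1) by auto
      have Fpq: "F q - F p < \<kappa>" using r(2)[of p q] p q by auto
      have "(\<lambda>k. E k q - E k p) \<longlonglongrightarrow> F q - F p" by (intro tendsto_intros E_lim p q)
      then have "\<forall>\<^sub>F k in sequentially. E k q - E k p < \<kappa>" using Fpq by (rule order_tendstoD(2))
      moreover have "\<forall>\<^sub>F k in sequentially. E k q - E k p < \<kappa> \<longrightarrow> (\<forall>x\<in>{p..q}. 1 - \<delta> \<le> V k x)"
        using p q by (intro \<kappa>(2)) auto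
      ultimately have ev: "\<forall>\<^sub>F k in sequentially. \<forall>x\<in>{p..q}. 1 - \<delta> \<le> V k x"
        by eventually_elim blast
      show ?case
      proof (intro exI[of _ "min (z - p) (q - z)"] conjI allI impI)
        show "0 < min (z - p) (q - z)" using p q by simp
        fix p' q' assume pq': "p' \<le> z \<and> z \<le> q' \<and> q' - p' < min (z - p) (q - z)"
        have sub: "{p'..q'} \<subseteq> {p..q}" using pq' by auto
        show "\<forall>\<^sub>F k in sequentially. \<forall>t\<in>{p'..q'}. 1 - \<delta> \<le> V k t"
          using ev by eventually_elim (use sub in blast)
      qed
    qed
  qed
qed

text \<open>The closeness of \<open>V k\<close> to 1 that \<open>elastic\<close> asks for depends on
  \<eta>, and through \<open>near_one\<close> so does \<kappa>. The index from which the estimate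
  holds is common to all \<open>s\<close> and \<open>t\<close>, as equicontinuity requires.\<close>

lemma eventually_oscillation_estimate:
  assumes \<eta>: "\<eta> > 0"
  obtains \<kappa> where "\<kappa> > 0" "\<And>x y. a < x \<Longrightarrow> x \<le> y \<Longrightarrow> y < b \<Longrightarrow> (\<And>z. z \<in> {x..y} \<Longrightarrow> measure \<mu> {z} < \<kappa>) \<Longrightarrow>
    \<forall>\<^sub>F k in sequentially. \<forall>s t. x \<le> s \<longrightarrow> s < t \<longrightarrow> t \<le> y \<longrightarrow>
      \<bar>U k t - U k s\<bar> \<le> c\<^sub>0 * sqrt ((t - s) * (E k t - E k s)) + \<eta> * (E k t - E k s)"
proof -
  obtain \<delta> where \<delta>: "0 < \<delta>" "\<delta> < 1"
    "\<And>k x. x \<in> {a<..<b} \<Longrightarrow> 1 - \<delta> \<le> V k x \<Longrightarrow> \<bar>gu k x\<bar> \<le> c\<^sub>0 * sqrt (e k x) + \<eta> * e k x"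
    using elastic[OF \<eta>] by blast
  obtain \<kappa> where \<kappa>: "\<kappa> > 0" "\<And>x y. a < x \<Longrightarrow> x \<le> y \<Longrightarrow> y < b \<Longrightarrow> (\<And>z. z \<in> {x..y} \<Longrightarrow> measure \<mu> {z} < \<kappa>) \<Longrightarrow>
    \<forall>\<^sub>F k in sequentially. \<forall>t\<in>{x..y}. 1 - \<delta> \<le> V k t"
    using near_one[OF \<delta>(1,2)] by blast
  show ?thesis
  proof (rule that[OF \<kappa>(1)])
    fix x y assume xy: "a < x" "x \<le> y" "y < b" and small: "\<And>z. z \<in> {x..y} \<Longrightarrow> measure \<mu> {z} < \<kappa>"
    have "\<forall>\<^sub>F k in sequentially. \<forall>t\<in>{x..y}. 1 - \<delta> \<le> V k t"
      using small by (intro \<kappa>(2) xy)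
    then show "\<forall>\<^sub>F k in sequentially. \<forall>s t. x \<le> s \<longrightarrow> s < t \<longrightarrow> t \<le> y \<longrightarrow>
      \<bar>U k t - U k s\<bar> \<le> c\<^sub>0 * sqrt ((t - s) * (E k t - E k s)) + \<eta> * (E k t - E k s)"
    proof eventually_elim
      case (elim k)
      show ?case
      proof (intro allI impI)
        fix s t assume st: "x \<le> s" "s < t" "t \<le> y"
        show "\<bar>U k t - U k s\<bar> \<le> c\<^sub>0 * sqrt ((t - s) * (E k t - E k s)) + \<eta> * (E k t - E k s)"
        proof (rule oscillation_estimate)
          fix z assume "z \<in> {s..t}"
          then show "\<bar>gu k z\<bar> \<le> c\<^sub>0 * sqrt (e k z) + \<eta> * e k z"
            using elim st xy by (intro \<delta>(3)) auto
        qed (use \<eta> st xy in auto)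
      qed
    qed
  qed
qed

definition G :: "real set" where "G = {x \<in> {a<..<b}. measure \<mu> {x} = 0}"

lemma V_lim:
  assumes x: "x \<in> G"
  shows "(\<lambda>k. V k x) \<longlonglongrightarrow> 1"
proof (rule LIMSEQ_I)
  fix r :: real assume r: "r > 0"
  define \<delta> where "\<delta> = min r 1 / 2"
  have \<delta>: "0 < \<delta>" "\<delta> < 1" "\<delta> < r" using r by (auto simp: \<delta>_def)
  obtain \<kappa> where \<kappa>: "\<kappa> > 0" "\<And>x y. a < x \<Longrightarrow> x \<le> y \<Longrightarrow> y < b \<Longrightarrow> (\<And>z. z \<in> {x..y} \<Longrightarrow> measure \<mu> {z} < \<kappa>) \<Longrightarrow>
    \<forall>\<^sub>F k in sequentially. \<forall>t\<in>{x..y}. 1 - \<delta> \<le> V k t"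
    using near_one[OF \<delta>(1,2)] by blast
  \<comment> \<open>The interval may degenerate to a single point.\<close>
  have "\<forall>\<^sub>F k in sequentially. \<forall>t\<in>{x..x}. 1 - \<delta> \<le> V k t"
    by (rule \<kappa>(2)) (use x \<kappa>(1) in \<open>auto simp: G_def\<close>)
  then have "\<forall>\<^sub>F k in sequentially. norm (V k x - 1) < r"
  proof eventually_elim
    case (elim k)
    then show ?case using V_le[of x k] x \<delta> by (auto simp: G_def)
  qed
  then show "\<exists>no. \<forall>n\<ge>no. norm (V n x - 1) < r" by (simp add: eventually_sequentially)
qed

text \<open>\<eta> is chosen against the total energy bound \<open>C\<close>, which settles the
  linear term; a short interval settles the root. Near a point of mass 0 all atoms are below the
  threshold that belongs to this \<eta>; at an atom the threshold might be smaller than its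
  mass.\<close>

lemma equicontinuous_at:
  assumes x: "x \<in> G" and \<epsilon>: "\<epsilon> > 0"
  obtains r where "r > 0" "a < x - r" "x + r < b" "\<forall>\<^sub>F k in sequentially. \<forall>y. \<bar>y - x\<bar> \<le> r \<longrightarrow> \<bar>U k y - U k x\<bar> \<le> \<epsilon>"
proof -
  define \<eta> where "\<eta> = \<epsilon> / (2 * (C + 1))"
  have \<eta>: "\<eta> > 0" using \<epsilon> C by (simp add: \<eta>_def)
  have \<eta>C: "\<eta> * C \<le> \<epsilon> / 2"
  proof -
    have "\<eta> * C \<le> \<eta> * (C + 1)" using \<eta> by simp
    also have "\<dots> = \<epsilon> / 2"
    proof -
      have "\<epsilon> / (2 * K) * K = \<epsilon> / 2" if "K \<noteq> 0" for K using that by simp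
      moreover have "C + 1 \<noteq> 0" using C by linarith
      ultimately show ?thesis unfolding \<eta>_def by blast
    qed
    finally show ?thesis .
  qed
  obtain \<kappa> where \<kappa>: "\<kappa> > 0" "\<And>x y. a < x \<Longrightarrow> x \<le> y \<Longrightarrow> y < b \<Longrightarrow> (\<And>z. z \<in> {x..y} \<Longrightarrow> measure \<mu> {z} < \<kappa>) \<Longrightarrow>
    \<forall>\<^sub>F k in sequentially. \<forall>s t. x \<le> s \<longrightarrow> s < t \<longrightarrow> t \<le> y \<longrightarrow>
      \<bar>U k t - U k s\<bar> \<le> c\<^sub>0 * sqrt ((t - s) * (E k t - E k s)) + \<eta> * (E k t - E k s)"
    using eventually_oscillation_estimate[OF \<eta>] by blast
  have "finite {z. \<kappa> \<le> measure \<mu> {z}}"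
    by (rule finite_large_atoms) (use \<kappa>(1) sets_mu in auto)
  then obtain r1 where r1: "r1 > 0" "\<And>z. z \<in> {z. \<kappa> \<le> measure \<mu> {z}} \<Longrightarrow> z \<in> ball x r1 \<Longrightarrow> z = x"
    using isolated_from_finite[of _ x] by blast
  define r2 where "r2 = (\<epsilon> / (2 * c\<^sub>0))\<^sup>2 / (C + 1)"
  have r2: "r2 > 0" unfolding r2_def using \<epsilon> c0 C by simp
  have r2C: "c\<^sub>0 * sqrt (d * I) \<le> \<epsilon> / 2" if "0 \<le> d" "d \<le> r2" "0 \<le> I" "I \<le> C" for d I
  proof -
    have "d * I \<le> r2 * (C + 1)" using that r2 by (intro mult_mono) auto
    also have "\<dots> = (\<epsilon> / (2 * c\<^sub>0))\<^sup>2" using C by (simp add: r2_def)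
    finally have "sqrt (d * I) \<le> \<epsilon> / (2 * c\<^sub>0)" using \<epsilon> c0 by (intro real_le_lsqrt) auto
    then have "c\<^sub>0 * sqrt (d * I) \<le> c\<^sub>0 * (\<epsilon> / (2 * c\<^sub>0))" using c0 by (intro mult_left_mono) auto
    then show ?thesis using c0 by simp
  qed
  have xab: "a < x" "x < b" "measure \<mu> {x} = 0" using x by (auto simp: G_def)
  define r where "r = Min {r1, r2, x - a, b - x} / 2"
  have r: "r > 0" "r < r1" "r < r2" "r < x - a" "r < b - x" using r1 r2 xab by (auto simp: r_def)
  have "\<forall>\<^sub>F k in sequentially. \<forall>s t. x - r \<le> s \<longrightarrow> s < t \<longrightarrow> t \<le> x + r \<longrightarrow>
      \<bar>U k t - U k s\<bar> \<le> c\<^sub>0 * sqrt ((t - s) * (E k t - E k s)) + \<eta> * (E k t - E k s)"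
  proof (rule \<kappa>(2))
    fix z assume "z \<in> {x - r..x + r}"
    then have "z \<in> ball x r1" using r by (auto simp: dist_real_def)
    then show "measure \<mu> {z} < \<kappa>" using r1(2)[of z] xab \<kappa>(1) by (cases "\<kappa> \<le> measure \<mu> {z}") auto
  qed (use r in auto)
  then have "\<forall>\<^sub>F k in sequentially. \<forall>y. \<bar>y - x\<bar> \<le> r \<longrightarrow> \<bar>U k y - U k x\<bar> \<le> \<epsilon>"
  proof eventually_elim
    case (elim k)
    have main: "\<bar>U k t - U k s\<bar> \<le> \<epsilon>" if st: "x - r \<le> s" "s < t" "t \<le> x + r" "t - s \<le> r" for s t
    proof -
      have I: "0 \<le> E k t - E k s" "E k t - E k s \<le> C"
        by (rule E_diff_nonneg, use st in simp) (rule E_diff_le, use st in simp)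
      have "\<bar>U k t - U k s\<bar> \<le> c\<^sub>0 * sqrt ((t - s) * (E k t - E k s)) + \<eta> * (E k t - E k s)"
        using elim st by blast
      also have "c\<^sub>0 * sqrt ((t - s) * (E k t - E k s)) \<le> \<epsilon> / 2"
        using st r I by (intro r2C) auto
      also have "\<eta> * (E k t - E k s) \<le> \<eta> * C" using I \<eta> by simp
      finally show ?thesis using \<eta>C by linarith
    qed
    show ?case
    proof (intro allI impI)
      fix y assume y: "\<bar>y - x\<bar> \<le> r"
      show "\<bar>U k y - U k x\<bar> \<le> \<epsilon>"
        using main[of x y] main[of y x] y r(1) \<epsilon>
        by (cases x y rule: linorder_cases) (auto simp: abs_minus_commute)
    qed
  qed
  then show ?thesis using r by (intro that[of r]) auto
qed

text \<open>Eventually \<open>\<bar>U k\<bar>\<close> is at least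
  \<open>\<bar>U k x\<bar> - 1\<close> on an interval whose length \<open>r\<close> does not depend
  on \<open>k\<close>, so a large value at \<open>x\<close> would violate the L1 bound.\<close>

lemma bounded_at:
  assumes x: "x \<in> G"
  shows "bounded (range (\<lambda>k. U k x))"
proof -
  obtain r where r: "r > 0" "a < x - r" "x + r < b"
    "\<forall>\<^sub>F k in sequentially. \<forall>y. \<bar>y - x\<bar> \<le> r \<longrightarrow> \<bar>U k y - U k x\<bar> \<le> 1"
    using equicontinuous_at[OF x, of 1] by auto
  from r(4) have "\<forall>\<^sub>F k in sequentially. norm (U k x) \<le> C / r + 1"
  proof eventually_elim
    case (elim k)
    have "(\<bar>U k x\<bar> - 1) * r = (LINT t|L. (\<bar>U k x\<bar> - 1) * indicator {x..<x + r} t)"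
      using integral_indicator_Ico[of x "x + r"] r by simp
    also have "\<dots> \<le> (LINT t|L. \<bar>U k t\<bar>)"
    proof (rule integral_mono)
      show "integrable L (\<lambda>t. (\<bar>U k x\<bar> - 1) * indicator {x..<x + r} t)"
        by (rule ind_int[OF const_int]) simp
      show "integrable L (\<lambda>t. \<bar>U k t\<bar>)" using U_int by simp
      fix t
      show "(\<bar>U k x\<bar> - 1) * indicator {x..<x + r} t \<le> \<bar>U k t\<bar>"
      proof (cases "t \<in> {x..<x + r}")
        case True
        then have "\<bar>U k t - U k x\<bar> \<le> 1" using elim by auto
        then show ?thesis using True by simp
      qed simp
    qed
    also have "\<dots> \<le> C" by (rule U_bound)
    finally have "\<bar>U k x\<bar> - 1 \<le> C / r" using r(1) by (simp add: pos_le_divide_eq)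
    then show ?case by simp
  qed
  then have "Bseq (\<lambda>k. U k x)" by (rule BfunI)
  then show ?thesis by (simp add: Bseq_eq_bounded)
qed

text \<open>Equicontinuity holds at each point of \<open>G\<close> without uniformity, so the
  subsequence is made to converge on a countable dense subset of \<open>G\<close>, and
  equicontinuity at a single point of \<open>G\<close> then gives Cauchy's criterion there. Off
  \<open>G\<close>, \<open>w\<close> is whatever \<open>lim\<close> returns.\<close>

theorem compactness:
  obtains s w where "strict_mono (s :: nat \<Rightarrow> nat)" "\<And>x. x \<in> G \<Longrightarrow> (\<lambda>k. U (s k) x) \<longlonglongrightarrow> w x"
    "controlled_oscillation \<mu> a b c\<^sub>0 w"
proof -
  obtain Q where Q: "countable Q" "Q \<subseteq> G" "G \<subseteq> closure Q" using separable by blast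
  have "bounded (range (\<lambda>k. U k q))" if "q \<in> Q" for q using bounded_at Q that by blast
  then obtain s where s: "strict_mono s" "\<And>q. q \<in> Q \<Longrightarrow> convergent (\<lambda>k. U (s k) q)"
    using diagonal_subsequence_convergent[OF Q(1), of U] by blast
  define w where "w x = lim (\<lambda>k. U (s k) x)" for x
  have w: "(\<lambda>k. U (s k) x) \<longlonglongrightarrow> w x" if x: "x \<in> G" for x
  proof -
    have "Cauchy (\<lambda>k. U (s k) x)"
    proof (rule CauchyI)
      fix \<epsilon> :: real assume \<epsilon>: "\<epsilon> > 0"
      then have \<epsilon>4: "\<epsilon> / 4 > 0" by simp
      obtain r where r: "r > 0" "\<forall>\<^sub>F k in sequentially. \<forall>y. \<bar>y - x\<bar> \<le> r \<longrightarrow> \<bar>U k y - U k x\<bar> \<le> \<epsilon> / 4"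
        using equicontinuous_at[OF x \<epsilon>4] by blast
      have "x \<in> closure Q" using Q(3) x by blast
      then obtain q where q: "q \<in> Q" "dist q x < r" using r(1) unfolding closure_approachable by blast
      have "\<forall>\<^sub>F k in sequentially. \<bar>U (s k) q - U (s k) x\<bar> \<le> \<epsilon> / 4"
        using eventually_subseq[OF s(1) r(2)]
        by eventually_elim (use q(2) in \<open>auto simp: dist_real_def\<close>)
      then obtain N1 where N1: "\<And>k. k \<ge> N1 \<Longrightarrow> \<bar>U (s k) q - U (s k) x\<bar> \<le> \<epsilon> / 4"
        by (auto simp: eventually_sequentially)
      have "Cauchy (\<lambda>k. U (s k) q)" using s(2)[OF q(1)] by (rule convergent_Cauchy)
      then obtain N2 where N2: "\<forall>m\<ge>N2. \<forall>n\<ge>N2. norm (U (s m) q - U (s n) q) < \<epsilon> / 4"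
        using CauchyD \<epsilon>4 by blast
      have "norm (U (s m) x - U (s n) x) < \<epsilon>" if mn: "m \<ge> max N1 N2" "n \<ge> max N1 N2" for m n
      proof -
        have "\<bar>U (s m) q - U (s n) q\<bar> < \<epsilon> / 4" using N2 mn by simp
        moreover have "\<bar>U (s m) q - U (s m) x\<bar> \<le> \<epsilon> / 4" "\<bar>U (s n) q - U (s n) x\<bar> \<le> \<epsilon> / 4"
          using N1 mn by simp_all
        ultimately show ?thesis using \<epsilon> unfolding real_norm_def by linarith
      qed
      then show "\<exists>N. \<forall>m\<ge>N. \<forall>n\<ge>N. norm (U (s m) x - U (s n) x) < \<epsilon>" by blast
    qed
    then show ?thesis unfolding w_def by (simp add: Cauchy_convergent_iff convergent_LIMSEQ_iff)
  qed
  have "controlled_oscillation \<mu> a b c\<^sub>0 w"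
  proof (rule controlled_oscillation.intro)
    show "a < b" by (rule ab)
    show "sets \<mu> = sets borel" by (rule sets_mu)
    show "0 \<le> c\<^sub>0" using c0 by simp
    show "finite_measure \<mu>" by (rule finite_measure_axioms)
    fix \<eta> :: real assume "\<eta> > 0"
    then obtain \<kappa> where \<kappa>: "\<kappa> > 0" "\<And>x y. a < x \<Longrightarrow> x \<le> y \<Longrightarrow> y < b \<Longrightarrow> (\<And>z. z \<in> {x..y} \<Longrightarrow> measure \<mu> {z} < \<kappa>) \<Longrightarrow>
      \<forall>\<^sub>F k in sequentially. \<forall>s t. x \<le> s \<longrightarrow> s < t \<longrightarrow> t \<le> y \<longrightarrow>
        \<bar>U k t - U k s\<bar> \<le> c\<^sub>0 * sqrt ((t - s) * (E k t - E k s)) + \<eta> * (E k t - E k s)"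
      using eventually_oscillation_estimate by blast
    have "\<bar>w y - w x\<bar> \<le> c\<^sub>0 * sqrt ((y - x) * measure \<mu> {x<..<y}) + \<eta> * measure \<mu> {x<..<y}"
      if xy: "a < x" "x < y" "y < b" "measure \<mu> {x} = 0" "measure \<mu> {y} = 0"
        and small: "\<forall>z\<in>{x<..<y}. measure \<mu> {z} < \<kappa>" for x y
    proof -
      have G: "x \<in> G" "y \<in> G" using xy by (auto simp: G_def)
      have "\<forall>\<^sub>F k in sequentially. \<forall>s t. x \<le> s \<longrightarrow> s < t \<longrightarrow> t \<le> y \<longrightarrow>
        \<bar>U k t - U k s\<bar> \<le> c\<^sub>0 * sqrt ((t - s) * (E k t - E k s)) + \<eta> * (E k t - E k s)"
      proof (rule \<kappa>(2))
        fix z assume "z \<in> {x..y}"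
        then show "measure \<mu> {z} < \<kappa>" using small xy \<kappa>(1) by (cases "z = x \<or> z = y") auto
      qed (use xy in auto)
      then have "\<forall>\<^sub>F k in sequentially. \<bar>U k y - U k x\<bar> \<le> c\<^sub>0 * sqrt ((y - x) * (E k y - E k x)) + \<eta> * (E k y - E k x)"
        by eventually_elim (use xy in auto)
      then have ev: "\<forall>\<^sub>F k in sequentially. \<bar>U (s k) y - U (s k) x\<bar>
          \<le> c\<^sub>0 * sqrt ((y - x) * (E (s k) y - E (s k) x)) + \<eta> * (E (s k) y - E (s k) x)"
        by (rule eventually_subseq[OF s(1)])
      have Es: "(\<lambda>k. E (s k) z) \<longlonglongrightarrow> F z" if "measure \<mu> {z} = 0" for z
        using LIMSEQ_subseq_LIMSEQ[OF E_lim[OF that] s(1)] by (simp add: o_def)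
      \<comment> \<open>Increments of \<open>F\<close> are masses of half-open intervals; the end
        point \<open>y\<close> has no mass.\<close>
      have "measure \<mu> {x<..y} = measure \<mu> ({x<..<y} \<union> {y})"
        by (rule arg_cong[where f="measure \<mu>"]) (use xy in auto)
      also have "\<dots> = measure \<mu> {x<..<y} + measure \<mu> {y}"
        by (rule finite_measure_Union) (use sets_mu in auto)
      finally have Feq: "measure \<mu> {x<..<y} = F y - F x" using measure_Ioc[of x y] xy by simp
      have "\<bar>w y - w x\<bar> \<le> c\<^sub>0 * sqrt ((y - x) * (F y - F x)) + \<eta> * (F y - F x)"
      proof (rule tendsto_le[OF _ _ _ ev])
        show "(\<lambda>k. \<bar>U (s k) y - U (s k) x\<bar>) \<longlonglongrightarrow> \<bar>w y - w x\<bar>" by (intro tendsto_intros w G)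
        show "(\<lambda>k. c\<^sub>0 * sqrt ((y - x) * (E (s k) y - E (s k) x)) + \<eta> * (E (s k) y - E (s k) x))
            \<longlonglongrightarrow> c\<^sub>0 * sqrt ((y - x) * (F y - F x)) + \<eta> * (F y - F x)"
          by (intro tendsto_intros Es xy)
      qed simp
      then show ?thesis by (simp add: Feq)
    qed
    then show "\<exists>\<kappa>>0. \<forall>x y. a < x \<longrightarrow> x < y \<longrightarrow> y < b \<longrightarrow> measure \<mu> {x} = 0 \<longrightarrow>
      measure \<mu> {y} = 0 \<longrightarrow> (\<forall>z\<in>{x<..<y}. measure \<mu> {z} < \<kappa>) \<longrightarrow>
      \<bar>w y - w x\<bar> \<le> c\<^sub>0 * sqrt ((y - x) * measure \<mu> {x<..<y}) + \<eta> * measure \<mu> {x<..<y}"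
      using \<kappa>(1) by (intro exI[of _ \<kappa>]) blast
  qed
  with s(1) w show ?thesis by (rule that)
qed

end

section \<open>The phase-field functionals\<close>

text \<open>Near 0 the difference quotient exceeds \<open>d / 2\<close>. From \<open>t0 / 2\<close>
  up to 1, monotonicity keeps \<phi> above the positive constant
  \<open>\<phi> (t0 / 2)\<close>.\<close>

lemma right_derivative_linear_lower_bound:
  fixes \<phi> :: "real \<Rightarrow> real"
  assumes mono: "mono_on {0..} \<phi>" and pos: "\<forall>t\<ge>0. 0 \<le> \<phi> t" and zero: "{t \<in> {0..}. \<phi> t = 0} = {0}"
    and der: "(\<phi> has_real_derivative d) (at_right 0)" and d: "d > 0"
  obtains c where "c > 0" "\<And>t. 0 \<le> t \<Longrightarrow> t \<le> 1 \<Longrightarrow> c * t \<le> \<phi> t"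
proof -
  have \<phi>0: "\<phi> 0 = 0" using zero by blast
  have \<phi>pos: "\<phi> t > 0" if "t > 0" for t
  proof -
    have "t \<notin> {t \<in> {0..}. \<phi> t = 0}" unfolding zero using that by simp
    then show ?thesis using pos that by (simp add: order.strict_iff_order)
  qed
  have "((\<lambda>t. (\<phi> t - \<phi> 0) / (t - 0)) \<longlongrightarrow> d) (at_right 0)"
    using der unfolding has_field_derivative_iff by simp
  then have "\<forall>\<^sub>F t in at_right 0. d / 2 < (\<phi> t - \<phi> 0) / (t - 0)"
    using d by (intro order_tendstoD(1)) auto
  then obtain t0 where t0: "t0 > 0" "\<And>t. 0 < t \<Longrightarrow> t < t0 \<Longrightarrow> d / 2 < \<phi> t / t"
    unfolding eventually_at_right_field by (auto simp: \<phi>0)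
  define c where "c = min (d / 2) (\<phi> (t0 / 2))"
  have c: "c > 0" using d \<phi>pos[of "t0 / 2"] t0(1) by (simp add: c_def)
  show ?thesis
  proof (rule that[OF c])
    fix t :: real assume t: "0 \<le> t" "t \<le> 1"
    show "c * t \<le> \<phi> t"
    proof (cases "t = 0 \<or> t < t0 / 2")
      case True
      show ?thesis
      proof (cases "t = 0")
        case False
        then have "d / 2 < \<phi> t / t" using t0 True t by simp
        then have "d / 2 * t \<le> \<phi> t" using False t by (simp add: pos_less_divide_eq)
        moreover have "c * t \<le> d / 2 * t" using t by (intro mult_right_mono) (auto simp: c_def)
        ultimately show ?thesis by linarith
      qed (simp add: \<phi>0)
    next
      case False
      then have "\<phi> (t0 / 2) \<le> \<phi> t" using t t0(1) by (intro mono_onD[OF mono]) auto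
      moreover have "c * t \<le> c * 1" using t c by (intro mult_left_mono) auto
      moreover have "c \<le> \<phi> (t0 / 2)" by (simp add: c_def)
      ultimately show ?thesis by linarith
    qed
  qed
qed

text \<open>Twice the geometric mean of two energy terms is at most their sum; squaring avoids
  roots. It serves both the gradient of \<open>u\<close> and that of \<open>v\<close>.\<close>

lemma abs_le_of_AM_GM:
  fixes x y z k :: real
  assumes "0 \<le> x" "0 \<le> y" "0 \<le> k" "k\<^sup>2 * z\<^sup>2 \<le> 4 * (x * y)"
  shows "k * \<bar>z\<bar> \<le> x + y"
proof (rule power2_le_imp_le)
  have "(k * \<bar>z\<bar>)\<^sup>2 = k\<^sup>2 * z\<^sup>2" by (simp add: power_mult_distrib)
  also have "\<dots> \<le> 4 * (x * y)" by (rule assms(4))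
  also have "\<dots> \<le> (x + y)\<^sup>2"
  proof -
    have "0 \<le> (x - y)\<^sup>2" by simp
    then show ?thesis by (simp add: power2_eq_square algebra_simps)
  qed
  finally show "(k * \<bar>z\<bar>)\<^sup>2 \<le> (x + y)\<^sup>2" .
qed (use assms in simp)

lemma positive_on_compact_lower_bound:
  fixes \<omega> :: "real \<Rightarrow> real"
  assumes cont: "continuous_on {0..1} \<omega>" and nonneg: "\<forall>t\<in>{0..1}. 0 \<le> \<omega> t"
    and zero: "{t \<in> {0..1}. \<omega> t = 0} = {0}" and d: "0 < d" "d \<le> 1"
  obtains w0 where "w0 > 0" "\<And>s. d \<le> s \<Longrightarrow> s \<le> 1 \<Longrightarrow> w0 \<le> \<omega> s"
proof -
  have "continuous_on {d..1} \<omega>" by (rule continuous_on_subset[OF cont]) (use d in auto)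
  then obtain s0 where s0: "s0 \<in> {d..1}" "\<forall>s\<in>{d..1}. \<omega> s0 \<le> \<omega> s"
    using continuous_attains_inf[of "{d..1}" \<omega>] d by auto
  have "s0 \<notin> {t \<in> {0..1}. \<omega> t = 0}" unfolding zero using s0(1) d by auto
  moreover have "0 \<le> \<omega> s0" using nonneg s0(1) d by auto
  ultimately have "\<omega> s0 > 0" using s0(1) d by (auto simp: order.strict_iff_order)
  then show ?thesis using s0(2) by (intro that[of "\<omega> s0"]) auto
qed

text \<open>If the elastic coefficient is at least \<open>\<phi> 1\<close>, it controls the square
  of \<open>p\<close>. Otherwise it is at least \<open>c * (\<epsilon> * (f t)\<^sup>2)\<close>, and
  its product with the potential term is free of \<epsilon> and proportional to
  \<open>ell t * \<omega> (1 - t) / Q (1 - t)\<close>, which is large near \<open>t = 1\<close>. The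
  summand \<open>r\<close> stands for the gradient term of \<open>v\<close>.\<close>

lemma elastic_energy_controls_gradient:
  fixes ell Q \<omega> \<phi> f :: "real \<Rightarrow> real"
  assumes ell: "continuous_on {0..1} ell" "\<forall>t\<in>{0..1}. 0 \<le> ell t" "ell 1 = 1"
    and Q: "\<forall>t\<in>{0..1}. 0 \<le> Q t" "{t \<in> {0..1}. Q t = 0} = {0}"
    and f: "f = degradation ell Q"
    and \<omega>: "\<forall>t\<in>{0..1}. 0 \<le> \<omega> t" "((\<lambda>t. ereal (sqrt (\<omega> t / Q t))) \<longlongrightarrow> \<infinity>) (at_right 0)"
    and \<phi>: "\<forall>t\<ge>0. 0 \<le> \<phi> t" "mono_on {0..} \<phi>" "(\<phi> \<longlongrightarrow> \<phi>inf) at_top" "{t \<in> {0..}. \<phi> t = 0} = {0}"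
      "(\<phi> has_real_derivative d) (at_right 0)" "d > 0"
    and \<eta>: "\<eta> > 0"
  obtains \<delta> where "0 < \<delta>" "\<delta> < 1" "\<And>\<epsilon> t p r. 0 < \<epsilon> \<Longrightarrow> 1 - \<delta> \<le> t \<Longrightarrow> t \<le> 1 \<Longrightarrow> 0 \<le> r \<Longrightarrow>
    \<bar>p\<bar> \<le> 1 / sqrt (\<phi> 1) * sqrt (elastic_coeff \<phi> \<phi>inf f \<epsilon> t * \<bar>p\<bar>\<^sup>2 + \<omega> (1 - t) / (4 * \<epsilon>) + r)
      + \<eta> * (elastic_coeff \<phi> \<phi>inf f \<epsilon> t * \<bar>p\<bar>\<^sup>2 + \<omega> (1 - t) / (4 * \<epsilon>) + r)"
proof -
  obtain c where c: "c > 0" "\<And>t. 0 \<le> t \<Longrightarrow> t \<le> 1 \<Longrightarrow> c * t \<le> \<phi> t"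
    using right_derivative_linear_lower_bound[OF \<phi>(2,1,4,5,6)] by blast
  have \<phi>1: "\<phi> 1 > 0" using c by (metis less_le_trans mult.right_neutral order_refl zero_le_one)
  have \<phi>inf: "\<phi> 1 \<le> \<phi>inf"
  proof (rule tendsto_lowerbound[OF \<phi>(3)])
    show "\<forall>\<^sub>F t in at_top. \<phi> 1 \<le> \<phi> t"
      using eventually_ge_at_top[of 1] by eventually_elim (auto intro: mono_onD[OF \<phi>(2)])
  qed simp
  \<comment> \<open>Chosen so that \<open>c / 2 * K\<^sup>2 = (1 / \<eta>)\<^sup>2\<close>; the
    factor 1/2 is the lower bound for \<open>ell\<close> near 1.\<close>
  define K where "K = sqrt (2 / c) / \<eta>"
  have K: "K > 0" using c(1) \<eta> by (simp add: K_def)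
  have "\<forall>\<^sub>F t in at_right 0. ereal K < ereal (sqrt (\<omega> t / Q t))"
    by (rule order_tendstoD(1)[OF \<omega>(2)]) simp
  then obtain s0 where s0: "s0 > 0" "\<And>s. 0 < s \<Longrightarrow> s < s0 \<Longrightarrow> K < sqrt (\<omega> s / Q s)"
    unfolding eventually_at_right_field by auto
  obtain s1 where s1: "s1 > 0" "\<And>t. t \<in> {0..1} \<Longrightarrow> dist t 1 < s1 \<Longrightarrow> dist (ell t) (ell 1) < 1 / 2"
    using ell(1) unfolding continuous_on_iff by (metis atLeastAtMost_iff half_gt_zero_iff order_refl zero_le_one zero_less_one)
  define \<delta> where "\<delta> = Min {s0, s1, 1} / 2"
  have \<delta>: "0 < \<delta>" "\<delta> < 1" "\<delta> < s0" "\<delta> < s1" using s0 s1 by (auto simp: \<delta>_def)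
  show ?thesis
  proof (rule that[OF \<delta>(1,2)])
    fix \<epsilon> t p r :: real assume \<epsilon>: "0 < \<epsilon>" and t: "1 - \<delta> \<le> t" "t \<le> 1" and r: "0 \<le> r"
    let ?A = "elastic_coeff \<phi> \<phi>inf f \<epsilon> t"
    define e where "e = ?A * \<bar>p\<bar>\<^sup>2 + \<omega> (1 - t) / (4 * \<epsilon>) + r"
    have t01: "t \<in> {0..1}" "1 - t \<in> {0..1}" using t \<delta> by auto
    have om: "0 \<le> \<omega> (1 - t) / (4 * \<epsilon>)" using \<omega>(1) t01 \<epsilon> by simp
    have big: "\<bar>p\<bar> \<le> 1 / sqrt (\<phi> 1) * sqrt e \<and> 0 \<le> e" if A: "\<phi> 1 \<le> ?A"
    proof -
      have "\<phi> 1 * p\<^sup>2 \<le> ?A * p\<^sup>2" using A by (intro mult_right_mono) auto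
      then have "\<phi> 1 * p\<^sup>2 \<le> e" using om r unfolding e_def by simp
      moreover have "0 \<le> \<phi> 1 * p\<^sup>2" using \<phi>1 by simp
      moreover have "sqrt (\<phi> 1 * p\<^sup>2) = sqrt (\<phi> 1) * \<bar>p\<bar>" by (simp add: real_sqrt_mult)
      ultimately have "sqrt (\<phi> 1) * \<bar>p\<bar> \<le> sqrt e" "0 \<le> e" by (auto dest: real_sqrt_le_mono)
      then show ?thesis using \<phi>1 by (simp add: pos_le_divide_eq mult.commute)
    qed
    have "\<bar>p\<bar> \<le> 1 / sqrt (\<phi> 1) * sqrt e + \<eta> * e"
    \<comment> \<open>The first case contains \<open>t = 1\<close>, where the coefficient is
      \<open>\<phi>inf\<close>. In the second one \<open>\<epsilon> * (f t)\<^sup>2\<close> is at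
      most 1 by monotonicity, so the linear lower bound applies.\<close>
    proof (cases "\<phi> 1 \<le> ?A")
      case True
      from big[OF this] have "\<bar>p\<bar> \<le> 1 / sqrt (\<phi> 1) * sqrt e" "0 \<le> \<eta> * e" using \<eta> by auto
      then show ?thesis by linarith
    next
      case False
      have "t \<noteq> 1" using False \<phi>inf by (auto simp: elastic_coeff_def)
      then have t1: "t < 1" using t by simp
      define s where "s = 1 - t"
      have s: "0 < s" "s < s0" "s \<in> {0..1}" using t1 t \<delta> t01 by (auto simp: s_def)
      have Qs: "Q s > 0"
      proof -
        have "s \<notin> {t \<in> {0..1}. Q t = 0}" unfolding Q(2) using s by simp
        then show ?thesis using Q(1) s by (auto simp: order.strict_iff_order)
      qed
      have "dist (ell t) (ell 1) < 1 / 2" using t01 t \<delta> by (intro s1(2)) (auto simp: dist_real_def)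
      then have ellt: "ell t \<ge> 1 / 2" unfolding dist_real_def ell(3) by linarith
      have f2: "(f t)\<^sup>2 = ell t / Q s" using ellt Qs by (simp add: f degradation_def s_def)
      have f2n: "0 \<le> \<epsilon> * (f t)\<^sup>2" using \<epsilon> by simp
      have A: "?A = \<phi> (\<epsilon> * (f t)\<^sup>2)" using t1 by (simp add: elastic_coeff_def)
      have "\<epsilon> * (f t)\<^sup>2 \<le> 1"
      proof (rule ccontr)
        assume "\<not> \<epsilon> * (f t)\<^sup>2 \<le> 1"
        then have "\<phi> 1 \<le> \<phi> (\<epsilon> * (f t)\<^sup>2)" by (intro mono_onD[OF \<phi>(2)]) auto
        then show False using False A by simp
      qed
      then have Ac: "c * (\<epsilon> * (f t)\<^sup>2) \<le> ?A" unfolding A by (intro c(2) f2n)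
      have K2: "K\<^sup>2 \<le> \<omega> s / Q s"
      proof -
        have nn: "0 \<le> \<omega> s / Q s" using \<omega>(1) s(3) Qs by simp
        have "K\<^sup>2 \<le> (sqrt (\<omega> s / Q s))\<^sup>2" using s0(2)[OF s(1,2)] K by (intro power_mono) auto
        then show ?thesis using nn by simp
      qed
      have "1 / \<eta> * \<bar>p\<bar> \<le> c * (\<epsilon> * (f t)\<^sup>2) * p\<^sup>2 + \<omega> s / (4 * \<epsilon>)"
      proof (rule abs_le_of_AM_GM)
        show "0 \<le> c * (\<epsilon> * (f t)\<^sup>2) * p\<^sup>2" using c(1) \<epsilon> by simp
        show "0 \<le> \<omega> s / (4 * \<epsilon>)" using om by (simp add: s_def)
        have "(1 / \<eta>)\<^sup>2 = c / 2 * K\<^sup>2" using c(1) \<eta> by (simp add: K_def power_divide)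
        also have "\<dots> \<le> c / 2 * (\<omega> s / Q s)" using K2 c(1) by (intro mult_left_mono) auto
        also have "\<dots> = c * (1 / 2) * (\<omega> s / Q s)" by simp
        also have "\<dots> \<le> c * ell t * (\<omega> s / Q s)"
          using ellt c(1) \<omega>(1) s(3) Qs by (intro mult_right_mono mult_left_mono) auto
        also have "\<dots> = c * (f t)\<^sup>2 * \<omega> s" by (simp add: f2)
        finally have "(1 / \<eta>)\<^sup>2 * p\<^sup>2 \<le> c * (f t)\<^sup>2 * \<omega> s * p\<^sup>2" by (rule mult_right_mono) simp
        also have "\<dots> = 4 * (c * (\<epsilon> * (f t)\<^sup>2) * p\<^sup>2 * (\<omega> s / (4 * \<epsilon>)))" using \<epsilon> by simp
        finally show "(1 / \<eta>)\<^sup>2 * p\<^sup>2 \<le> 4 * (c * (\<epsilon> * (f t)\<^sup>2) * p\<^sup>2 * (\<omega> s / (4 * \<epsilon>)))" .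
      qed (use \<eta> in simp)
      also have "c * (\<epsilon> * (f t)\<^sup>2) * p\<^sup>2 \<le> ?A * p\<^sup>2" using Ac by (intro mult_right_mono) auto
      finally have "1 / \<eta> * \<bar>p\<bar> \<le> e" using r by (simp add: e_def s_def)
      then have "\<bar>p\<bar> \<le> \<eta> * e" using \<eta> by (simp add: pos_divide_le_eq mult.commute)
      moreover have "0 \<le> e"
      proof -
        have "0 \<le> 1 / \<eta> * \<bar>p\<bar>" using \<eta> by simp
        then show ?thesis using \<open>1 / \<eta> * \<bar>p\<bar> \<le> e\<close> by linarith
      qed
      then have "0 \<le> 1 / sqrt (\<phi> 1) * sqrt e" using \<phi>1 by simp
      ultimately show ?thesis by linarith
    qed
    then show "\<bar>p\<bar> \<le> 1 / sqrt (\<phi> 1) * sqrt (?A * \<bar>p\<bar>\<^sup>2 + \<omega> (1 - t) / (4 * \<epsilon>) + r)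
      + \<eta> * (?A * \<bar>p\<bar>\<^sup>2 + \<omega> (1 - t) / (4 * \<epsilon>) + r)" unfolding e_def .
  qed
qed

text \<open>Vitali's convergence theorem: the integral is split according to whether
  \<open>f k\<close> is within \<eta> of \<open>w\<close> or not. The measure of the bad set
  \<open>A k\<close> tends to 0 by dominated convergence, and equi-integrability disposes of
  \<open>f k\<close> on it.\<close>

lemma equi_integrable_L1_convergence:
  assumes fin: "finite_measure M" and f: "\<And>k. integrable M (f k)" and w: "integrable M w"
    and conv: "AE x in M. (\<lambda>k. f k x) \<longlonglongrightarrow> w x"
    and equi: "equi_integrable M S" "\<And>k. f k \<in> S"
  shows "(\<lambda>k. LINT x|M. \<bar>f k x - w x\<bar>) \<longlonglongrightarrow> 0"
proof (rule LIMSEQ_I)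
  interpret finite_measure M by fact
  fix \<epsilon> :: real assume \<epsilon>: "\<epsilon> > 0"
  define \<eta> where "\<eta> = \<epsilon> / (4 * (measure M (space M) + 1))"
  have m1: "measure M (space M) + 1 > 0" using measure_nonneg[of M "space M"] by linarith
  have \<eta>: "\<eta> > 0" using \<epsilon> m1 by (simp add: \<eta>_def)
  have \<eta>m: "\<eta> * measure M (space M) \<le> \<epsilon> / 4"
  proof -
    have cancel: "\<epsilon> / (4 * K) * K = \<epsilon> / 4" if "K > 0" for K using that by simp
    have "\<eta> * (measure M (space M) + 1) = \<epsilon> / 4" unfolding \<eta>_def by (rule cancel[OF m1])
    moreover have "\<eta> * measure M (space M) \<le> \<eta> * (measure M (space M) + 1)" using \<eta> by simp
    ultimately show ?thesis by linarith
  qed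
  have "\<epsilon> / 4 > 0" using \<epsilon> by simp
  then obtain \<delta> where \<delta>: "\<delta> > 0"
    "\<And>g A. g \<in> S \<Longrightarrow> A \<in> sets M \<Longrightarrow> emeasure M A < ennreal \<delta> \<Longrightarrow> (LINT x:A|M. \<bar>g x\<bar>) < \<epsilon> / 4"
    using equi(1) unfolding equi_integrable_def by metis
  define A where "A k = {x \<in> space M. \<eta> < \<bar>f k x - w x\<bar>}" for k
  have [measurable]: "f k \<in> borel_measurable M" "w \<in> borel_measurable M" for k
    using f w by auto
  have A[measurable]: "A k \<in> sets M" for k unfolding A_def by measurable
  have ind0: "AE x in M. (\<lambda>k. indicator (A k) x :: real) \<longlonglongrightarrow> 0"
    using conv
  proof eventually_elim
    case (elim x)
    then have "(\<lambda>k. \<bar>f k x - w x\<bar>) \<longlonglongrightarrow> \<bar>w x - w x\<bar>" by (intro tendsto_intros)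
    then have "\<forall>\<^sub>F k in sequentially. \<bar>f k x - w x\<bar> < \<eta>"
      using \<eta> by (intro order_tendstoD(2)) auto
    then have "\<forall>\<^sub>F k in sequentially. indicator (A k) x = (0::real)"
      by eventually_elim (auto simp: A_def indicator_def)
    then show ?case by (rule tendsto_eventually)
  qed
  have "(\<lambda>k. LINT x|M. indicator (A k) x) \<longlonglongrightarrow> (LINT x|M. 0 :: real)"
    by (rule integral_dominated_convergence[where w="\<lambda>_. 1"]) (use ind0 in \<open>auto simp: indicator_def\<close>)
  then have "(\<lambda>k. measure M (A k)) \<longlonglongrightarrow> 0" by simp
  then have ev1: "\<forall>\<^sub>F k in sequentially. measure M (A k) < \<delta>" using \<delta>(1) by (rule order_tendstoD)
  \<comment> \<open>\<open>w\<close> need not belong to \<open>S\<close>, so its integral over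
    \<open>A k\<close> is handled by dominated convergence.\<close>
  have "(\<lambda>k. LINT x|M. \<bar>w x\<bar> * indicator (A k) x) \<longlonglongrightarrow> (LINT x|M. 0 :: real)"
  proof (rule integral_dominated_convergence[where w="\<lambda>x. \<bar>w x\<bar>"])
    show "AE x in M. (\<lambda>k. \<bar>w x\<bar> * indicator (A k) x) \<longlonglongrightarrow> 0"
      using ind0 by eventually_elim (auto intro: tendsto_mult_right_zero)
  qed (use w in \<open>auto simp: indicator_def\<close>)
  then have "(\<lambda>k. LINT x|M. \<bar>w x\<bar> * indicator (A k) x) \<longlonglongrightarrow> 0" by simp
  then have ev2: "\<forall>\<^sub>F k in sequentially. (LINT x|M. \<bar>w x\<bar> * indicator (A k) x) < \<epsilon> / 4"
    using \<open>\<epsilon> / 4 > 0\<close> by (rule order_tendstoD)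
  have "\<forall>\<^sub>F k in sequentially. norm ((LINT x|M. \<bar>f k x - w x\<bar>) - 0) < \<epsilon>"
    using ev1 ev2
  proof eventually_elim
    case (elim k)
    have int_ind: "integrable M (\<lambda>x. \<bar>h x\<bar> * indicator (A k) x)" if "integrable M h" for h :: "_ \<Rightarrow> real"
    proof -
      have "integrable M (\<lambda>x. indicator (A k) x *\<^sub>R \<bar>h x\<bar>)"
        using A that by (intro integrable_mult_indicator integrable_abs)
      then show ?thesis by (simp add: mult.commute)
    qed
    have "emeasure M (A k) < ennreal \<delta>" using elim(1) \<delta>(1) by (simp add: emeasure_eq_measure ennreal_less_iff)
    then have "(LINT x:A k|M. \<bar>f k x\<bar>) < \<epsilon> / 4" by (intro \<delta>(2) equi(2) A)
    then have fA: "(LINT x|M. \<bar>f k x\<bar> * indicator (A k) x) < \<epsilon> / 4"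
      by (simp add: set_lebesgue_integral_def mult.commute)
    have "(LINT x|M. \<bar>f k x - w x\<bar>) \<le> (LINT x|M. \<eta> + \<bar>f k x\<bar> * indicator (A k) x + \<bar>w x\<bar> * indicator (A k) x)"
    proof (rule integral_mono)
      show "integrable M (\<lambda>x. \<bar>f k x - w x\<bar>)" using f w by simp
      show "integrable M (\<lambda>x. \<eta> + \<bar>f k x\<bar> * indicator (A k) x + \<bar>w x\<bar> * indicator (A k) x)"
        by (intro Bochner_Integration.integrable_add int_ind f w integrable_const)
      fix x assume "x \<in> space M"
      then show "\<bar>f k x - w x\<bar> \<le> \<eta> + \<bar>f k x\<bar> * indicator (A k) x + \<bar>w x\<bar> * indicator (A k) x"
        using \<eta> by (cases "x \<in> A k") (auto simp: A_def)
    qed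
    also have "\<dots> = \<eta> * measure M (space M) + (LINT x|M. \<bar>f k x\<bar> * indicator (A k) x)
        + (LINT x|M. \<bar>w x\<bar> * indicator (A k) x)"
      using int_ind[OF f] int_ind[OF w] by (simp add: mult.commute)
    finally have "(LINT x|M. \<bar>f k x - w x\<bar>) < \<epsilon>" using elim(2) fA \<eta>m \<epsilon> by linarith
    moreover have "0 \<le> (LINT x|M. \<bar>f k x - w x\<bar>)" by simp
    ultimately show ?case by simp
  qed
  then show "\<exists>N. \<forall>k\<ge>N. norm ((LINT x|M. \<bar>f k x - w x\<bar>) - 0) < \<epsilon>"
    by (simp add: eventually_sequentially)
qed

text \<open>The coefficient is continuous on \<open>{0..<1}\<close>, where \<open>Q (1 - t)\<close>
  does not vanish. The constant value outside agrees with it at \<open>t = 1\<close> by definition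
  of \<open>elastic_coeff\<close>.\<close>

lemma borel_measurable_elastic_coeff:
  assumes ell: "continuous_on {0..1} ell"
    and Q: "continuous_on {0..1} Q" "{t \<in> {0..1}. Q t = 0} = {0}"
    and f: "f = degradation ell Q"
    and \<phi>: "continuous_on {0..} \<phi>" and nonneg: "\<forall>t\<in>{0..1}. 0 \<le> ell t" "\<forall>t\<in>{0..1}. 0 \<le> Q t"
    and \<epsilon>: "0 < \<epsilon>"
  shows "(\<lambda>t. if t \<in> {0..<1} then elastic_coeff \<phi> \<phi>inf f \<epsilon> t else \<phi>inf) \<in> borel_measurable borel"
proof -
  have "continuous_on {0..<1} (\<lambda>t. ell t / Q (1 - t))"
  proof (intro continuous_on_divide)
    show "continuous_on {0..<1} ell" by (rule continuous_on_subset[OF ell]) auto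
    show "continuous_on {0..<1} (\<lambda>t. Q (1 - t))"
      by (rule continuous_on_compose2[OF Q(1)]) (auto intro!: continuous_intros)
    show "\<forall>t\<in>{0..<1}. Q (1 - t) \<noteq> 0"
    proof
      fix t :: real assume "t \<in> {0..<1}"
      then have "1 - t \<notin> {t \<in> {0..1}. Q t = 0}" "1 - t \<in> {0..1}" unfolding Q(2) by auto
      then show "Q (1 - t) \<noteq> 0" by simp
    qed
  qed
  then have "continuous_on {0..<1} f"
    unfolding f degradation_def by (rule continuous_on_real_sqrt)
  then have "continuous_on {0..<1} (\<lambda>t. \<epsilon> * (f t)\<^sup>2)"
    by (intro continuous_on_mult continuous_on_const continuous_on_power)
  then have "continuous_on {0..<1} (\<lambda>t. \<phi> (\<epsilon> * (f t)\<^sup>2))"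
    by (rule continuous_on_compose2[OF \<phi>]) (use \<epsilon> in auto)
  then have "continuous_on {0..<1} (elastic_coeff \<phi> \<phi>inf f \<epsilon>)"
    by (rule continuous_on_eq) (auto simp: elastic_coeff_def)
  then show ?thesis
    by (intro borel_measurable_continuous_on_if) (auto intro: continuous_on_const)
qed

text \<open>By continuity a violation at one point would persist on a nonempty open set, which is
  not null.\<close>

lemma closed_range_of_AE:
  fixes V :: "real \<Rightarrow> real"
  assumes cont: "continuous_on {a<..<b} V" and S: "closed S" and ae: "AE x in lebesgue_on {a<..<b}. V x \<in> S"
    and x: "x \<in> {a<..<b}"
  shows "V x \<in> S"
proof (rule ccontr)
  assume "V x \<notin> S"
  have "open ({a<..<b} \<inter> V -` (- S))"
    by (rule continuous_open_preimage[OF cont]) (use S in auto)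
  moreover have "x \<in> {a<..<b} \<inter> V -` (- S)" using x \<open>V x \<notin> S\<close> by simp
  ultimately have "\<not> negligible ({a<..<b} \<inter> V -` (- S))" using open_not_negligible by blast
  moreover have "negligible ({a<..<b} \<inter> V -` (- S))"
  proof -
    have "AE x in lebesgue. x \<in> {a<..<b} \<longrightarrow> V x \<in> S" using ae by (subst (asm) AE_restrict_space_iff) auto
    then have "negligible {x. \<not> (x \<in> {a<..<b} \<longrightarrow> V x \<in> S)}" by (simp only: eventually_ae_filter_negligible) (meson mem_Collect_eq negligible_subset subsetI)
    moreover have "{x. \<not> (x \<in> {a<..<b} \<longrightarrow> V x \<in> S)} = {a<..<b} \<inter> V -` (- S)" by auto
    ultimately show ?thesis by simp
  qed
  ultimately show False by contradiction
qed

lemma H1_representative: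
  assumes ab: "a < b" and u: "u \<in> H1 {a<..<b}"
  obtains k where "AE x in lebesgue_on {a<..<b}. u x = k + primitive (lebesgue_on {a<..<b}) (weak_deriv {a<..<b} u) x"
    "weak_deriv {a<..<b} u \<in> L2 {a<..<b}"
proof -
  have "\<exists>g. g \<in> L2 {a<..<b} \<and> is_weak_deriv {a<..<b} u g" using u by (auto simp: H1_def)
  then have wd: "weak_deriv {a<..<b} u \<in> L2 {a<..<b} \<and> is_weak_deriv {a<..<b} u (weak_deriv {a<..<b} u)"
    unfolding weak_deriv_def by (rule someI_ex)
  moreover have "u \<in> L2 {a<..<b}" using u by (simp add: H1_def)
  ultimately obtain k where "AE x in lebesgue_on {a<..<b}. u x = k + primitive (lebesgue_on {a<..<b}) (weak_deriv {a<..<b} u) x"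
    using weak_deriv_primitive[OF ab] by blast
  with wd show ?thesis by (intro that) auto
qed

text \<open>The continuous representatives replace \<open>u\<close> and \<open>v\<close>, and the
  bound on the extended integral becomes integrability of a real energy density. Everything is
  packed into one existential statement, so that a single choice over the index later yields all the
  sequences.\<close>

lemma phase_field_energy_representation:
  fixes ell Q \<omega> \<phi> f :: "real \<Rightarrow> real"
  assumes ab: "a < b"
    and ell: "continuous_on {0..1} ell" "\<forall>t\<in>{0..1}. 0 \<le> ell t"
    and Q: "continuous_on {0..1} Q" "\<forall>t\<in>{0..1}. 0 \<le> Q t" "{t \<in> {0..1}. Q t = 0} = {0}"
    and f: "f = degradation ell Q"
    and \<omega>: "continuous_on {0..1} \<omega>" "\<forall>t\<in>{0..1}. 0 \<le> \<omega> t"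
    and \<phi>: "continuous_on {0..} \<phi>" "\<forall>t\<ge>0. 0 \<le> \<phi> t" "0 < \<phi>inf"
    and \<epsilon>: "0 < \<epsilon>" and C: "0 \<le> C"
    and energy: "phase_field_energy {a<..<b} \<phi> \<phi>inf f \<omega> \<epsilon> u v \<le> ennreal C"
  shows "\<exists>U V gu gv e. gu \<in> L2 {a<..<b} \<and> gv \<in> L2 {a<..<b} \<and>
    integrable (lebesgue_on {a<..<b}) e \<and> (LINT x|lebesgue_on {a<..<b}. e x) \<le> C \<and>
    (\<forall>x y. U y - U x = primitive (lebesgue_on {a<..<b}) gu y - primitive (lebesgue_on {a<..<b}) gu x) \<and>
    (\<forall>x y. V y - V x = primitive (lebesgue_on {a<..<b}) gv y - primitive (lebesgue_on {a<..<b}) gv x) \<and>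
    integrable (lebesgue_on {a<..<b}) U \<and>
    (AE x in lebesgue_on {a<..<b}. u x = U x) \<and> (AE x in lebesgue_on {a<..<b}. v x = V x) \<and>
    (\<forall>x\<in>{a<..<b}. V x \<in> {0..1}) \<and>
    (\<forall>x\<in>{a<..<b}. e x = elastic_coeff \<phi> \<phi>inf f \<epsilon> (V x) * \<bar>gu x\<bar>\<^sup>2 + \<omega> (1 - V x) / (4 * \<epsilon>) + \<epsilon> * \<bar>gv x\<bar>\<^sup>2) \<and>
    (\<forall>x\<in>{a<..<b}. 0 \<le> elastic_coeff \<phi> \<phi>inf f \<epsilon> (V x) * \<bar>gu x\<bar>\<^sup>2) \<and>
    (\<forall>x\<in>{a<..<b}. 0 \<le> \<omega> (1 - V x) / (4 * \<epsilon>))"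
proof -
  let ?L = "lebesgue_on {a<..<b}"
  interpret L: finite_measure ?L by (rule finite_measure_lebesgue_on_Ioo)
  have H: "u \<in> H1 {a<..<b} \<and> v \<in> H1 {a<..<b} \<and> (AE x in ?L. v x \<in> {0..1})"
  proof (rule ccontr)
    assume "\<not> ?thesis"
    then have "phase_field_energy {a<..<b} \<phi> \<phi>inf f \<omega> \<epsilon> u v = \<infinity>"
      unfolding phase_field_energy_def by (rule if_not_P)
    then show False using energy by (simp add: top_unique)
  qed
  define gu where "gu = weak_deriv {a<..<b} u"
  define gv where "gv = weak_deriv {a<..<b} v"
  obtain ku where ku: "AE x in ?L. u x = ku + primitive ?L gu x" "gu \<in> L2 {a<..<b}"
    using H1_representative[OF ab] H unfolding gu_def by blast
  obtain kv where kv: "AE x in ?L. v x = kv + primitive ?L gv x" "gv \<in> L2 {a<..<b}"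
    using H1_representative[OF ab] H unfolding gv_def by blast
  define U where "U x = ku + primitive ?L gu x" for x
  define V where "V x = kv + primitive ?L gv x" for x
  have gui: "integrable ?L gu" and gvi: "integrable ?L gv" using ku(2) kv(2) by (auto intro: L2_imp_integrable)
  have prim_meas: "primitive ?L g \<in> borel_measurable borel" if "integrable ?L g" for g
    by (rule borel_measurable_primitive[OF L.sigma_finite_measure_axioms that measurable_ident_lebesgue_on])
  have to_L: "h \<in> borel_measurable ?L" if "h \<in> borel_measurable borel" for h :: "real \<Rightarrow> real"
    by (intro measurable_restrict_space1 measurable_completion) (use that in simp)
  have V_borel: "V \<in> borel_measurable borel" unfolding V_def using prim_meas[OF gvi] by measurable
  have V_cont: "continuous_on {a<..<b} V"
    unfolding V_def
    by (intro continuous_intros continuous_at_imp_continuous_on ballI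
        isCont_primitive[OF gvi measurable_ident_lebesgue_on] AE_lebesgue_on_neq)
  have vV: "AE x in ?L. v x = V x" using kv(1) by (simp add: V_def)
  have V01: "V x \<in> {0..1}" if x: "x \<in> {a<..<b}" for x
  proof (rule closed_range_of_AE[OF V_cont _ _ x])
    have "AE x in ?L. v x \<in> {0..1}" using H by blast
    with vV show "AE x in ?L. V x \<in> {0..1}" by eventually_elim simp
  qed simp
  define e where "e x = elastic_coeff \<phi> \<phi>inf f \<epsilon> (V x) * \<bar>gu x\<bar>\<^sup>2 + \<omega> (1 - V x) / (4 * \<epsilon>) + \<epsilon> * \<bar>gv x\<bar>\<^sup>2" for x
  have nn1: "0 \<le> elastic_coeff \<phi> \<phi>inf f \<epsilon> (V x) * \<bar>gu x\<bar>\<^sup>2" for x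
    using \<phi>(2,3) \<epsilon> by (auto simp: elastic_coeff_def intro!: mult_nonneg_nonneg)
  have nn2: "0 \<le> \<omega> (1 - V x) / (4 * \<epsilon>)" if "x \<in> {a<..<b}" for x
    using \<omega>(2) V01[OF that] \<epsilon> by auto
  have e_nn: "0 \<le> e x" if "x \<in> {a<..<b}" for x
    using nn1[of x] nn2[OF that] \<epsilon> by (simp add: e_def)
  have e_meas: "e \<in> borel_measurable ?L"
  proof -
    \<comment> \<open>The coefficient and \<omega> are regular on parts of \<open>{0..1}\<close>
      only; extended to the whole line they can be composed with the Borel function
      \<open>V\<close>.\<close>
    let ?h = "\<lambda>t. if t \<in> {0..<1} then elastic_coeff \<phi> \<phi>inf f \<epsilon> t else \<phi>inf"
    let ?k = "\<lambda>s. if s \<in> {0..1} then \<omega> s else 0"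
    have h: "?h \<in> borel_measurable borel"
      by (rule borel_measurable_elastic_coeff[OF ell(1) Q(1,3) f \<phi>(1) ell(2) Q(2) \<epsilon>])
    have k: "?k \<in> borel_measurable borel"
      by (intro borel_measurable_continuous_on_if \<omega>(1)) auto
    have 1: "(\<lambda>x. ?h (V x)) \<in> borel_measurable ?L"
      by (rule to_L) (rule measurable_compose[OF V_borel h])
    have 2: "(\<lambda>x. ?k (1 - V x)) \<in> borel_measurable ?L"
      by (rule to_L, rule measurable_compose[OF _ k]) (use V_borel in measurable)
    have 3: "gu \<in> borel_measurable ?L" "gv \<in> borel_measurable ?L" using gui gvi by auto
    have "(\<lambda>x. ?h (V x) * \<bar>gu x\<bar>\<^sup>2 + ?k (1 - V x) / (4 * \<epsilon>) + \<epsilon> * \<bar>gv x\<bar>\<^sup>2) \<in> borel_measurable ?L"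
      using 1 2 3 by (intro borel_measurable_add borel_measurable_times borel_measurable_divide
          borel_measurable_power borel_measurable_abs borel_measurable_const)
    moreover have "?h (V x) * \<bar>gu x\<bar>\<^sup>2 + ?k (1 - V x) / (4 * \<epsilon>) + \<epsilon> * \<bar>gv x\<bar>\<^sup>2 = e x" if "x \<in> space ?L" for x
    proof -
      have x: "V x \<in> {0..1}" using V01[of x] that by simp
      then have "?h (V x) = elastic_coeff \<phi> \<phi>inf f \<epsilon> (V x)" by (auto simp: elastic_coeff_def)
      moreover have "?k (1 - V x) = \<omega> (1 - V x)" using x by auto
      ultimately show ?thesis by (simp add: e_def)
    qed
    ultimately show ?thesis by (rule measurable_cong[THEN iffD1, rotated])
  qed
  have "(\<integral>\<^sup>+x. ennreal (e x) \<partial>?L) = phase_field_energy {a<..<b} \<phi> \<phi>inf f \<omega> \<epsilon> u v"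
  proof -
    have "phase_field_energy {a<..<b} \<phi> \<phi>inf f \<omega> \<epsilon> u v = (\<integral>\<^sup>+x. ennreal (elastic_coeff \<phi> \<phi>inf f \<epsilon> (v x) * \<bar>gu x\<bar>\<^sup>2
              + \<omega> (1 - v x) / (4 * \<epsilon>) + \<epsilon> * \<bar>gv x\<bar>\<^sup>2) \<partial>?L)"
      unfolding phase_field_energy_def gu_def gv_def using H by (rule if_P)
    also have "\<dots> = (\<integral>\<^sup>+x. ennreal (e x) \<partial>?L)"
      by (rule nn_integral_cong_AE) (use vV in \<open>eventually_elim, simp add: e_def\<close>)
    finally show ?thesis by simp
  qed
  then have nn_e: "(\<integral>\<^sup>+x. ennreal (e x) \<partial>?L) \<le> ennreal C" using energy by simp
  have e_int: "integrable ?L e"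
  proof (rule integrableI_nonneg[OF e_meas])
    show "AE x in ?L. 0 \<le> e x" using e_nn by (intro AE_I2) simp
    show "(\<integral>\<^sup>+x. ennreal (e x) \<partial>?L) < \<infinity>" using nn_e by (rule le_less_trans) simp
  qed
  have "ennreal (LINT x|?L. e x) = (\<integral>\<^sup>+x. ennreal (e x) \<partial>?L)"
    by (rule nn_integral_eq_integral[OF e_int, symmetric]) (use e_nn in \<open>auto intro!: AE_I2\<close>)
  then have "ennreal (LINT x|?L. e x) \<le> ennreal C" using nn_e by simp
  then have e_le: "(LINT x|?L. e x) \<le> C" using C by (simp add: ennreal_le_iff)
  have U_int: "integrable ?L U"
  proof (rule L.integrable_const_bound)
    show "U \<in> borel_measurable ?L" unfolding U_def using prim_meas[OF gui] by (intro to_L) measurable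
    show "AE x in ?L. norm (U x) \<le> \<bar>ku\<bar> + (LINT t|?L. \<bar>gu t\<bar>)"
    proof (rule AE_I2)
      fix x show "norm (U x) \<le> \<bar>ku\<bar> + (LINT t|?L. \<bar>gu t\<bar>)"
        using abs_primitive_le[OF gui measurable_ident_lebesgue_on, of x] unfolding U_def real_norm_def by linarith
    qed
  qed
  have uU: "AE x in ?L. u x = U x" using ku(1) by (simp add: U_def)
  show ?thesis
    by (rule exI[of _ U], rule exI[of _ V], rule exI[of _ gu], rule exI[of _ gv], rule exI[of _ e])
       (intro conjI ku(2) kv(2) e_int e_le U_int uU vV allI ballI V01 nn1 nn2; simp add: U_def V_def e_def)
qed

lemma controlled_oscillation_truncate:
  assumes "controlled_oscillation \<mu> a b c\<^sub>0 w"
  shows "controlled_oscillation \<mu> a b c\<^sub>0 (\<lambda>x. max (- N) (min N (w x)))"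
proof -
  interpret controlled_oscillation \<mu> a b c\<^sub>0 w by fact
  have trunc: "\<bar>max (- N) (min N s) - max (- N) (min N t)\<bar> \<le> \<bar>s - t\<bar>" for s t :: real
    by (auto simp: max_def min_def)
  show ?thesis
  proof (rule controlled_oscillation.intro[OF ab fin sets_mu c0])
    fix \<eta> :: real assume "\<eta> > 0"
    from key[OF this] obtain \<kappa> where \<kappa>: "\<kappa> > 0" "\<forall>x y. a < x \<longrightarrow> x < y \<longrightarrow> y < b \<longrightarrow> measure \<mu> {x} = 0 \<longrightarrow>
      measure \<mu> {y} = 0 \<longrightarrow> (\<forall>z\<in>{x<..<y}. measure \<mu> {z} < \<kappa>) \<longrightarrow>
      \<bar>w y - w x\<bar> \<le> c\<^sub>0 * sqrt ((y - x) * measure \<mu> {x<..<y}) + \<eta> * measure \<mu> {x<..<y}" by auto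
    then show "\<exists>\<kappa>>0. \<forall>x y. a < x \<longrightarrow> x < y \<longrightarrow> y < b \<longrightarrow> measure \<mu> {x} = 0 \<longrightarrow>
      measure \<mu> {y} = 0 \<longrightarrow> (\<forall>z\<in>{x<..<y}. measure \<mu> {z} < \<kappa>) \<longrightarrow>
      \<bar>max (- N) (min N (w y)) - max (- N) (min N (w x))\<bar>
        \<le> c\<^sub>0 * sqrt ((y - x) * measure \<mu> {x<..<y}) + \<eta> * measure \<mu> {x<..<y}"
      using trunc order.trans by (intro exI[of _ \<kappa>]) blast
  qed
qed

lemma (in controlled_oscillation) SBV:
  assumes "open V" "V \<subseteq> {a<..<b}"
  shows "w \<in> SBV V"
proof -
  obtain u\<^sub>0 g where g: "g \<in> L2 {a<..<b}"
    "\<And>x. x \<in> G \<Longrightarrow> w x = u\<^sub>0 + primitive (lebesgue_on {a<..<b}) g x + primitive (count_space D) jump x"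
    using representation by blast
  show ?thesis
  proof (rule SBV_of_representation[OF ab countable_D _ L2_imp_integrable[OF g(1)] integrable_jump assms])
    show "D \<subseteq> {a<..<b}" by (auto simp: D_def)
    fix x assume "x \<in> {a<..<b} - D"
    then show "w x = u\<^sub>0 + primitive (lebesgue_on {a<..<b}) g x + primitive (count_space D) jump x"
      by (intro g(2)) (auto simp: G_def D_def)
  qed
qed

lemma (in controlled_oscillation) approx_gradient:
  obtains g where "g \<in> L2 {a<..<b}" "is_approx_gradient {a<..<b} w g"
proof -
  obtain u\<^sub>0 g where g: "g \<in> L2 {a<..<b}"
    "\<And>x. x \<in> G \<Longrightarrow> w x = u\<^sub>0 + primitive (lebesgue_on {a<..<b}) g x + primitive (count_space D) jump x"
    using representation by blast
  define F where "F x = u\<^sub>0 + primitive (lebesgue_on {a<..<b}) g x + primitive (count_space D) jump x" for x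
  obtain N1 where N1: "negligible N1"
    "\<And>x. x \<in> {a<..<b} - N1 \<Longrightarrow> (primitive (lebesgue_on {a<..<b}) g has_real_derivative g x) (at x)"
    using primitive_deriv_AE[OF L2_imp_integrable[OF g(1)]] by blast
  obtain N2 where N2: "negligible N2"
    "\<And>x. x \<notin> N2 \<Longrightarrow> (primitive (count_space D) jump has_real_derivative 0) (at x)"
    using jump_function_deriv_zero[OF countable_D integrable_jump] by blast
  have der: "has_approx_deriv {a<..<b} w x (g x)" if x: "x \<in> {a<..<b}" "x \<notin> N1 \<union> N2" for x
  proof (rule has_approx_derivI[OF negligible_of_countable[OF countable_D]])
    show "w y = F y" if "y \<in> {a<..<b} - D" for y
      unfolding F_def by (rule g(2)) (use that in \<open>auto simp: G_def D_def\<close>)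
    have "(F has_real_derivative 0 + g x + 0) (at x)"
      unfolding F_def by (intro DERIV_add DERIV_const N1(2) N2(2)) (use x in auto)
    then show "(F has_real_derivative g x) (at x)" by simp
  qed
  have "AE x in lebesgue. x \<notin> N1 \<union> N2"
    by (rule AE_not_in[OF iffD1[OF negligible_iff_null_sets negligible_Un[OF N1(1) N2(1)]]])
  then have "AE x in lebesgue. x \<in> {a<..<b} \<longrightarrow> has_approx_deriv {a<..<b} w x (g x)"
    by eventually_elim (use der in blast)
  then have "is_approx_gradient {a<..<b} w g"
    unfolding is_approx_gradient_def by (subst AE_restrict_space_iff) auto
  with g(1) show ?thesis by (rule that)
qed

theorem theorem3p6:
  fixes a b :: real and \<Omega> :: "real set"
    and ell Q \<omega> \<phi> f :: "real \<Rightarrow> real" and \<phi>inf :: real and sbar :: ereal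
    and u v :: "real \<Rightarrow> real \<Rightarrow> real"
  assumes "a < b" and "\<Omega> = {a<..<b}"
    and "continuous_on {0..1} ell" and "\<forall>t\<in>{0..1}. 0 \<le> ell t"
    and "continuous_on {0..1} Q" and "\<forall>t\<in>{0..1}. 0 \<le> Q t"
    and "ell 1 = 1"
    and "{t \<in> {0..1}. ell t = 0} = {0}" and "{t \<in> {0..1}. Q t = 0} = {0}"
    and "\<exists>\<delta>\<in>{0<..1}. mono_on {0..\<delta>} Q"
    and "f = degradation ell Q"
    and "\<exists>\<delta>\<in>{0<..1}. mono_on {1 - \<delta>..<1} f"
    and "continuous_on {0..1} \<omega>" and "\<forall>t\<in>{0..1}. 0 \<le> \<omega> t"
    and "{t \<in> {0..1}. \<omega> t = 0} = {0}"
    and "((\<lambda>t. ereal (sqrt (\<omega> t / Q t))) \<longlongrightarrow> sbar) (at_right 0)"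
    and "continuous_on {0..} \<phi>" and "\<forall>t\<ge>0. 0 \<le> \<phi> t" and "mono_on {0..} \<phi>"
    and "(\<phi> \<longlongrightarrow> \<phi>inf) at_top" and "0 < \<phi>inf"
    and "{t \<in> {0..}. \<phi> t = 0} = {0}"
    and "\<exists>d>0. (\<phi> has_real_derivative d) (at_right 0)"
    and "sbar = \<infinity>"
    and "\<forall>\<epsilon>>0. u \<epsilon> \<in> L1 \<Omega> \<and> v \<epsilon> \<in> L1 \<Omega>"
    and "(SUP \<epsilon>\<in>{0<..}. phase_field_energy \<Omega> \<phi> \<phi>inf f \<omega> \<epsilon> (u \<epsilon>) (v \<epsilon>)
            + ennreal (L1_norm \<Omega> (u \<epsilon>))) < \<infinity>"
  shows "\<exists>(e :: nat \<Rightarrow> real) w.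
      (\<forall>k. 0 < e k) \<and> e \<longlonglongrightarrow> 0 \<and>
      w \<in> L1 \<Omega> \<and> w \<in> GSBV \<Omega> \<and> (\<exists>w'\<in>L2 \<Omega>. is_approx_gradient \<Omega> w w') \<and>
      (AE x in lebesgue_on \<Omega>. (\<lambda>k. u (e k) x) \<longlonglongrightarrow> w x \<and> (\<lambda>k. v (e k) x) \<longlonglongrightarrow> 1) \<and>
      (equi_integrable (lebesgue_on \<Omega>) (u ` {0<..}) \<longrightarrow>
        (\<lambda>k. L1_norm \<Omega> (\<lambda>x. u (e k) x - w x)) \<longlonglongrightarrow> 0)"
proof -
  let ?L = "lebesgue_on {a<..<b}"
  note A = assms[unfolded \<open>\<Omega> = {a<..<b}\<close> \<open>sbar = \<infinity>\<close>]
  obtain d where d: "d > 0" "(\<phi> has_real_derivative d) (at_right 0)" using assms(23) by blast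
  have \<phi>1: "\<phi> 1 > 0"
  proof -
    have "1 \<notin> {t \<in> {0..}. \<phi> t = 0}" unfolding assms(22) by simp
    then show ?thesis using assms(18) by (auto simp: order.strict_iff_order)
  qed
  interpret L: finite_measure ?L by (rule finite_measure_lebesgue_on_Ioo)
  define C0 where "C0 = (SUP \<epsilon>\<in>{0<..}. phase_field_energy {a<..<b} \<phi> \<phi>inf f \<omega> \<epsilon> (u \<epsilon>) (v \<epsilon>)
            + ennreal (L1_norm {a<..<b} (u \<epsilon>)))"
  define C where "C = enn2real C0"
  have C: "0 \<le> C" by (simp add: C_def)
  have C0: "C0 = ennreal C"
    using A(26) unfolding C_def C0_def by simp
  have total: "phase_field_energy {a<..<b} \<phi> \<phi>inf f \<omega> \<epsilon> (u \<epsilon>) (v \<epsilon>) + ennreal (L1_norm {a<..<b} (u \<epsilon>)) \<le> ennreal C"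
    if "0 < \<epsilon>" for \<epsilon>
    unfolding C0[symmetric] C0_def by (rule SUP_upper) (use that in simp)
  have energy: "phase_field_energy {a<..<b} \<phi> \<phi>inf f \<omega> \<epsilon> (u \<epsilon>) (v \<epsilon>) \<le> ennreal C" if "0 < \<epsilon>" for \<epsilon>
    by (rule order.trans[OF _ total[OF that]]) simp
  have u_L1: "L1_norm {a<..<b} (u \<epsilon>) \<le> C" if "0 < \<epsilon>" for \<epsilon>
  proof -
    have "ennreal (L1_norm {a<..<b} (u \<epsilon>)) \<le> ennreal C"
      by (rule order.trans[OF _ total[OF that]]) simp
    then show ?thesis using C by (simp add: ennreal_le_iff)
  qed
  define e0 where "e0 k = 1 / real (Suc k)" for k
  have e0: "e0 k > 0" for k by (simp add: e0_def)
  have e0_lim: "e0 \<longlonglongrightarrow> 0"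
    unfolding e0_def using LIMSEQ_Suc[OF lim_1_over_n] by simp
  \<comment> \<open>The body of \<open>phase_field_energy_representation\<close> at
    \<open>e0 k\<close>, named for the choice of the five sequences.\<close>
  define P where "P k U V gu gv e \<longleftrightarrow> gu \<in> L2 {a<..<b} \<and> gv \<in> L2 {a<..<b} \<and> integrable ?L e \<and> (LINT x|?L. e x) \<le> C
    \<and> (\<forall>x y. U y - U x = primitive ?L gu y - primitive ?L gu x)
    \<and> (\<forall>x y. V y - V x = primitive ?L gv y - primitive ?L gv x)
    \<and> integrable ?L U \<and> (AE x in ?L. u (e0 k) x = U x) \<and> (AE x in ?L. v (e0 k) x = V x)
    \<and> (\<forall>x\<in>{a<..<b}. V x \<in> {0..1})
    \<and> (\<forall>x\<in>{a<..<b}. e x = elastic_coeff \<phi> \<phi>inf f (e0 k) (V x) * \<bar>gu x\<bar>\<^sup>2 + \<omega> (1 - V x) / (4 * e0 k) + e0 k * \<bar>gv x\<bar>\<^sup>2)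
    \<and> (\<forall>x\<in>{a<..<b}. 0 \<le> elastic_coeff \<phi> \<phi>inf f (e0 k) (V x) * \<bar>gu x\<bar>\<^sup>2)
    \<and> (\<forall>x\<in>{a<..<b}. 0 \<le> \<omega> (1 - V x) / (4 * e0 k))" for k U V gu gv e
  have "\<exists>U V gu gv e. P k U V gu gv e" for k
    unfolding P_def
    by (rule phase_field_energy_representation[OF \<open>a < b\<close> assms(3,4,5,6,9,11,13,14,17,18,21) e0 C energy[OF e0]])
  then obtain U V gu gv e where P: "\<And>k. P k (U k) (V k) (gu k) (gv k) (e k)" by metis
  have P_gu: "integrable ?L (gu k)" and P_gv: "integrable ?L (gv k)" and P_e: "integrable ?L (e k)"
    and P_eC: "(LINT x|?L. e k x) \<le> C"
    and P_U: "U k y - U k x = primitive ?L (gu k) y - primitive ?L (gu k) x"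
    and P_V: "V k y - V k x = primitive ?L (gv k) y - primitive ?L (gv k) x"
    and P_Ui: "integrable ?L (U k)" and P_u: "AE x in ?L. u (e0 k) x = U k x" and P_v: "AE x in ?L. v (e0 k) x = V k x"
    for k x y using P[of k] by (auto simp: P_def intro: L2_imp_integrable)
  have P_V01: "0 \<le> V k x" "V k x \<le> 1"
    and P_eq: "e k x = elastic_coeff \<phi> \<phi>inf f (e0 k) (V k x) * \<bar>gu k x\<bar>\<^sup>2 + \<omega> (1 - V k x) / (4 * e0 k) + e0 k * \<bar>gv k x\<bar>\<^sup>2"
    and P_nn1: "0 \<le> elastic_coeff \<phi> \<phi>inf f (e0 k) (V k x) * \<bar>gu k x\<bar>\<^sup>2"
    and P_nn2: "0 \<le> \<omega> (1 - V k x) / (4 * e0 k)" and P_nn3: "0 \<le> e0 k * \<bar>gv k x\<bar>\<^sup>2"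
    if "x \<in> {a<..<b}" for k x
    using P[of k] that e0[of k] by (auto simp: P_def)
  have e_nn: "0 \<le> e k x" if "x \<in> {a<..<b}" for k x
    using P_nn1[OF that, of k] P_nn2[OF that, of k] P_nn3[OF that, of k] unfolding P_eq[OF that, of k] by linarith
  have "\<exists>s. strict_mono (s::nat \<Rightarrow> nat) \<and> (\<exists>F. (\<forall>x. continuous (at_right x) F) \<and> mono F \<and> (\<forall>x. \<bar>F x\<bar> \<le> C) \<and>
    (\<forall>x. continuous (at x) F \<longrightarrow> (\<lambda>n. primitive ?L (e (s n)) x) \<longlonglongrightarrow> F x))"
  proof (rule Helly_selection)
    fix k x
    have "isCont (primitive ?L (e k)) x"
      by (rule isCont_primitive[OF P_e measurable_ident_lebesgue_on AE_lebesgue_on_neq])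
    then show "continuous (at_right x) (primitive ?L (e k))" by (rule continuous_at_imp_continuous_at_within)
    show "\<bar>primitive ?L (e k) x\<bar> \<le> C"
    proof -
      have "(LINT t|?L. \<bar>e k t\<bar>) = (LINT t|?L. e k t)"
        by (rule Bochner_Integration.integral_cong) (use e_nn in auto)
      then show ?thesis using abs_primitive_le[OF P_e[of k] measurable_ident_lebesgue_on, of x] P_eC[of k] by linarith
    qed
  next
    fix k show "mono (primitive ?L (e k))"
    proof (rule monoI)
      fix x y :: real assume xy: "x \<le> y"
      have "0 \<le> (LINT t|?L. e k t * indicator {x..<y} t)"
        by (intro integral_nonneg_AE AE_I2) (use e_nn in \<open>auto intro!: mult_nonneg_nonneg\<close>)
      then show "primitive ?L (e k) x \<le> primitive ?L (e k) y"
        using primitive_diff[OF P_e[of k] measurable_ident_lebesgue_on xy] by linarith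
    qed
  qed
  then obtain s1 F where s1: "strict_mono s1" and F: "\<And>x. continuous (at_right x) F" "mono F" "\<And>x. \<bar>F x\<bar> \<le> C"
    "\<And>x. isCont F x \<Longrightarrow> (\<lambda>n. primitive ?L (e (s1 n)) x) \<longlonglongrightarrow> F x" by blast
  interpret S: phase_field_sequence a b "1 / sqrt (\<phi> 1)" C C "\<lambda>k. U (s1 k)" "\<lambda>k. V (s1 k)" "\<lambda>k. gu (s1 k)"
    "\<lambda>k. gv (s1 k)" "\<lambda>k. e (s1 k)" "\<lambda>k. e0 (s1 k)" F
  proof (rule phase_field_sequence.intro)
    show "(LINT x|?L. \<bar>U (s1 k) x\<bar>) \<le> C" for k
    proof -
      have "(LINT x|?L. \<bar>U (s1 k) x\<bar>) = L1_norm {a<..<b} (u (e0 (s1 k)))"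
        unfolding L1_norm_def
      proof (rule integral_cong_AE)
        have "integrable ?L (u (e0 (s1 k)))" using A(25) e0 by (auto simp: L1_def)
        then show "(\<lambda>x. \<bar>u (e0 (s1 k)) x\<bar>) \<in> borel_measurable ?L" by auto
        show "(\<lambda>x. \<bar>U (s1 k) x\<bar>) \<in> borel_measurable ?L" using P_Ui[of "s1 k"] by auto
        show "AE x in ?L. \<bar>U (s1 k) x\<bar> = \<bar>u (e0 (s1 k)) x\<bar>" using P_u[of "s1 k"] by eventually_elim simp
      qed
      then show ?thesis using u_L1[OF e0] by simp
    qed
    show "(\<lambda>k. e0 (s1 k)) \<longlonglongrightarrow> 0" using LIMSEQ_subseq_LIMSEQ[OF e0_lim s1] by (simp add: o_def)
    fix \<eta> :: real assume \<eta>: "\<eta> > 0"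
    obtain \<delta> where \<delta>: "0 < \<delta>" "\<delta> < 1" "\<And>\<epsilon> t p r. 0 < \<epsilon> \<Longrightarrow> 1 - \<delta> \<le> t \<Longrightarrow> t \<le> 1 \<Longrightarrow> 0 \<le> r \<Longrightarrow>
      \<bar>p\<bar> \<le> 1 / sqrt (\<phi> 1) * sqrt (elastic_coeff \<phi> \<phi>inf f \<epsilon> t * \<bar>p\<bar>\<^sup>2 + \<omega> (1 - t) / (4 * \<epsilon>) + r)
        + \<eta> * (elastic_coeff \<phi> \<phi>inf f \<epsilon> t * \<bar>p\<bar>\<^sup>2 + \<omega> (1 - t) / (4 * \<epsilon>) + r)"
      using elastic_energy_controls_gradient[OF assms(3,4,7,6,9,11,14) A(16) assms(18,19,20,22) d(2,1) \<eta>] by blast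
    have "\<bar>gu (s1 k) x\<bar> \<le> 1 / sqrt (\<phi> 1) * sqrt (e (s1 k) x) + \<eta> * e (s1 k) x"
      if "x \<in> {a<..<b}" "1 - \<delta> \<le> V (s1 k) x" for k x
      unfolding P_eq[OF that(1)] by (rule \<delta>(3)[OF e0 that(2) P_V01(2)[OF that(1)] P_nn3[OF that(1)]])
    with \<delta>(1,2) show "\<exists>\<delta>. 0 < \<delta> \<and> \<delta> < 1 \<and> (\<forall>k. \<forall>x\<in>{a<..<b}. 1 - \<delta> \<le> V (s1 k) x \<longrightarrow>
        \<bar>gu (s1 k) x\<bar> \<le> 1 / sqrt (\<phi> 1) * sqrt (e (s1 k) x) + \<eta> * e (s1 k) x)" by blast
  next
    fix \<delta> :: real assume \<delta>: "0 < \<delta>" "\<delta> < 1"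
    obtain w0 where w0: "w0 > 0" "\<And>s. \<delta> / 2 \<le> s \<Longrightarrow> s \<le> 1 \<Longrightarrow> w0 \<le> \<omega> s"
      using positive_on_compact_lower_bound[OF assms(13,14,15), of "\<delta> / 2"] \<delta> by auto
    have low: "w0 \<le> \<omega> (1 - V k x)" if "x \<in> {a<..<b}" "V k x \<le> 1 - \<delta> / 2" for k x
      using w0(2)[of "1 - V k x"] that P_V01(1)[OF that(1), of k] by simp
    \<comment> \<open>The Modica-Mortola estimate: potential and gradient term of \<open>v\<close>
      together dominate a multiple of \<open>\<bar>gv\<bar>\<close> in which \<epsilon>
      cancels.\<close>
    have "sqrt w0 * \<bar>gv (s1 k) x\<bar> \<le> e (s1 k) x" if x: "x \<in> {a<..<b}" "V (s1 k) x \<le> 1 - \<delta> / 2" for k x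
    proof -
      let ?k = "s1 k"
      have "sqrt w0 * \<bar>gv ?k x\<bar> \<le> \<omega> (1 - V ?k x) / (4 * e0 ?k) + e0 ?k * \<bar>gv ?k x\<bar>\<^sup>2"
      proof (rule abs_le_of_AM_GM[OF P_nn2[OF x(1)] P_nn3[OF x(1)]])
        have "(sqrt w0)\<^sup>2 * (gv ?k x)\<^sup>2 \<le> \<omega> (1 - V ?k x) * (gv ?k x)\<^sup>2"
          using w0(1) low[OF x] by (intro mult_right_mono) auto
        also have "\<dots> = 4 * (\<omega> (1 - V ?k x) / (4 * e0 ?k) * (e0 ?k * \<bar>gv ?k x\<bar>\<^sup>2))"
          using e0[of ?k] by simp
        finally show "(sqrt w0)\<^sup>2 * (gv ?k x)\<^sup>2 \<le> 4 * (\<omega> (1 - V ?k x) / (4 * e0 ?k) * (e0 ?k * \<bar>gv ?k x\<bar>\<^sup>2))" .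
      qed (use w0(1) in simp)
      then show ?thesis using P_nn1[OF x(1), of ?k] unfolding P_eq[OF x(1), of ?k] by linarith
    qed
    then show "\<exists>m>0. \<forall>k. \<forall>x\<in>{a<..<b}. V (s1 k) x \<in> {1 - \<delta>..1 - \<delta> / 2} \<longrightarrow> m * \<bar>gv (s1 k) x\<bar> \<le> e (s1 k) x"
      using w0(1) by (intro exI[of _ "sqrt w0"]) auto
    \<comment> \<open>Multiplication by \<epsilon> turns the potential term into a quarter of
      \<omega>, which is at least \<open>w0\<close> where \<open>V\<close> stays away from
      1.\<close>
    have "w0 / 4 \<le> e0 (s1 k) * e (s1 k) x" if x: "x \<in> {a<..<b}" "V (s1 k) x \<le> 1 - \<delta> / 2" for k x
    proof -
      let ?k = "s1 k"
      have "w0 / 4 \<le> e0 ?k * (\<omega> (1 - V ?k x) / (4 * e0 ?k))" using low[OF x] e0[of ?k] by simp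
      also have "\<dots> \<le> e0 ?k * e ?k x"
        using P_nn1[OF x(1), of ?k] P_nn3[OF x(1), of ?k] e0[of ?k] unfolding P_eq[OF x(1), of ?k]
        by (intro mult_left_mono) linarith+
      finally show ?thesis .
    qed
    then show "\<exists>m>0. \<forall>k. \<forall>x\<in>{a<..<b}. V (s1 k) x \<le> 1 - \<delta> / 2 \<longrightarrow> m \<le> e0 (s1 k) * e (s1 k) x"
      using w0(1) by (intro exI[of _ "w0 / 4"]) auto
  qed (use \<open>a < b\<close> \<phi>1 C P_gu P_gv P_e e_nn P_eC P_U P_V P_Ui P_V01 e0 F in auto)
  obtain s w where s: "strict_mono s" and w: "\<And>x. x \<in> S.G \<Longrightarrow> (\<lambda>k. U (s1 (s k)) x) \<longlonglongrightarrow> w x"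
    and osc: "controlled_oscillation S.\<mu> a b (1 / sqrt (\<phi> 1)) w"
    using S.compactness by blast
  interpret W: controlled_oscillation S.\<mu> a b "1 / sqrt (\<phi> 1)" w by (rule osc)
  define ek where "ek k = e0 (s1 (s k))" for k
  have ek: "ek k > 0" for k by (simp add: ek_def e0)
  have ek_lim: "ek \<longlonglongrightarrow> 0"
    using LIMSEQ_subseq_LIMSEQ[OF e0_lim strict_mono_o[OF s1 s]] by (simp add: o_def ek_def[abs_def])
  \<comment> \<open>Membership in \<open>SBV\<close> of the whole interval includes
    integrability.\<close>
  have w_L1: "w \<in> L1 {a<..<b}" using W.SBV[of "{a<..<b}"] by (simp add: SBV_def)
  have w_GSBV: "w \<in> GSBV {a<..<b}"
    unfolding GSBV_def SBV_loc_def
  proof (intro CollectI conjI allI impI)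
    show "w \<in> borel_measurable ?L" using w_L1 by (auto simp: L1_def)
    fix N :: real and X :: "real set"
    assume X: "open X \<and> compact (closure X) \<and> closure X \<subseteq> {a<..<b}"
    interpret T: controlled_oscillation S.\<mu> a b "1 / sqrt (\<phi> 1)" "\<lambda>x. max (- N) (min N (w x))"
      by (rule controlled_oscillation_truncate[OF osc])
    show "(\<lambda>x. max (- N) (min N (w x))) \<in> SBV X"
      by (rule T.SBV) (use X closure_subset[of X] in auto)
  qed
  have ae: "AE x in ?L. (\<lambda>k. u (ek k) x) \<longlonglongrightarrow> w x \<and> (\<lambda>k. v (ek k) x) \<longlonglongrightarrow> 1"
  proof -
    \<comment> \<open>Only the countably many parameters \<open>e0 k\<close> occur, so the
      identities with the continuous representatives hold for all of them at almost every
      point.\<close>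
    have "AE x in ?L. \<forall>k. u (e0 k) x = U k x" "AE x in ?L. \<forall>k. v (e0 k) x = V k x"
      using P_u P_v by (simp_all add: AE_all_countable)
    moreover have "AE x in ?L. x \<in> S.G"
    proof -
      have "AE x in lebesgue. x \<notin> W.D"
        by (rule AE_not_in[OF iffD1[OF negligible_iff_null_sets negligible_of_countable[OF W.countable_D]]])
      then have "AE x in lebesgue. x \<in> {a<..<b} \<longrightarrow> x \<in> S.G"
        by eventually_elim (auto simp: W.D_def S.G_def)
      then show ?thesis by (subst AE_restrict_space_iff) auto
    qed
    ultimately show ?thesis
    proof eventually_elim
      case (elim x)
      have "(\<lambda>k. V (s1 (s k)) x) \<longlonglongrightarrow> 1"
        using LIMSEQ_subseq_LIMSEQ[OF S.V_lim[OF elim(3)] s] by (simp add: o_def)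
      then show ?case using w[OF elim(3)] elim(1,2) by (simp add: ek_def)
    qed
  qed
  obtain g where g: "g \<in> L2 {a<..<b}" "is_approx_gradient {a<..<b} w g" using W.approx_gradient by blast
  have conv: "(\<lambda>k. L1_norm {a<..<b} (\<lambda>x. u (ek k) x - w x)) \<longlonglongrightarrow> 0"
    if equi: "equi_integrable ?L (u ` {0<..})"
    unfolding L1_norm_def
  proof (rule equi_integrable_L1_convergence[OF L.finite_measure_axioms _ _ _ equi])
    show "integrable ?L (u (ek k))" for k using A(25) ek by (auto simp: L1_def)
    show "integrable ?L w" using w_L1 by (simp add: L1_def)
    show "AE x in ?L. (\<lambda>k. u (ek k) x) \<longlonglongrightarrow> w x" using ae by eventually_elim simp
    show "u (ek k) \<in> u ` {0<..}" for k using ek by auto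
  qed
  show ?thesis
    unfolding \<open>\<Omega> = {a<..<b}\<close>
    using ek ek_lim w_L1 w_GSBV g ae conv by (intro exI[of _ ek] exI[of _ w]) auto
qed

end
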